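(* Let $i\in\{1,2\}$. The transformation defined by $$\mathcal{T}^{(i)}_t(X) := \int^T_0 \left(\beta^{X,i}1_{[0,t)}\right)(s)\,dX_s,\quad t\in[0,T],$$ is measure-preserving, i.e. $\mathcal{T}^{(i)}(X)$ is a centered Gaussian process with $\mathcal{T}^{(i)}_0(X)=0$ a.s. and covariance function $R^{\mathcal{T}^{(i)}(X)}=R^X$. Furthermore, the process $$\mathcal{B}^{(i)}_t(X) := \int^T_0 \left(\alpha^{X,i}1_{[0,t)}\right)(s)\,dX_s,\quad t\in[0,T],$$ is a bridge of $X$ (from $0$ to $0$ on $[0,T]$).
   Context: **Process.** Fix $T>0$; $\lambda$ is Lebesgue measure. $X=(X_t)_{t\in[0,T]}$ is a continuous Volterra Gaussian process: $X_t=\int_0^t z_X(t,s)\,dW_s$ a.s., $t\in[0,T]$, with $W$ a standard Brownian motion and $z_X\in L^2([0,T]^2)$ satisfying $z_X(t,s)=0$ for $s\ge t$. The probability space $(\Omega,\mathcal F,\mathbb P)$ is the (completed) coordinate space of $X$: $\Omega=C([0,T])$, $X_t(\omega)=\omega(t)$, $\mathcal F=\mathcal F^X_T$. For a Gaussian process $Y$, $R^Y(s,t):=\mathrm{Cov}_{\mathbb P}(Y_s,Y_t)$. Standing assumptions: (i) $z_X$ is non-degenerate: $\{z_X(t,\cdot)\mid t\in(0,T]\}$ is linearly independent and generates a dense subspace of $L^2([0,T])$; (ii) $z_X(T,\cdot)\ne0$ $\lambda$-a.e.; (iii) $z_X(\cdot,s)$ has bounded variation on $[u,T]$ for all $u\in(s,T)$;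 (iv) for every $t\in(0,T]$ the equation $\mathbf K^Xf=z_X(T,\cdot)1_{[0,t)}$ has a solution $f\in\check\Lambda_T(X)$, where $(\mathbf K^Xf)(s):=f(s)z_X(T,s)+\int_s^T(f(u)-f(s))\,z_X(du,s)$, $s\in(0,T)$, and $\check\Lambda_T(X)$ is the space of $f:[0,T]\to\mathbb R$ for which $\mathbf K^Xf$ is well-defined and $\int_0^T(\mathbf K^Xf)^2(s)\,ds<\infty$. **Wiener integral.** $\Lambda_T(X)$ is the Hilbert space completion of $\mathrm{span}\{1_{[0,t)}\mid t\in(0,T]\}$ with respect to the scalar product $(1_{[0,s)},1_{[0,t)})_X:=R^X(s,t)$. $\Gamma_T(X)$ is the closure of $\mathrm{span}\{X_t\mid t\in[0,T]\}$ in $L^2(\mathbb P)$. The Wiener integral $f\mapsto\int_0^Tf(s)\,dX_s$ is the isometric isomorphism $\Lambda_T(X)\to\Gamma_T(X)$ with $1_{[0,t)}\mapsto X_t$. **Prediction martingale.** $M_t:=\mathrm E_{\mathbb P}(X_T\mid\mathcal F^X_t)=\int_0^tz_X(T,s)\,dW_s$, a continuous Gaussian martingale with strictly increasing quadratic variation $\langle M\rangle_t=\int_0^tz_X^2(T,s)\,ds$; $\langle M\rangle_{T,t}:=\langle M\rangle_T-\langle M\rangle_t$; $L^2_T(M):=L^2([0,T],d\langle M\rangle)$. **Operators.** On $L^2_T(M)$ define $$(\alpha^{M,1}f)(s)=f(s)-\tfrac1{\langle M\rangle_s}\int_0^sf(u)\,d\langle M\rangle_u,\qquad(\alpha^{M,2}f)(s)=f(s)-\tfrac1{\langle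 M\rangle_{T,s}}\int_s^Tf(u)\,d\langle M\rangle_u,$$ $$(\beta^{M,1}f)(s)=f(s)-\int_s^T\tfrac{f(u)}{\langle M\rangle_u}\,d\langle M\rangle_u,\qquad(\beta^{M,2}f)(s)=f(s)-\int_0^s\tfrac{f(u)}{\langle M\rangle_{T,u}}\,d\langle M\rangle_u.$$ Let $k(t,s):=z_X(t,s)/z_X(T,s)$ and let $\kappa:\Lambda_T(X)\to L^2_T(M)$ be the isometric isomorphism with $\kappa(1_{[0,t)})=k(t,\cdot)$, $t\in(0,T]$. Put $\alpha^{X,i}:=\kappa^{-1}\alpha^{M,i}\kappa$ and $\beta^{X,i}:=\kappa^{-1}\beta^{M,i}\kappa$ on $\Lambda_T(X)$, $i\in\{1,2\}$. **Bridge.** A process $(X^T_t)_{t\in[0,T]}$ is a bridge of $X$ (from $0$ to $0$ on $[0,T]$) if its law equals the law of $X$ conditioned on $X_T=0$; equivalently, it has the same finite-dimensional distributions as $\widehat X^T_t:=X_t-\frac{R^X(t,T)}{R^X(T,T)}X_T$, i.e. it is centered Gaussian with covariance $R^X(s,t)-\frac{R^X(s,T)R^X(t,T)}{R^X(T,T)}$. *)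

theory Defs
  imports "HOL-Probability.Probability"
begin

section \<open>Square-integrable functions\<close>

text \<open>Elements of \<open>L\<^sup>2(\<mu>)\<close> are represented by functions; equality in \<open>L\<^sup>2(\<mu>)\<close> is equality
  \<open>\<mu>\<close>-almost everywhere.\<close>

definition L2 :: "'a measure \<Rightarrow> ('a \<Rightarrow> real) set" where
  "L2 \<mu> = {f \<in> borel_measurable \<mu>. integrable \<mu> (\<lambda>x. (f x)\<^sup>2)}"

text \<open>The closure in \<open>L\<^sup>2(\<mu>)\<close> of the linear span of the family \<open>v\<^sub>t\<close>, \<open>t \<in> I\<close>.\<close>

definition L2_closed_span :: "'a measure \<Rightarrow> real set \<Rightarrow> (real \<Rightarrow> 'a \<Rightarrow> real) \<Rightarrow> ('a \<Rightarrow> real) set" where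
  "L2_closed_span \<mu> I v = {f \<in> L2 \<mu>. \<forall>e>0. \<exists>J c. finite J \<and> J \<subseteq> I \<and>
     (\<integral>x. (f x - (\<Sum>t\<in>J. c t * v t x))\<^sup>2 \<partial>\<mu>) < e}"

text \<open>\<open>K\<close> induces an isometric isomorphism from the Hilbert space \<open>'h\<close> onto the subspace \<open>S\<close> of
  \<open>L\<^sup>2(\<mu>)\<close> (a set of functions, to be read modulo null sets).\<close>

definition isometric_iso_L2 ::
    "'a measure \<Rightarrow> ('a \<Rightarrow> real) set \<Rightarrow> ('h::real_inner \<Rightarrow> 'a \<Rightarrow> real) \<Rightarrow> bool" where
  "isometric_iso_L2 \<mu> S K \<longleftrightarrow>
     (\<forall>h. K h \<in> S \<and> K h \<in> L2 \<mu>) \<and>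
     (\<forall>a b g h. AE x in \<mu>. K (a *\<^sub>R g + b *\<^sub>R h) x = a * K g x + b * K h x) \<and>
     (\<forall>g h. (\<integral>x. K g x * K h x \<partial>\<mu>) = g \<bullet> h) \<and>
     (\<forall>f\<in>S. \<exists>h. AE x in \<mu>. K h x = f x)"

section \<open>Processes indexed by \<open>[0,T]\<close>\<close>

definition cov :: "'a measure \<Rightarrow> (real \<Rightarrow> 'a \<Rightarrow> real) \<Rightarrow> real \<Rightarrow> real \<Rightarrow> real" where
  "cov P Y s t =
     (\<integral>\<omega>. (Y s \<omega> - (\<integral>\<omega>'. Y s \<omega>' \<partial>P)) * (Y t \<omega> - (\<integral>\<omega>'. Y t \<omega>' \<partial>P)) \<partial>P)"

text \<open>Constants count as (degenerate) Gaussian random variables.\<close>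

definition gaussian_rv :: "'a measure \<Rightarrow> ('a \<Rightarrow> real) \<Rightarrow> bool" where
  "gaussian_rv P Y \<longleftrightarrow> Y \<in> borel_measurable P \<and>
     ((\<exists>m. AE \<omega> in P. Y \<omega> = m) \<or> (\<exists>m \<sigma>. \<sigma> > 0 \<and> distributed P lborel Y (normal_density m \<sigma>)))"

definition centered_gaussian_process :: "'a measure \<Rightarrow> real \<Rightarrow> (real \<Rightarrow> 'a \<Rightarrow> real) \<Rightarrow> bool" where
  "centered_gaussian_process P T Y \<longleftrightarrow>
     (\<forall>J c. finite J \<and> J \<subseteq> {0..T} \<longrightarrow> gaussian_rv P (\<lambda>\<omega>. \<Sum>t\<in>J. c t * Y t \<omega>)) \<and>
     (\<forall>t\<in>{0..T}. (\<integral>\<omega>. Y t \<omega> \<partial>P) = 0)"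

definition brownian_motion :: "'a measure \<Rightarrow> real \<Rightarrow> (real \<Rightarrow> 'a \<Rightarrow> real) \<Rightarrow> bool" where
  "brownian_motion P T W \<longleftrightarrow>
     (\<forall>t\<in>{0..T}. W t \<in> borel_measurable P) \<and>
     (AE \<omega> in P. W 0 \<omega> = 0) \<and>
     (AE \<omega> in P. continuous_on {0..T} (\<lambda>t. W t \<omega>)) \<and>
     (\<forall>s t. 0 \<le> s \<and> s < t \<and> t \<le> T \<longrightarrow>
        distributed P lborel (\<lambda>\<omega>. W t \<omega> - W s \<omega>) (normal_density 0 (sqrt (t - s)))) \<and>
     (\<forall>(n::nat) (t::nat \<Rightarrow> real). 0 \<le> t 0 \<and> (\<forall>i<n. t i \<le> t (Suc i)) \<and> t n \<le> T \<longrightarrow>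
        prob_space.indep_vars P (\<lambda>_. borel) (\<lambda>i \<omega>. W (t (Suc i)) \<omega> - W (t i) \<omega>) {..<n})"

text \<open>The completed coordinate space \<open>C([0,T])\<close>; paths are extended outside \<open>[0,T]\<close> by the value
  \<open>undefined\<close> (this is what the product measurable space does).\<close>

definition coordinate_space :: "real \<Rightarrow> (real \<Rightarrow> real) measure \<Rightarrow> bool" where
  "coordinate_space T P \<longleftrightarrow> (\<exists>P0. prob_space P0 \<and>
     sets P0 = sets (restrict_space (\<Pi>\<^sub>M t\<in>{0..T}. borel) {\<omega>. continuous_on {0..T} \<omega>}) \<and>
     P = completion P0)"

definition coord :: "real \<Rightarrow> (real \<Rightarrow> real) \<Rightarrow> real" where
  "coord t \<omega> = \<omega> t"

text \<open>The law of a process on \<open>\<real>\<^bsup>[0,T]\<^esup>\<close>, i.e. the family of its finite-dimensional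
  distributions.\<close>

definition sample_path :: "real \<Rightarrow> (real \<Rightarrow> 'a \<Rightarrow> real) \<Rightarrow> 'a \<Rightarrow> real \<Rightarrow> real" where
  "sample_path T Y \<omega> = (\<lambda>t\<in>{0..T}. Y t \<omega>)"

definition path_law :: "'a measure \<Rightarrow> real \<Rightarrow> (real \<Rightarrow> 'a \<Rightarrow> real) \<Rightarrow> (real \<Rightarrow> real) measure" where
  "path_law P T Y = distr P (\<Pi>\<^sub>M t\<in>{0..T}. borel) (sample_path T Y)"

text \<open>\<open>Q x\<close> is the law of \<open>X\<close> conditioned on \<open>X\<^sub>T = x\<close>. A regular conditional law is determined only
  for almost every \<open>x\<close> with respect to the law of \<open>X\<^sub>T\<close>. As usual, the single null event
  \<open>X\<^sub>T = 0\<close> is given a meaning by taking the version that depends on \<open>x\<close> weakly continuously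
  (in the sense of finite-dimensional distributions); this version is unique when the law of
  \<open>X\<^sub>T\<close> is a non-degenerate Gaussian law, because its support is the whole line.\<close>

definition conditional_law ::
    "'a measure \<Rightarrow> real \<Rightarrow> (real \<Rightarrow> 'a \<Rightarrow> real) \<Rightarrow> (real \<Rightarrow> (real \<Rightarrow> real) measure) \<Rightarrow> bool" where
  "conditional_law P T X Q \<longleftrightarrow>
     Q \<in> measurable borel (prob_algebra (\<Pi>\<^sub>M t\<in>{0..T}. borel)) \<and>
     (\<forall>A\<in>sets (\<Pi>\<^sub>M t\<in>{0..T}. borel). \<forall>B\<in>sets borel.
        measure P {\<omega>\<in>space P. sample_path T X \<omega> \<in> A \<and> X T \<omega> \<in> B} =
        (\<integral>x. indicator B x * measure (Q x) A \<partial>distr P borel (X T))) \<and>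
     (\<forall>J (g::(real \<Rightarrow> real) \<Rightarrow> real).
        finite J \<and> J \<subseteq> {0..T} \<and> continuous_on UNIV g \<and> bounded (range g) \<longrightarrow>
        continuous_on UNIV (\<lambda>x. \<integral>\<omega>. g (restrict \<omega> J) \<partial>Q x))"

definition is_bridge ::
    "'a measure \<Rightarrow> real \<Rightarrow> (real \<Rightarrow> 'a \<Rightarrow> real) \<Rightarrow> (real \<Rightarrow> 'a \<Rightarrow> real) \<Rightarrow> bool" where
  "is_bridge P T X Y \<longleftrightarrow> (\<forall>t\<in>{0..T}. Y t \<in> borel_measurable P) \<and>
     (\<exists>Q. conditional_law P T X Q \<and> path_law P T Y = Q 0)"

section \<open>Volterra processes\<close>

text \<open>\<open>Y = \<integral>\<^sub>0\<^sup>T f dW\<close> almost surely: the isometric extension of \<open>1\<^bsub>[0,t)\<^esub> \<mapsto> W\<^sub>t\<close>.\<close>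

definition is_wiener_integral_BM ::
    "'a measure \<Rightarrow> real \<Rightarrow> (real \<Rightarrow> 'a \<Rightarrow> real) \<Rightarrow> (real \<Rightarrow> real) \<Rightarrow> ('a \<Rightarrow> real) \<Rightarrow> bool" where
  "is_wiener_integral_BM P T W f Y \<longleftrightarrow> f \<in> L2 (lebesgue_on {0..T}) \<and> Y \<in> L2 P \<and>
     (\<forall>e>0. \<exists>J c. finite J \<and> J \<subseteq> {0<..T} \<and>
        (\<integral>s. (f s - (\<Sum>t\<in>J. c t * indicator {0..<t} s))\<^sup>2 \<partial>lebesgue_on {0..T}) < e \<and>
        (\<integral>\<omega>. (Y \<omega> - (\<Sum>t\<in>J. c t * W t \<omega>))\<^sup>2 \<partial>P) < e)"

text \<open>Since \<open>z t s = 0\<close> for \<open>s \<ge> t\<close>, the integral over \<open>[0,t]\<close> may be extended to \<open>[0,T]\<close>.\<close>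

definition volterra_gaussian ::
    "'a measure \<Rightarrow> real \<Rightarrow> (real \<Rightarrow> 'a \<Rightarrow> real) \<Rightarrow> (real \<Rightarrow> real \<Rightarrow> real) \<Rightarrow> (real \<Rightarrow> 'a \<Rightarrow> real) \<Rightarrow> bool"
  where
  "volterra_gaussian P T W z X \<longleftrightarrow>
     (\<lambda>(t, s). z t s) \<in> L2 (lebesgue_on ({0..T} \<times> {0..T})) \<and>
     (\<forall>t\<in>{0..T}. \<forall>s\<in>{0..T}. t \<le> s \<longrightarrow> z t s = 0) \<and>
     (\<forall>t\<in>{0..T}. is_wiener_integral_BM P T W (z t) (X t))"

definition nondegenerate_kernel :: "real \<Rightarrow> (real \<Rightarrow> real \<Rightarrow> real) \<Rightarrow> bool" where
  "nondegenerate_kernel T z \<longleftrightarrow>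
     (\<forall>J c. finite J \<and> J \<subseteq> {0<..T} \<and> (AE s in lebesgue_on {0..T}. (\<Sum>t\<in>J. c t * z t s) = 0)
        \<longrightarrow> (\<forall>t\<in>J. c t = 0)) \<and>
     L2_closed_span (lebesgue_on {0..T}) {0<..T} z = L2 (lebesgue_on {0..T})"

definition bounded_variation_on :: "real \<Rightarrow> real \<Rightarrow> (real \<Rightarrow> real) \<Rightarrow> bool" where
  "bounded_variation_on a b g \<longleftrightarrow> (\<exists>V. \<forall>(n::nat) (x::nat \<Rightarrow> real).
     (\<forall>i\<le>n. x i \<in> {a..b}) \<and> (\<forall>i<n. x i \<le> x (Suc i)) \<longrightarrow> (\<Sum>i<n. \<bar>g (x (Suc i)) - g (x i)\<bar>) \<le> V)"

text \<open>The Lebesgue--Stieltjes integral \<open>\<integral>\<^bsub>(a,b]\<^esub> \<phi>(u) g(du)\<close> for \<open>g\<close> of bounded variation on \<open>[u,b]\<close>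
  for all \<open>u \<in> (a,b)\<close>. The signed measure \<open>g(du)\<close> has \<open>g(du)((c,d]) = g(d+) - g(c+)\<close>, where \<open>g\<close> is
  continued as a constant to the right of \<open>b\<close>; its total mass near \<open>a\<close> may be infinite. It is
  written as a difference \<open>p - n\<close> of two positive measures; the value of the integral does not
  depend on the choice of this decomposition.\<close>

definition right_lim :: "real \<Rightarrow> (real \<Rightarrow> real) \<Rightarrow> real \<Rightarrow> real" where
  "right_lim b g x = Lim (at_right x) (\<lambda>u. g (min u b))"

definition has_stieltjes_integral ::
    "real \<Rightarrow> real \<Rightarrow> (real \<Rightarrow> real) \<Rightarrow> (real \<Rightarrow> real) \<Rightarrow> real \<Rightarrow> bool" where
  "has_stieltjes_integral a b g \<phi> I \<longleftrightarrow> (\<exists>p n :: real measure.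
     sets p = sets borel \<and> sets n = sets borel \<and>
     (\<forall>u\<in>{a<..<b}. emeasure p {u..b} < \<infinity> \<and> emeasure n {u..b} < \<infinity>) \<and>
     (\<forall>c d. a < c \<and> c < d \<and> d \<le> b \<longrightarrow>
        measure p {c<..d} - measure n {c<..d} = right_lim b g d - right_lim b g c) \<and>
     set_integrable (completion p) {a<..b} \<phi> \<and> set_integrable (completion n) {a<..b} \<phi> \<and>
     I = (LINT u:{a<..b}|completion p. \<phi> u) - (LINT u:{a<..b}|completion n. \<phi> u))"

definition K_op :: "real \<Rightarrow> (real \<Rightarrow> real \<Rightarrow> real) \<Rightarrow> (real \<Rightarrow> real) \<Rightarrow> real \<Rightarrow> real" where
  "K_op T z f s = f s * z T s +
     (THE I. has_stieltjes_integral s T (\<lambda>u. z u s) (\<lambda>u. f u - f s) I)"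

definition Lambda_check :: "real \<Rightarrow> (real \<Rightarrow> real \<Rightarrow> real) \<Rightarrow> (real \<Rightarrow> real) set" where
  "Lambda_check T z = {f.
     (AE s in lebesgue_on {0<..<T}.
        \<exists>I. has_stieltjes_integral s T (\<lambda>u. z u s) (\<lambda>u. f u - f s) I) \<and>
     K_op T z f \<in> L2 (lebesgue_on {0<..<T})}"

section \<open>The space \<open>\<Lambda>\<^sub>T(X)\<close> and the Wiener integral\<close>

definition step_functions :: "real \<Rightarrow> (real \<Rightarrow> real) set" where
  "step_functions T = {\<lambda>s. \<Sum>t\<in>J. c t * indicator {0..<t} s | J c. finite J \<and> J \<subseteq> {0<..T}}"

text \<open>A Hilbert space completion of the step functions with respect to \<open>(\<cdot>,\<cdot>)\<^sub>X\<close> is unique only up to a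
  unique isometric isomorphism. We let \<open>'h\<close> be any realization of it and \<open>\<iota>\<close> the embedding of
  the step functions (the value of \<open>\<iota>\<close> elsewhere is irrelevant).\<close>

definition is_Lambda ::
    "'a measure \<Rightarrow> real \<Rightarrow> (real \<Rightarrow> 'a \<Rightarrow> real) \<Rightarrow>
     ((real \<Rightarrow> real) \<Rightarrow> 'h::{real_inner, complete_space}) \<Rightarrow> bool" where
  "is_Lambda P T X \<iota> \<longleftrightarrow>
     (\<forall>a b. \<forall>f\<in>step_functions T. \<forall>g\<in>step_functions T.
        \<iota> (\<lambda>s. a * f s + b * g s) = a *\<^sub>R \<iota> f + b *\<^sub>R \<iota> g) \<and>
     (\<forall>s\<in>{0<..T}. \<forall>t\<in>{0<..T}. \<iota> (indicator {0..<s}) \<bullet> \<iota> (indicator {0..<t}) = cov P X s t) \<and>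
     closure (\<iota> ` step_functions T) = UNIV"

text \<open>The Wiener integral \<open>\<integral>\<^sub>0\<^sup>T h dX\<close>, a random variable determined up to almost sure equality,
  for \<open>h\<close> in the completion.\<close>

definition wiener_integral ::
    "'a measure \<Rightarrow> real \<Rightarrow> (real \<Rightarrow> 'a \<Rightarrow> real) \<Rightarrow>
     ((real \<Rightarrow> real) \<Rightarrow> 'h::{real_inner, complete_space}) \<Rightarrow> 'h \<Rightarrow> 'a \<Rightarrow> real" where
  "wiener_integral P T X \<iota> = (SOME K.
     isometric_iso_L2 P (L2_closed_span P {0..T} X) K \<and>
     (\<forall>t\<in>{0<..T}. AE \<omega> in P. K (\<iota> (indicator {0..<t})) \<omega> = X t \<omega>))"

section \<open>The operators\<close>

text \<open>The bracket \<open>\<langle>M\<rangle>\<close> of the prediction martingale and the measure \<open>d\<langle>M\<rangle>\<close> on \<open>[0,T]\<close>.\<close>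

definition bracket :: "real \<Rightarrow> (real \<Rightarrow> real \<Rightarrow> real) \<Rightarrow> real \<Rightarrow> real" where
  "bracket T z t = (\<integral>s. (z T s)\<^sup>2 \<partial>lebesgue_on {0..t})"

definition d_bracket :: "real \<Rightarrow> (real \<Rightarrow> real \<Rightarrow> real) \<Rightarrow> real measure" where
  "d_bracket T z = density (lebesgue_on {0..T}) (\<lambda>s. ennreal ((z T s)\<^sup>2))"

definition alpha_M1 :: "real \<Rightarrow> (real \<Rightarrow> real \<Rightarrow> real) \<Rightarrow> (real \<Rightarrow> real) \<Rightarrow> real \<Rightarrow> real" where
  "alpha_M1 T z f s = f s - 1 / bracket T z s * (LINT u:{0..s}|d_bracket T z. f u)"

definition alpha_M2 :: "real \<Rightarrow> (real \<Rightarrow> real \<Rightarrow> real) \<Rightarrow> (real \<Rightarrow> real) \<Rightarrow> real \<Rightarrow> real" where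
  "alpha_M2 T z f s =
     f s - 1 / (bracket T z T - bracket T z s) * (LINT u:{s..T}|d_bracket T z. f u)"

definition beta_M1 :: "real \<Rightarrow> (real \<Rightarrow> real \<Rightarrow> real) \<Rightarrow> (real \<Rightarrow> real) \<Rightarrow> real \<Rightarrow> real" where
  "beta_M1 T z f s = f s - (LINT u:{s..T}|d_bracket T z. f u / bracket T z u)"

definition beta_M2 :: "real \<Rightarrow> (real \<Rightarrow> real \<Rightarrow> real) \<Rightarrow> (real \<Rightarrow> real) \<Rightarrow> real \<Rightarrow> real" where
  "beta_M2 T z f s =
     f s - (LINT u:{0..s}|d_bracket T z. f u / (bracket T z T - bracket T z u))"

definition alpha_M ::
    "nat \<Rightarrow> real \<Rightarrow> (real \<Rightarrow> real \<Rightarrow> real) \<Rightarrow> (real \<Rightarrow> real) \<Rightarrow> real \<Rightarrow> real" where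
  "alpha_M i = (if i = 1 then alpha_M1 else alpha_M2)"

definition beta_M ::
    "nat \<Rightarrow> real \<Rightarrow> (real \<Rightarrow> real \<Rightarrow> real) \<Rightarrow> (real \<Rightarrow> real) \<Rightarrow> real \<Rightarrow> real" where
  "beta_M i = (if i = 1 then beta_M1 else beta_M2)"

definition kappa ::
    "real \<Rightarrow> (real \<Rightarrow> real \<Rightarrow> real) \<Rightarrow>
     ((real \<Rightarrow> real) \<Rightarrow> 'h::{real_inner, complete_space}) \<Rightarrow> 'h \<Rightarrow> real \<Rightarrow> real" where
  "kappa T z \<iota> = (SOME K.
     isometric_iso_L2 (d_bracket T z) (L2 (d_bracket T z)) K \<and>
     (\<forall>t\<in>{0<..T}. AE s in d_bracket T z. K (\<iota> (indicator {0..<t})) s = z t s / z T s))"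

definition kappa_inv ::
    "real \<Rightarrow> (real \<Rightarrow> real \<Rightarrow> real) \<Rightarrow>
     ((real \<Rightarrow> real) \<Rightarrow> 'h::{real_inner, complete_space}) \<Rightarrow> (real \<Rightarrow> real) \<Rightarrow> 'h" where
  "kappa_inv T z \<iota> f = (THE h. AE s in d_bracket T z. kappa T z \<iota> h s = f s)"

definition alpha_X ::
    "nat \<Rightarrow> real \<Rightarrow> (real \<Rightarrow> real \<Rightarrow> real) \<Rightarrow>
     ((real \<Rightarrow> real) \<Rightarrow> 'h::{real_inner, complete_space}) \<Rightarrow> 'h \<Rightarrow> 'h" where
  "alpha_X i T z \<iota> h = kappa_inv T z \<iota> (alpha_M i T z (kappa T z \<iota> h))"

definition beta_X ::
    "nat \<Rightarrow> real \<Rightarrow> (real \<Rightarrow> real \<Rightarrow> real) \<Rightarrow>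
     ((real \<Rightarrow> real) \<Rightarrow> 'h::{real_inner, complete_space}) \<Rightarrow> 'h \<Rightarrow> 'h" where
  "beta_X i T z \<iota> h = kappa_inv T z \<iota> (beta_M i T z (kappa T z \<iota> h))"

definition T_process ::
    "nat \<Rightarrow> 'a measure \<Rightarrow> real \<Rightarrow> (real \<Rightarrow> real \<Rightarrow> real) \<Rightarrow> (real \<Rightarrow> 'a \<Rightarrow> real) \<Rightarrow>
     ((real \<Rightarrow> real) \<Rightarrow> 'h::{real_inner, complete_space}) \<Rightarrow> real \<Rightarrow> 'a \<Rightarrow> real" where
  "T_process i P T z X \<iota> t = wiener_integral P T X \<iota> (beta_X i T z \<iota> (\<iota> (indicator {0..<t})))"

definition B_process ::
    "nat \<Rightarrow> 'a measure \<Rightarrow> real \<Rightarrow> (real \<Rightarrow> real \<Rightarrow> real) \<Rightarrow> (real \<Rightarrow> 'a \<Rightarrow> real) \<Rightarrow>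
     ((real \<Rightarrow> real) \<Rightarrow> 'h::{real_inner, complete_space}) \<Rightarrow> real \<Rightarrow> 'a \<Rightarrow> real" where
  "B_process i P T z X \<iota> t = wiener_integral P T X \<iota> (alpha_X i T z \<iota> (\<iota> (indicator {0..<t})))"

end

theory Submission
  imports Defs
begin

text \<open>
  Write \<open>H\<close> for the Hilbert space \<open>\<Lambda>\<^sub>T(X)\<close> and \<open>e\<^sub>t \<in> H\<close> for the class of \<open>1\<^bsub>[0,t)\<^esub>\<close>. The Wiener
  integral is an isometry from \<open>H\<close> onto the Gaussian space of \<open>X\<close>, so \<open>\<integral> h\<^sub>t dX\<close> is a centered Gaussian
  process with covariance \<open>h\<^sub>s \<bullet> h\<^sub>t\<close>, and \<open>X\<close> itself is the case \<open>h\<^sub>t = e\<^sub>t\<close>. The map \<open>\<kappa>\<close> is an isometry from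
  \<open>H\<close> onto \<open>L\<^sup>2(d\<langle>M\<rangle>)\<close>. The theorem is therefore a statement about inner products in \<open>L\<^sup>2(d\<langle>M\<rangle>)\<close>: with
  \<open>c = \<langle>M\<rangle>\<^sub>T\<close>,
    \<open>(\<beta> f, \<beta> g) = (f, g)\<close> and \<open>(\<alpha> f, \<alpha> g) = (f, g) - (\<integral> f d\<langle>M\<rangle>) (\<integral> g d\<langle>M\<rangle>) / c\<close>.
  As \<open>\<kappa> e\<^sub>T = 1\<close>, the integral of \<open>\<kappa> h\<close> is \<open>h \<bullet> e\<^sub>T\<close> and \<open>c = e\<^sub>T \<bullet> e\<^sub>T\<close>; hence the first identity says that
  \<open>\<T>(X)\<close> has the covariance of \<open>X\<close>, and the second one that \<open>\<B>(X)\<close> has the covariance of the bridge.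

  For the two identities, let \<open>F\<close> be \<open>\<langle>M\<rangle>\<close> in the case \<open>i = 1\<close> and \<open>\<langle>M\<rangle>\<^sub>T - \<langle>M\<rangle>\<close> in the case \<open>i = 2\<close>. Measured
  by the clock \<open>F\<close>, the measure \<open>d\<langle>M\<rangle>\<close> is Lebesgue measure on \<open>[0,c]\<close>. Let \<open>A\<close> be the operator with the kernel
  \<open>w(s,u) = 1\<^bsub>{F(s) \<le> F(u)}\<^esub> / F(u)\<close>. Then \<open>\<beta> = I - A\<close> and \<open>\<alpha> = I - A\<^sup>*\<close>. The operators \<open>A + A\<^sup>*\<close> and \<open>A\<^sup>* A\<close> both
  have the kernel \<open>1 / max(F(u), F(v))\<close>, while \<open>A A\<^sup>*\<close> has the kernel \<open>1 / max(F(u), F(v)) - 1 / c\<close>. Expanding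
  \<open>\<beta>\<^sup>* \<beta>\<close> and \<open>\<alpha>\<^sup>* \<alpha>\<close> gives the identities (\<open>beta_isometry\<close>, \<open>alpha_Gram\<close>). Fubini's theorem is applicable because
  Schur's test bounds the kernel \<open>1 / max\<close> on \<open>L\<^sup>2\<close> (\<open>kernel_integrable\<close>).

  Both isometries exist because Gram matrices agree (\<open>closed_span_isometry_exists\<close>). Linear combinations of \<open>X\<close>
  are \<open>L\<^sup>2\<close>-limits of linear combinations of Brownian increments, and centered Gaussian characteristic functions
  survive such limits (\<open>gaussian_char_L2_limit\<close>). A process law is determined by the characteristic functions of
  all linear combinations (\<open>law_unique_by_linear_combinations\<close>), so equality of covariances gives equality of
  laws. The same principle identifies the conditional law of \<open>X\<close>: on the product of two copies of the
  probability space, the process \<open>B\<^sub>t(\<omega>) + r\<^sub>t X\<^sub>T(\<omega>')\<close> with \<open>r\<^sub>t = R(t,T) / R(T,T)\<close> has the law of \<open>X\<close>, and its value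
  at \<open>T\<close> is \<open>X\<^sub>T(\<omega>')\<close>. This disintegrates the law of \<open>X\<close> along \<open>X\<^sub>T\<close> (\<open>bridge_by_covariance\<close>).
\<close>

section \<open>Square-integrable functions\<close>

text \<open>Padding the coefficients with zeros brings two finite linear combinations to a common index
  set. Thus the limits of combinations of a given family are again closed under linear combinations.\<close>

lemma lincomb_union:
  fixes g :: "'i \<Rightarrow> 'v::real_vector"
  assumes "finite J" "finite J'"
  shows "(\<Sum>t\<in>J \<union> J'. (a * (if t \<in> J then c t else 0) + b * (if t \<in> J' then c' t else 0)) *\<^sub>R g t) =
    a *\<^sub>R (\<Sum>t\<in>J. c t *\<^sub>R g t) + b *\<^sub>R (\<Sum>t\<in>J'. c' t *\<^sub>R g t)"
proof -
  have "(\<Sum>t\<in>J \<union> J'. (if t \<in> J then c t else 0) *\<^sub>R g t) = (\<Sum>t\<in>J. c t *\<^sub>R g t)"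
    using assms by (intro sum.mono_neutral_cong_right) auto
  moreover have "(\<Sum>t\<in>J \<union> J'. (if t \<in> J' then c' t else 0) *\<^sub>R g t) = (\<Sum>t\<in>J'. c' t *\<^sub>R g t)"
    using assms by (intro sum.mono_neutral_cong_right) auto
  ultimately show ?thesis
    by (simp only: scaleR_add_left sum.distrib scaleR_scaleR[symmetric] scaleR_sum_right[symmetric])
qed

lemmas lincomb_union_real = lincomb_union[where 'v = real, unfolded real_scaleR_def]

lemma all_pos_square_iff: "(\<forall>e>0. Q (e\<^sup>2)) \<longleftrightarrow> (\<forall>e>0. Q e)" for Q :: "real \<Rightarrow> bool"
proof (intro iffI allI impI)
  fix e :: real assume "\<forall>e>0. Q (e\<^sup>2)" "e > 0"
  then have "Q ((sqrt e)\<^sup>2)" using real_sqrt_gt_0_iff by blast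
  then show "Q e" using \<open>e > 0\<close> by simp
next
  fix e :: real assume "\<forall>e>0. Q e" "e > 0"
  then show "Q (e\<^sup>2)" using zero_less_power by blast
qed

lemma small_radius_exists:
  fixes a b e :: real
  assumes "e > 0"
  obtains r where "r > 0" "\<bar>a\<bar> * r + \<bar>b\<bar> * r < e"
proof
  let ?r = "e / (\<bar>a\<bar> + \<bar>b\<bar> + 1)"
  have pos: "\<bar>a\<bar> + \<bar>b\<bar> + 1 > 0" by linarith
  then show "?r > 0" using assms by simp
  have "?r * (\<bar>a\<bar> + \<bar>b\<bar> + 1) = e" using pos by simp
  then show "\<bar>a\<bar> * ?r + \<bar>b\<bar> * ?r < e" using \<open>?r > 0\<close> by (simp only: distrib_left mult_1_right mult.commute[of _ ?r])
qed

definition L2_norm :: "'a measure \<Rightarrow> ('a \<Rightarrow> real) \<Rightarrow> real" where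
  "L2_norm \<mu> f = sqrt (LINT x|\<mu>. (f x)\<^sup>2)"

lemma L2_D:
  assumes "f \<in> L2 \<mu>"
  shows "f \<in> borel_measurable \<mu>" "integrable \<mu> (\<lambda>x. (f x)\<^sup>2)"
  using assms by (auto simp: L2_def)

lemma L2_I: "f \<in> borel_measurable \<mu> \<Longrightarrow> integrable \<mu> (\<lambda>x. (f x)\<^sup>2) \<Longrightarrow> f \<in> L2 \<mu>"
  by (auto simp: L2_def)

lemma L2_mult_integrable:
  assumes "f \<in> L2 \<mu>" "g \<in> L2 \<mu>"
  shows "integrable \<mu> (\<lambda>x. f x * g x)"
proof (rule Bochner_Integration.integrable_bound)
  show "integrable \<mu> (\<lambda>x. (f x)\<^sup>2 + (g x)\<^sup>2)"
    using assms by (simp add: L2_D)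
  show "(\<lambda>x. f x * g x) \<in> borel_measurable \<mu>"
    using assms by (intro borel_measurable_times L2_D(1))
  have "\<bar>a * b\<bar> \<le> a\<^sup>2 + b\<^sup>2" for a b :: real
  proof -
    have "2 * \<bar>a * b\<bar> \<le> a\<^sup>2 + b\<^sup>2"
      using sum_squares_bound[of "\<bar>a\<bar>" "\<bar>b\<bar>"] by (simp add: abs_mult)
    then show ?thesis by linarith
  qed
  then show "AE x in \<mu>. norm (f x * g x) \<le> norm ((f x)\<^sup>2 + (g x)\<^sup>2)"
    by (simp add: abs_of_nonneg)
qed

lemma L2_lincomb:
  assumes "f \<in> L2 \<mu>" "g \<in> L2 \<mu>"
  shows "(\<lambda>x. a * f x + b * g x) \<in> L2 \<mu>"
proof (rule L2_I)
  show "(\<lambda>x. a * f x + b * g x) \<in> borel_measurable \<mu>"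
    using assms by (intro borel_measurable_add borel_measurable_times borel_measurable_const L2_D(1))
  have "integrable \<mu> (\<lambda>x. a\<^sup>2 * (f x)\<^sup>2 + (2 * a * b) * (f x * g x) + b\<^sup>2 * (g x)\<^sup>2)"
    using assms L2_mult_integrable[OF assms] by (simp add: L2_D)
  then show "integrable \<mu> (\<lambda>x. (a * f x + b * g x)\<^sup>2)"
    by (simp add: power2_eq_square algebra_simps)
qed

lemma L2_add: "f \<in> L2 \<mu> \<Longrightarrow> g \<in> L2 \<mu> \<Longrightarrow> (\<lambda>x. f x + g x) \<in> L2 \<mu>"
  using L2_lincomb[of f \<mu> g 1 1] by simp

lemma L2_diff: "f \<in> L2 \<mu> \<Longrightarrow> g \<in> L2 \<mu> \<Longrightarrow> (\<lambda>x. f x - g x) \<in> L2 \<mu>"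
  using L2_lincomb[of f \<mu> g 1 "-1"] by simp

lemma L2_cmult: "f \<in> L2 \<mu> \<Longrightarrow> (\<lambda>x. a * f x) \<in> L2 \<mu>"
  using L2_lincomb[of f \<mu> f a 0] by simp

lemma L2_zero: "(\<lambda>x. 0) \<in> L2 \<mu>"
  by (simp add: L2_def)

lemma L2_sum:
  "(\<And>t. t \<in> J \<Longrightarrow> f t \<in> L2 \<mu>) \<Longrightarrow> (\<lambda>x. \<Sum>t\<in>J. c t * f t x) \<in> L2 \<mu>"
  by (induction J rule: infinite_finite_induct)
     (simp_all add: L2_zero L2_add[OF L2_cmult])

lemma L2_cong_AE:
  assumes "f \<in> L2 \<mu>" "g \<in> borel_measurable \<mu>" "AE x in \<mu>. f x = g x"
  shows "g \<in> L2 \<mu>"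
proof (rule L2_I)
  show "integrable \<mu> (\<lambda>x. (g x)\<^sup>2)"
    by (rule Bochner_Integration.integrable_cong_AE_imp[of \<mu> "\<lambda>x. (f x)\<^sup>2"])
       (use assms in \<open>auto simp: L2_D\<close>)
qed fact

lemma L2_integrable:
  assumes "finite_measure \<mu>" "f \<in> L2 \<mu>"
  shows "integrable \<mu> f"
proof -
  interpret finite_measure \<mu> by fact
  have "(\<lambda>x. 1) \<in> L2 \<mu>" by (simp add: L2_def)
  from L2_mult_integrable[OF assms(2) this] show ?thesis by simp
qed

lemma L2_norm_nonneg [simp]: "0 \<le> L2_norm \<mu> f"
  by (simp add: L2_norm_def)

lemma L2_norm_power2: "(L2_norm \<mu> f)\<^sup>2 = (LINT x|\<mu>. (f x)\<^sup>2)"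
  by (simp add: L2_norm_def)

lemma L2_norm_less_iff: "e > 0 \<Longrightarrow> L2_norm \<mu> f < e \<longleftrightarrow> (LINT x|\<mu>. (f x)\<^sup>2) < e\<^sup>2"
  unfolding L2_norm_def by (subst real_sqrt_less_iff[symmetric, of _ "e\<^sup>2"]) simp

lemma L2_norm_lincomb_power2:
  assumes "f \<in> L2 \<mu>" "g \<in> L2 \<mu>"
  shows "(L2_norm \<mu> (\<lambda>x. a * f x + b * g x))\<^sup>2 =
    a\<^sup>2 * (L2_norm \<mu> f)\<^sup>2 + 2 * a * b * (LINT x|\<mu>. f x * g x) + b\<^sup>2 * (L2_norm \<mu> g)\<^sup>2"
proof -
  have "(LINT x|\<mu>. (a * f x + b * g x)\<^sup>2) =
    (LINT x|\<mu>. a\<^sup>2 * (f x)\<^sup>2 + (2 * a * b) * (f x * g x) + b\<^sup>2 * (g x)\<^sup>2)"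
    by (simp add: power2_eq_square algebra_simps)
  also have "\<dots> = a\<^sup>2 * (LINT x|\<mu>. (f x)\<^sup>2) + (2 * a * b) * (LINT x|\<mu>. f x * g x) + b\<^sup>2 * (LINT x|\<mu>. (g x)\<^sup>2)"
    using assms L2_mult_integrable[OF assms] by (simp add: L2_D)
  finally show ?thesis by (simp add: L2_norm_power2)
qed

lemma L2_Cauchy_Schwarz:
  assumes "f \<in> L2 \<mu>" "g \<in> L2 \<mu>"
  shows "\<bar>\<integral>x. f x * g x \<partial>\<mu>\<bar> \<le> L2_norm \<mu> f * L2_norm \<mu> g"
proof -
  let ?F = "L2_norm \<mu> f" and ?G = "L2_norm \<mu> g" and ?I = "\<integral>x. f x * g x \<partial>\<mu>"
  have *: "0 \<le> a\<^sup>2 * ?F\<^sup>2 + 2 * a * b * ?I + b\<^sup>2 * ?G\<^sup>2" for a b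
    using L2_norm_lincomb_power2[OF assms, of a b] by (metis zero_le_power2)
  have "?I\<^sup>2 \<le> ?F\<^sup>2 * ?G\<^sup>2"
  proof (cases "?F = 0")
    case True
    have "?I = 0"
    proof (rule ccontr)
      assume "?I \<noteq> 0"
      moreover have "0 \<le> 2 * a * ?I + ?G\<^sup>2" for a using *[of a 1] True by simp
      from this[of "- (?G\<^sup>2 + 1) / (2 * ?I)"] \<open>?I \<noteq> 0\<close> show False by (simp add: field_simps)
    qed
    then show ?thesis by simp
  next
    case False
    have "0 \<le> (-?I)\<^sup>2 * ?F\<^sup>2 + 2 * (-?I) * ?F\<^sup>2 * ?I + (?F\<^sup>2)\<^sup>2 * ?G\<^sup>2" by (rule *)
    also have "\<dots> = ?F\<^sup>2 * (?F\<^sup>2 * ?G\<^sup>2 - ?I\<^sup>2)" by (simp add: power2_eq_square algebra_simps)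
    finally show ?thesis using False by (simp add: zero_le_mult_iff)
  qed
  then have "\<bar>?I\<bar>\<^sup>2 \<le> (?F * ?G)\<^sup>2" by (simp add: power_mult_distrib)
  then show ?thesis by (rule power2_le_imp_le) simp
qed

lemma L2_norm_triangle:
  assumes "f \<in> L2 \<mu>" "g \<in> L2 \<mu>"
  shows "L2_norm \<mu> (\<lambda>x. f x + g x) \<le> L2_norm \<mu> f + L2_norm \<mu> g"
proof (rule power2_le_imp_le)
  show "(L2_norm \<mu> (\<lambda>x. f x + g x))\<^sup>2 \<le> (L2_norm \<mu> f + L2_norm \<mu> g)\<^sup>2"
    using L2_norm_lincomb_power2[OF assms, of 1 1] L2_Cauchy_Schwarz[OF assms]
    by (simp add: power2_sum)
qed simp

lemma L2_norm_cmult: "L2_norm \<mu> (\<lambda>x. a * f x) = \<bar>a\<bar> * L2_norm \<mu> f"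
  by (simp add: L2_norm_def power_mult_distrib real_sqrt_mult)

lemma L2_norm_minus_commute: "L2_norm \<mu> (\<lambda>x. f x - g x) = L2_norm \<mu> (\<lambda>x. g x - f x)"
  by (simp add: L2_norm_def power2_commute)

lemma L2_norm_triangle_diff:
  assumes "f \<in> L2 \<mu>" "g \<in> L2 \<mu>" "h \<in> L2 \<mu>"
  shows "L2_norm \<mu> (\<lambda>x. f x - h x) \<le> L2_norm \<mu> (\<lambda>x. f x - g x) + L2_norm \<mu> (\<lambda>x. g x - h x)"
  using L2_norm_triangle[OF L2_diff[OF assms(1,2)] L2_diff[OF assms(2,3)]] by simp

text \<open>The bound matches \<open>small_radius_exists\<close>: approximations within \<open>r\<close> of two functions combine
  to an approximation within \<open>e\<close> of their linear combination.\<close>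

lemma L2_norm_lincomb_diff_less:
  assumes "f \<in> L2 \<mu>" "f' \<in> L2 \<mu>" "g \<in> L2 \<mu>" "g' \<in> L2 \<mu>"
    and "L2_norm \<mu> (\<lambda>x. f x - f' x) < r" "L2_norm \<mu> (\<lambda>x. g x - g' x) < r" "\<bar>a\<bar> * r + \<bar>b\<bar> * r < e"
  shows "L2_norm \<mu> (\<lambda>x. (a * f x + b * g x) - (a * f' x + b * g' x)) < e"
proof -
  have "L2_norm \<mu> (\<lambda>x. (a * f x + b * g x) - (a * f' x + b * g' x)) =
     L2_norm \<mu> (\<lambda>x. a * (f x - f' x) + b * (g x - g' x))"
    by (rule arg_cong[where f = "L2_norm \<mu>"]) (auto simp: algebra_simps)
  also have "\<dots> \<le> \<bar>a\<bar> * L2_norm \<mu> (\<lambda>x. f x - f' x) + \<bar>b\<bar> * L2_norm \<mu> (\<lambda>x. g x - g' x)"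
    using L2_norm_triangle[OF L2_cmult[OF L2_diff[OF assms(1,2)], of a] L2_cmult[OF L2_diff[OF assms(3,4)], of b]]
    by (simp only: L2_norm_cmult)
  also have "\<dots> \<le> \<bar>a\<bar> * r + \<bar>b\<bar> * r" using assms(5,6) by (intro add_mono mult_left_mono) auto
  finally show ?thesis using assms(7) by simp
qed

lemma L2_norm_diff_abs:
  assumes "f \<in> L2 \<mu>" "g \<in> L2 \<mu>"
  shows "\<bar>L2_norm \<mu> f - L2_norm \<mu> g\<bar> \<le> L2_norm \<mu> (\<lambda>x. f x - g x)"
  using L2_norm_triangle_diff[OF assms L2_zero] L2_norm_triangle_diff[OF assms(2,1) L2_zero]
    L2_norm_minus_commute[of \<mu> f g] by simp

lemma L2_norm_eq_0:
  assumes "f \<in> L2 \<mu>" "L2_norm \<mu> f = 0"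
  shows "AE x in \<mu>. f x = 0"
  using assms integral_nonneg_eq_0_iff_AE[of \<mu> "\<lambda>x. (f x)\<^sup>2"] by (auto simp: L2_norm_def L2_D)

lemma L2_norm_cong_AE:
  assumes "AE x in \<mu>. f x = g x" "f \<in> borel_measurable \<mu>" "g \<in> borel_measurable \<mu>"
  shows "L2_norm \<mu> f = L2_norm \<mu> g"
  unfolding L2_norm_def
  by (rule arg_cong[where f = sqrt], rule integral_cong_AE) (use assms in auto)

lemma L1_le_L2_norm:
  assumes "finite_measure \<mu>" "f \<in> L2 \<mu>"
  shows "(LINT x|\<mu>. \<bar>f x\<bar>) \<le> L2_norm \<mu> f * sqrt (measure \<mu> (space \<mu>))"
proof -
  interpret finite_measure \<mu> by fact
  have "(\<lambda>x. 1) \<in> L2 \<mu>" "(\<lambda>x. \<bar>f x\<bar>) \<in> L2 \<mu>" using assms(2) by (auto simp: L2_def)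
  from L2_Cauchy_Schwarz[OF this(2,1)] show ?thesis by (simp add: L2_norm_def)
qed

lemma L2_norm_Fatou:
  assumes "\<And>n. u n \<in> L2 \<mu>" "f \<in> borel_measurable \<mu>" "AE x in \<mu>. (\<lambda>n. u n x) \<longlonglongrightarrow> f x"
    and bound: "\<And>n. L2_norm \<mu> (u n) \<le> b"
  shows "f \<in> L2 \<mu> \<and> L2_norm \<mu> f \<le> b"
proof -
  have m: "u n \<in> borel_measurable \<mu>" for n using assms(1) by (rule L2_D)
  have b0: "0 \<le> b" using bound[of 0] L2_norm_nonneg order_trans by blast
  have nn: "(\<integral>\<^sup>+x. ennreal ((u n x)\<^sup>2) \<partial>\<mu>) \<le> ennreal (b\<^sup>2)" for n
  proof -
    have "(\<integral>\<^sup>+x. ennreal ((u n x)\<^sup>2) \<partial>\<mu>) = ennreal ((L2_norm \<mu> (u n))\<^sup>2)"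
      using assms(1)[of n] by (simp add: L2_norm_power2 nn_integral_eq_integral L2_D)
    also have "\<dots> \<le> ennreal (b\<^sup>2)"
      using bound[of n] by (intro ennreal_leI power_mono) auto
    finally show ?thesis .
  qed
  have "(\<integral>\<^sup>+x. ennreal ((f x)\<^sup>2) \<partial>\<mu>) = (\<integral>\<^sup>+x. liminf (\<lambda>n. ennreal ((u n x)\<^sup>2)) \<partial>\<mu>)"
    using assms(3)
  proof (intro nn_integral_cong_AE, eventually_elim)
    case (elim x)
    then have "(\<lambda>n. ennreal ((u n x)\<^sup>2)) \<longlonglongrightarrow> ennreal ((f x)\<^sup>2)"
      by (intro tendsto_ennrealI tendsto_power)
    from lim_imp_Liminf[OF _ this] show ?case by simp
  qed
  also have "\<dots> \<le> liminf (\<lambda>n. \<integral>\<^sup>+x. ennreal ((u n x)\<^sup>2) \<partial>\<mu>)"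
    by (rule nn_integral_liminf) (use m in simp)
  also have "\<dots> \<le> ennreal (b\<^sup>2)"
    by (rule Liminf_le) (use nn in simp_all)
  finally have le: "(\<integral>\<^sup>+x. ennreal ((f x)\<^sup>2) \<partial>\<mu>) \<le> ennreal (b\<^sup>2)" .
  have int: "integrable \<mu> (\<lambda>x. (f x)\<^sup>2)"
    using assms(2) le by (intro integrableI_nonneg) (auto intro: order_le_less_trans)
  then have "ennreal ((L2_norm \<mu> f)\<^sup>2) \<le> ennreal (b\<^sup>2)"
    using le by (simp add: L2_norm_power2 nn_integral_eq_integral)
  then have "(L2_norm \<mu> f)\<^sup>2 \<le> b\<^sup>2" by simp
  then have "L2_norm \<mu> f \<le> b" using b0 by (rule power2_le_imp_le)
  then show ?thesis using assms(2) int by (auto intro: L2_I)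
qed

text \<open>The Riesz--Fischer theorem for a sequence with geometrically decreasing increments. As the measure is
  finite, the increments are also summable in \<open>L\<^sup>1\<close>, so the sequence converges almost everywhere; Fatou's lemma
  shows that the pointwise limit is the \<open>L\<^sup>2\<close>-limit.\<close>

lemma L2_complete_summable:
  assumes fin: "finite_measure \<mu>" and u: "\<And>n. u n \<in> L2 \<mu>"
    and step: "\<And>n. L2_norm \<mu> (\<lambda>x. u (Suc n) x - u n x) \<le> (1/2)^n"
  shows "\<exists>f \<in> L2 \<mu>. \<forall>n. L2_norm \<mu> (\<lambda>x. u n x - f x) \<le> 2 * (1/2)^n"
proof -
  interpret finite_measure \<mu> by fact
  let ?d = "\<lambda>n x. u (Suc n) x - u n x"
  let ?m = "sqrt (measure \<mu> (space \<mu>))"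
  have dL: "?d n \<in> L2 \<mu>" for n using u by (intro L2_diff)
  have meas [measurable]: "u n \<in> borel_measurable \<mu>" for n using u by (rule L2_D)
  have dint: "integrable \<mu> (?d n)" for n using L2_integrable[OF fin dL] .
  have d1: "(LINT x|\<mu>. \<bar>?d n x\<bar>) \<le> (1/2)^n * ?m" for n
    using L1_le_L2_norm[OF fin dL, of n] step[of n]
    by (meson mult_right_mono order_trans real_sqrt_ge_zero measure_nonneg)
  have "(\<integral>\<^sup>+x. (\<Sum>n. ennreal \<bar>?d n x\<bar>) \<partial>\<mu>) = (\<Sum>n. \<integral>\<^sup>+x. ennreal \<bar>?d n x\<bar> \<partial>\<mu>)"
    by (rule nn_integral_suminf) simp
  also have "\<dots> \<le> (\<Sum>n. ennreal ((1/2)^n * ?m))"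
  proof (rule suminf_le)
    fix n
    have "(\<integral>\<^sup>+x. ennreal \<bar>?d n x\<bar> \<partial>\<mu>) = ennreal (LINT x|\<mu>. \<bar>?d n x\<bar>)"
      by (rule nn_integral_eq_integral) (use dint in auto)
    then show "(\<integral>\<^sup>+x. ennreal \<bar>?d n x\<bar> \<partial>\<mu>) \<le> ennreal ((1/2)^n * ?m)"
      using d1[of n] by (simp add: ennreal_leI)
  qed auto
  also have "\<dots> < \<infinity>"
  proof -
    have "summable (\<lambda>n. (1/2)^n * ?m)"
      by (intro summable_mult2 summable_geometric) simp
    then have "(\<Sum>n. ennreal ((1/2)^n * ?m)) = ennreal (\<Sum>n. (1/2)^n * ?m)"
      by (intro suminf_ennreal2) simp_all
    then show ?thesis by (simp only: infinity_ennreal_def ennreal_less_top)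
  qed
  finally have "(\<integral>\<^sup>+x. (\<Sum>n. ennreal \<bar>?d n x\<bar>) \<partial>\<mu>) \<noteq> \<infinity>"
    by (rule less_imp_neq)
  moreover have "(\<lambda>x. \<Sum>n. ennreal \<bar>?d n x\<bar>) \<in> borel_measurable \<mu>" by measurable
  ultimately have "AE x in \<mu>. (\<Sum>n. ennreal \<bar>?d n x\<bar>) \<noteq> \<infinity>"
    by (intro nn_integral_noteq_infinite)
  then have conv: "AE x in \<mu>. convergent (\<lambda>n. u n x)"
  proof eventually_elim
    case (elim x)
    then have "summable (\<lambda>n. \<bar>?d n x\<bar>)"
      by (intro summable_suminf_not_top) auto
    then have "summable (\<lambda>n. ?d n x)" by (rule summable_rabs_cancel)
    then have "convergent (\<lambda>n. \<Sum>k<n. ?d k x)" by (simp add: summable_iff_convergent)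
    moreover have "(\<lambda>n. \<Sum>k<n. ?d k x) = (\<lambda>n. u n x - u 0 x)"
      by (rule ext) (rule sum_lessThan_telescope)
    ultimately have "convergent (\<lambda>n. u n x - u 0 x)" by (simp only:)
    then show ?case
      using convergent_add[of "\<lambda>n. u n x - u 0 x" "\<lambda>_. u 0 x"] by (simp add: convergent_const)
  qed
  define f where "f x = lim (\<lambda>n. u n x)" for x
  have fm [measurable]: "f \<in> borel_measurable \<mu>" unfolding f_def by measurable
  have lim: "AE x in \<mu>. (\<lambda>n. u n x) \<longlonglongrightarrow> f x"
    using conv by eventually_elim (simp add: f_def convergent_LIMSEQ_iff)
  have dist: "L2_norm \<mu> (\<lambda>x. u (n + k) x - u n x) \<le> 2 * (1/2)^n - 2 * (1/2)^(n + k)" for n k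
  proof (induction k)
    case 0 show ?case by (simp add: L2_norm_def)
  next
    case (Suc k)
    have "L2_norm \<mu> (\<lambda>x. u (n + Suc k) x - u n x) \<le>
       L2_norm \<mu> (?d (n + k)) + L2_norm \<mu> (\<lambda>x. u (n + k) x - u n x)"
      using L2_norm_triangle_diff[of "u (Suc (n + k))" \<mu> "u (n + k)" "u n"] u by simp
    moreover have "(1/2::real) ^ (n + Suc k) = (1/2) ^ (n + k) / 2" by simp
    ultimately show ?case using Suc step[of "n + k"] by linarith
  qed
  have "(\<lambda>x. f x - u n x) \<in> L2 \<mu> \<and> L2_norm \<mu> (\<lambda>x. f x - u n x) \<le> 2 * (1/2)^n" for n
  proof (rule L2_norm_Fatou[where u = "\<lambda>k x. u (n + k) x - u n x"])
    show "AE x in \<mu>. (\<lambda>k. u (n + k) x - u n x) \<longlonglongrightarrow> f x - u n x"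
      using lim
    proof eventually_elim
      case (elim x)
      then have "(\<lambda>k. u (k + n) x) \<longlonglongrightarrow> f x" by (rule LIMSEQ_ignore_initial_segment)
      then show ?case by (intro tendsto_intros) (simp add: add.commute)
    qed
    show "L2_norm \<mu> (\<lambda>x. u (n + k) x - u n x) \<le> 2 * (1/2)^n" for k
      using dist[of n k] by (smt (verit) zero_le_power divide_nonneg_nonneg)
  qed (auto intro: L2_diff u)
  note * = this
  have "f \<in> L2 \<mu>" using L2_add[OF conjunct1[OF *[of 0]] u[of 0]] by simp
  then show ?thesis using * L2_norm_minus_commute[of \<mu> f] by (intro bexI[of _ f]) auto
qed

section \<open>Hilbert spaces as closed spans in \<open>L\<^sup>2\<close>\<close>

text \<open>The isometry sends limits of \<open>\<Sum> c\<^sub>t e\<^sub>t\<close> to limits of \<open>\<Sum> c\<^sub>t v\<^sub>t\<close>. Instead of sequences, the proof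
  works with the relation \<open>rel h f\<close> that \<open>h\<close> and \<open>f\<close> are approximated simultaneously by combinations with the same
  coefficients. Equality of the Gram matrices makes this relation linear and norm preserving, hence single-valued
  up to null sets. It is total because \<open>L\<^sup>2\<close> is complete, and onto the closed span because \<open>'h\<close> is complete.\<close>

lemma closed_span_isometry_exists:
  fixes e :: "real \<Rightarrow> 'h::{real_inner, complete_space}" and v :: "real \<Rightarrow> 'a \<Rightarrow> real"
  assumes fin: "finite_measure \<mu>" and v: "\<And>t. t \<in> I \<Longrightarrow> v t \<in> L2 \<mu>"
    and gram: "\<And>s t. s \<in> I \<Longrightarrow> t \<in> I \<Longrightarrow> (LINT x|\<mu>. v s x * v t x) = e s \<bullet> e t"
    and dense: "closure {\<Sum>t\<in>J. c t *\<^sub>R e t | J c. finite J \<and> J \<subseteq> I} = UNIV"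
  shows "\<exists>K. isometric_iso_L2 \<mu> (L2_closed_span \<mu> I v) K \<and> (\<forall>t\<in>I. AE x in \<mu>. K (e t) x = v t x)"
proof -
  define comb :: "'h \<Rightarrow> ('a \<Rightarrow> real) \<Rightarrow> bool" where
    "comb h f \<longleftrightarrow> (\<exists>J c. finite J \<and> J \<subseteq> I \<and> h = (\<Sum>t\<in>J. c t *\<^sub>R e t) \<and>
      f = (\<lambda>x. \<Sum>t\<in>J. c t * v t x))" for h f
  define rel :: "'h \<Rightarrow> ('a \<Rightarrow> real) \<Rightarrow> bool" where
    "rel h f \<longleftrightarrow> f \<in> L2 \<mu> \<and>
      (\<forall>d>0. \<exists>h' f'. comb h' f' \<and> norm (h - h') < d \<and> L2_norm \<mu> (\<lambda>x. f x - f' x) < d)" for h f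
  have comb_lin: "comb (a *\<^sub>R h + b *\<^sub>R h') (\<lambda>x. a * f x + b * f' x)"
    if "comb h f" "comb h' f'" for a b h h' f f'
  proof -
    from that obtain J c J' c' where J: "finite J" "J \<subseteq> I" "h = (\<Sum>t\<in>J. c t *\<^sub>R e t)"
        "f = (\<lambda>x. \<Sum>t\<in>J. c t * v t x)"
      and J': "finite J'" "J' \<subseteq> I" "h' = (\<Sum>t\<in>J'. c' t *\<^sub>R e t)"
        "f' = (\<lambda>x. \<Sum>t\<in>J'. c' t * v t x)"
      unfolding comb_def by blast
    let ?c = "\<lambda>t. a * (if t \<in> J then c t else 0) + b * (if t \<in> J' then c' t else 0)"
    have "a *\<^sub>R h + b *\<^sub>R h' = (\<Sum>t\<in>J \<union> J'. ?c t *\<^sub>R e t)"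
      unfolding J(3) J'(3) lincomb_union[OF J(1) J'(1)] ..
    moreover have "(\<lambda>x. a * f x + b * f' x) = (\<lambda>x. \<Sum>t\<in>J \<union> J'. ?c t * v t x)"
      unfolding J(4) J'(4) lincomb_union_real[OF J(1) J'(1)] ..
    moreover have "finite (J \<union> J')" "J \<union> J' \<subseteq> I" using J J' by auto
    ultimately show ?thesis unfolding comb_def by (intro exI[of _ "J \<union> J'"] exI[of _ ?c] conjI)
  qed
  have comb_L2: "f \<in> L2 \<mu>" and comb_norm: "L2_norm \<mu> f = norm h" if "comb h f" for h f
  proof -
    from that obtain J c where J: "finite J" "J \<subseteq> I" "h = (\<Sum>t\<in>J. c t *\<^sub>R e t)"
        "f = (\<lambda>x. \<Sum>t\<in>J. c t * v t x)"
      unfolding comb_def by blast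
    have vJ: "v t \<in> L2 \<mu>" if "t \<in> J" for t using J(2) that v by auto
    then show "f \<in> L2 \<mu>" unfolding J(4) by (rule L2_sum)
    have "(LINT x|\<mu>. (f x)\<^sup>2) = (LINT x|\<mu>. (\<Sum>s\<in>J. \<Sum>t\<in>J. (c s * c t) * (v s x * v t x)))"
      unfolding J(4) power2_eq_square sum_product by (simp only: ac_simps)
    also have "\<dots> = (\<Sum>s\<in>J. \<Sum>t\<in>J. (c s * c t) * (LINT x|\<mu>. v s x * v t x))"
    proof -
      have i: "integrable \<mu> (\<lambda>x. (c s * c t) * (v s x * v t x))" if "s \<in> J" "t \<in> J" for s t
        using L2_mult_integrable[OF vJ vJ, OF that] by simp
      have "(LINT x|\<mu>. (\<Sum>s\<in>J. \<Sum>t\<in>J. (c s * c t) * (v s x * v t x))) =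
          (\<Sum>s\<in>J. \<integral>x. (\<Sum>t\<in>J. (c s * c t) * (v s x * v t x)) \<partial>\<mu>)"
        by (rule Bochner_Integration.integral_sum) (rule Bochner_Integration.integrable_sum, rule i)
      also have "\<dots> = (\<Sum>s\<in>J. \<Sum>t\<in>J. \<integral>x. (c s * c t) * (v s x * v t x) \<partial>\<mu>)"
        by (rule sum.cong[OF refl], rule Bochner_Integration.integral_sum) (rule i)
      finally show ?thesis by simp
    qed
    also have "\<dots> = (\<Sum>s\<in>J. \<Sum>t\<in>J. (c s * c t) * (e t \<bullet> e s))"
      using J(2) gram by (intro sum.cong refl arg_cong2[where f = "(*)"]) (metis inner_commute subsetD)
    also have "\<dots> = h \<bullet> h"
      unfolding J(3) by (simp add: inner_sum_left inner_sum_right mult.assoc sum_distrib_left)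
    finally have "(L2_norm \<mu> f)\<^sup>2 = (norm h)\<^sup>2"
      by (simp add: L2_norm_power2 power2_norm_eq_inner)
    then show "L2_norm \<mu> f = norm h" by simp
  qed
  have relD: "f \<in> L2 \<mu>" if "rel h f" for h f using that by (simp add: rel_def)
  have rel_lin: "rel (a *\<^sub>R h + b *\<^sub>R g) (\<lambda>x. a * f x + b * f' x)" if "rel h f" "rel g f'" for a b h g f f'
    unfolding rel_def
  proof (intro conjI allI impI)
    show "(\<lambda>x. a * f x + b * f' x) \<in> L2 \<mu>" using that by (intro L2_lincomb relD)
    fix d :: real assume "d > 0"
    from small_radius_exists[OF this] obtain r where r: "r > 0" "\<bar>a\<bar> * r + \<bar>b\<bar> * r < d" .
    from that(1) r(1) obtain h1 f1 where 1: "comb h1 f1" "norm (h - h1) < r" "L2_norm \<mu> (\<lambda>x. f x - f1 x) < r"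
      unfolding rel_def by blast
    from that(2) r(1) obtain h2 f2 where 2: "comb h2 f2" "norm (g - h2) < r" "L2_norm \<mu> (\<lambda>x. f' x - f2 x) < r"
      unfolding rel_def by blast
    have "norm (a *\<^sub>R h + b *\<^sub>R g - (a *\<^sub>R h1 + b *\<^sub>R h2)) = norm (a *\<^sub>R (h - h1) + b *\<^sub>R (g - h2))"
      by (simp add: algebra_simps)
    also have "\<dots> \<le> \<bar>a\<bar> * norm (h - h1) + \<bar>b\<bar> * norm (g - h2)"
      by (rule order_trans[OF norm_triangle_ineq]) simp
    also have "\<dots> \<le> \<bar>a\<bar> * r + \<bar>b\<bar> * r" using 1 2 by (intro add_mono mult_left_mono) auto
    finally have n1: "norm (a *\<^sub>R h + b *\<^sub>R g - (a *\<^sub>R h1 + b *\<^sub>R h2)) < d" using r by simp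
    have n2: "L2_norm \<mu> (\<lambda>x. (a * f x + b * f' x) - (a * f1 x + b * f2 x)) < d"
      by (rule L2_norm_lincomb_diff_less[OF relD[OF that(1)] comb_L2[OF 1(1)] relD[OF that(2)] comb_L2[OF 2(1)]
            1(3) 2(3) r(2)])
    show "\<exists>h' fa. comb h' fa \<and> norm (a *\<^sub>R h + b *\<^sub>R g - h') < d \<and>
        L2_norm \<mu> (\<lambda>x. (a * f x + b * f' x) - fa x) < d"
      using comb_lin[OF 1(1) 2(1), of a b] n1 n2
      by (intro exI[of _ "a *\<^sub>R h1 + b *\<^sub>R h2"] exI[of _ "\<lambda>x. a * f1 x + b * f2 x"]) auto
  qed
  have rel_norm: "L2_norm \<mu> f = norm h" if "rel h f" for h f
  proof (rule ccontr)
    assume ne: "L2_norm \<mu> f \<noteq> norm h"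
    define d where "d = \<bar>L2_norm \<mu> f - norm h\<bar> / 2"
    have "d > 0" using ne by (simp add: d_def)
    with that obtain h1 f1 where 1: "comb h1 f1" "norm (h - h1) < d" "L2_norm \<mu> (\<lambda>x. f x - f1 x) < d"
      unfolding rel_def by blast
    have "\<bar>L2_norm \<mu> f - L2_norm \<mu> f1\<bar> < d"
      using L2_norm_diff_abs[OF relD[OF that] comb_L2[OF 1(1)]] 1(3) by simp
    moreover have "\<bar>norm h - norm h1\<bar> < d"
      using norm_triangle_ineq3[of h h1] 1(2) by simp
    ultimately show False using comb_norm[OF 1(1)] unfolding d_def by (smt (verit) field_sum_of_halves)
  qed
  have rel_inner: "(LINT x|\<mu>. f x * f' x) = h \<bullet> g" if "rel h f" "rel g f'" for h g f f'
  proof -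
    have "(L2_norm \<mu> (\<lambda>x. 1 * f x + 1 * f' x))\<^sup>2 = (norm (1 *\<^sub>R h + 1 *\<^sub>R g))\<^sup>2"
      by (subst rel_norm[OF rel_lin[OF that]]) (rule refl)
    then show ?thesis
      using L2_norm_lincomb_power2[OF relD relD, OF that, of 1 1] rel_norm[OF that(1)] rel_norm[OF that(2)]
      by (simp add: power2_norm_eq_inner inner_add_left inner_add_right inner_commute)
  qed
  have dense': "\<exists>h' f'. comb h' f' \<and> norm (h - h') < d" if "d > 0" for h d
  proof -
    have "h \<in> closure {\<Sum>t\<in>J. c t *\<^sub>R e t | J c. finite J \<and> J \<subseteq> I}" using dense by simp
    then have "\<exists>h'\<in>{\<Sum>t\<in>J. c t *\<^sub>R e t | J c. finite J \<and> J \<subseteq> I}. dist h' h < d"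
      unfolding closure_approachable using that by simp
    then obtain h' where h': "h' \<in> {\<Sum>t\<in>J. c t *\<^sub>R e t | J c. finite J \<and> J \<subseteq> I}" "dist h' h < d"
      by (elim bexE)
    from h'(1) obtain J c where J: "finite J" "J \<subseteq> I" "h' = (\<Sum>t\<in>J. c t *\<^sub>R e t)" by auto
    then have "comb h' (\<lambda>x. \<Sum>t\<in>J. c t * v t x)"
      unfolding comb_def by (intro exI[of _ J] exI[of _ c]) simp
    moreover have "norm (h - h') < d" using h'(2) by (simp add: dist_norm norm_minus_commute)
    ultimately show ?thesis by blast
  qed
  have rel_ex: "\<exists>f. rel h f" for h
  proof -
    \<comment> \<open>With these radii, consecutive approximations differ by at most \<open>(1/2)^n\<close>.\<close>
    have "\<forall>n. \<exists>p. comb (fst p) (snd p) \<and> norm (h - fst p) < (1/2)^n / 4"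
      using dense'[of "(1/2)^n / 4" h for n] by simp
    then obtain p where p': "\<forall>n. comb (fst (p n)) (snd (p n)) \<and> norm (h - fst (p n)) < (1/2)^n / 4" by (rule choice[THEN exE])
    define hn fn where "hn n = fst (p n)" and "fn n = snd (p n)" for n
    have p: "\<And>n. comb (hn n) (fn n)" "\<And>n. norm (h - hn n) < (1/2)^n / 4"
      using p' by (simp_all add: hn_def fn_def)
    have "L2_norm \<mu> (\<lambda>x. fn (Suc n) x - fn n x) \<le> (1/2)^n" for n
    proof -
      have "comb (1 *\<^sub>R hn (Suc n) + (-1) *\<^sub>R hn n) (\<lambda>x. 1 * fn (Suc n) x + (-1) * fn n x)"
        by (rule comb_lin[OF p(1) p(1)])
      from comb_norm[OF this] have "L2_norm \<mu> (\<lambda>x. fn (Suc n) x - fn n x) = norm (hn (Suc n) - hn n)"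
        by simp
      also have "\<dots> \<le> norm (h - hn n) + norm (h - hn (Suc n))"
        using norm_triangle_ineq4[of "h - hn n" "h - hn (Suc n)"] by simp
      also have "\<dots> \<le> (1/2)^n / 4 + (1/2)^Suc n / 4" using p(2)[of n] p(2)[of "Suc n"] by linarith
      also have "\<dots> \<le> (1/2)^n" by (simp add: field_simps)
      finally show ?thesis .
    qed
    from L2_complete_summable[OF fin comb_L2[OF p(1)] this] obtain f where
      f: "f \<in> L2 \<mu>" "\<And>n. L2_norm \<mu> (\<lambda>x. fn n x - f x) \<le> 2 * (1/2)^n" by auto
    have "rel h f" unfolding rel_def
    proof (intro conjI allI impI)
      fix d :: real assume "d > 0"
      then obtain n where n: "(1/2)^n < d / 2"
        using real_arch_pow_inv[of "d/2" "1/2"] by auto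
      have "norm (h - hn n) < d" using p(2)[of n] n zero_less_power[of "1/2::real" n] by linarith
      moreover have "L2_norm \<mu> (\<lambda>x. f x - fn n x) < d"
        using f(2)[of n] n L2_norm_minus_commute[of \<mu> f "fn n"] by simp
      ultimately show "\<exists>h' f'. comb h' f' \<and> norm (h - h') < d \<and> L2_norm \<mu> (\<lambda>x. f x - f' x) < d"
        using p(1) by blast
    qed fact
    then show ?thesis by blast
  qed
  have rel_unique: "AE x in \<mu>. f x = f' x" if "rel h f" "rel h f'" for h f f'
  proof -
    have "L2_norm \<mu> (\<lambda>x. 1 * f x + (-1) * f' x) = 0"
      by (subst rel_norm[OF rel_lin[OF that]]) simp
    then have "AE x in \<mu>. 1 * f x + (-1) * f' x = 0"
      by (intro L2_norm_eq_0 L2_lincomb relD[OF that(1)] relD[OF that(2)])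
    then show ?thesis by eventually_elim simp
  qed
  have span_iff: "f \<in> L2_closed_span \<mu> I v \<longleftrightarrow>
      f \<in> L2 \<mu> \<and> (\<forall>d>0. \<exists>h' f'. comb h' f' \<and> L2_norm \<mu> (\<lambda>x. f x - f' x) < d)" for f
  proof -
    have "(\<exists>h' f'. comb h' f' \<and> L2_norm \<mu> (\<lambda>x. f x - f' x) < d) \<longleftrightarrow>
      (\<exists>J c. finite J \<and> J \<subseteq> I \<and> (LINT x|\<mu>. (f x - (\<Sum>t\<in>J. c t * v t x))\<^sup>2) < d\<^sup>2)"
      (is "?L \<longleftrightarrow> ?R") if "d > 0" for d
    proof
      assume ?L
      then obtain J c where J: "finite J" "J \<subseteq> I"
          "L2_norm \<mu> (\<lambda>x. f x - (\<Sum>t\<in>J. c t * v t x)) < d"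
        unfolding comb_def by auto
      then show ?R unfolding L2_norm_less_iff[OF that] by (intro exI[of _ J] exI[of _ c]) simp
    next
      assume ?R
      then obtain J c where J: "finite J" "J \<subseteq> I"
          "(LINT x|\<mu>. (f x - (\<Sum>t\<in>J. c t * v t x))\<^sup>2) < d\<^sup>2"
        by (elim exE conjE)
      then have "comb (\<Sum>t\<in>J. c t *\<^sub>R e t) (\<lambda>x. \<Sum>t\<in>J. c t * v t x)"
        unfolding comb_def by (intro exI[of _ J] exI[of _ c]) simp
      with J(3) show ?L unfolding L2_norm_less_iff[OF that]
        by (intro exI[of _ "\<Sum>t\<in>J. c t *\<^sub>R e t"] exI[of _ "\<lambda>x. \<Sum>t\<in>J. c t * v t x"]) simp
    qed
    then have "(\<forall>d>0. \<exists>h' f'. comb h' f' \<and> L2_norm \<mu> (\<lambda>x. f x - f' x) < d) \<longleftrightarrow>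
      (\<forall>d>0. \<exists>J c. finite J \<and> J \<subseteq> I \<and> (LINT x|\<mu>. (f x - (\<Sum>t\<in>J. c t * v t x))\<^sup>2) < d\<^sup>2)"
      by simp
    also have "\<dots> \<longleftrightarrow> (\<forall>d>0. \<exists>J c. finite J \<and> J \<subseteq> I \<and> (LINT x|\<mu>. (f x - (\<Sum>t\<in>J. c t * v t x))\<^sup>2) < d)"
      by (rule all_pos_square_iff)
    finally show ?thesis by (simp add: L2_closed_span_def)
  qed
  have onto: "\<exists>h. rel h f" if "f \<in> L2_closed_span \<mu> I v" for f
  proof -
    have f: "f \<in> L2 \<mu>" using that by (simp add: span_iff)
    have "\<forall>n. \<exists>p. comb (fst p) (snd p) \<and> L2_norm \<mu> (\<lambda>x. f x - snd p x) < (1/2)^n"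
      using that unfolding span_iff by simp
    then obtain p where p': "\<forall>n. comb (fst (p n)) (snd (p n)) \<and> L2_norm \<mu> (\<lambda>x. f x - snd (p n) x) < (1/2)^n" by (rule choice[THEN exE])
    define hn fn where "hn n = fst (p n)" and "fn n = snd (p n)" for n
    have p: "\<And>n. comb (hn n) (fn n)" "\<And>n. L2_norm \<mu> (\<lambda>x. f x - fn n x) < (1/2)^n"
      using p' by (simp_all add: hn_def fn_def)
    have dn: "norm (hn m - hn n) \<le> (1/2)^m + (1/2)^n" for m n
    proof -
      have "comb (1 *\<^sub>R hn m + (-1) *\<^sub>R hn n) (\<lambda>x. 1 * fn m x + (-1) * fn n x)"
        by (rule comb_lin[OF p(1) p(1)])
      from comb_norm[OF this] have "norm (hn m - hn n) = L2_norm \<mu> (\<lambda>x. fn m x - fn n x)"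
        by simp
      also have "\<dots> \<le> L2_norm \<mu> (\<lambda>x. fn m x - f x) + L2_norm \<mu> (\<lambda>x. f x - fn n x)"
        by (rule L2_norm_triangle_diff[OF comb_L2[OF p(1)] f comb_L2[OF p(1)]])
      also have "\<dots> \<le> (1/2)^m + (1/2)^n"
        using p(2)[of m] p(2)[of n] L2_norm_minus_commute[of \<mu> f "fn m"] by simp
      finally show ?thesis .
    qed
    have "Cauchy hn"
    proof (rule metric_CauchyI)
      fix d :: real assume "d > 0"
      then obtain N where N: "(1/2)^N < d / 2" using real_arch_pow_inv[of "d/2" "1/2"] by auto
      have "dist (hn m) (hn n) < d" if "m \<ge> N" "n \<ge> N" for m n
      proof -
        have "(1/2::real)^m \<le> (1/2)^N" "(1/2::real)^n \<le> (1/2)^N"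
          using that by (auto intro: power_decreasing)
        then have "norm (hn m - hn n) < d" using dn[of m n] N by linarith
        then show ?thesis by (simp add: dist_norm)
      qed
      then show "\<exists>N. \<forall>m\<ge>N. \<forall>n\<ge>N. dist (hn m) (hn n) < d" by blast
    qed
    then obtain h where h: "hn \<longlonglongrightarrow> h" using Cauchy_convergent convergent_def by blast
    have "rel h f" unfolding rel_def
    proof (intro conjI allI impI)
      fix d :: real assume "d > 0"
      obtain N where N: "\<And>n. n \<ge> N \<Longrightarrow> norm (hn n - h) < d" using LIMSEQ_D[OF h \<open>d > 0\<close>] by auto
      obtain M where M: "(1/2)^M < d" using \<open>d > 0\<close> real_arch_pow_inv[of d "1/2"] by auto
      let ?n = "max N M"
      have "(1/2::real)^?n \<le> (1/2)^M" by (rule power_decreasing) auto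
      then have "L2_norm \<mu> (\<lambda>x. f x - fn ?n x) < d" using p(2)[of ?n] M by linarith
      moreover have "norm (h - hn ?n) < d" using N[of ?n] by (simp add: norm_minus_commute)
      ultimately show "\<exists>h' f'. comb h' f' \<and> norm (h - h') < d \<and> L2_norm \<mu> (\<lambda>x. f x - f' x) < d"
        using p(1) by blast
    qed fact
    then show ?thesis by blast
  qed
  define K where "K h = (SOME f. rel h f)" for h
  have K: "rel h (K h)" for h unfolding K_def by (rule someI_ex[OF rel_ex])
  have iso: "isometric_iso_L2 \<mu> (L2_closed_span \<mu> I v) K"
    unfolding isometric_iso_L2_def
  proof (intro conjI allI ballI)
    fix h show "K h \<in> L2 \<mu>" by (rule relD[OF K])
    show "K h \<in> L2_closed_span \<mu> I v"
      using K[of h] unfolding span_iff rel_def by blast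
  next
    fix a b g h
    show "AE x in \<mu>. K (a *\<^sub>R g + b *\<^sub>R h) x = a * K g x + b * K h x"
      by (rule rel_unique[OF K rel_lin[OF K K]])
  next
    fix g h show "(LINT x|\<mu>. K g x * K h x) = g \<bullet> h" by (rule rel_inner[OF K K])
  next
    fix f assume "f \<in> L2_closed_span \<mu> I v"
    then obtain h where "rel h f" using onto by blast
    then show "\<exists>h. AE x in \<mu>. K h x = f x" using rel_unique[OF K] by blast
  qed
  moreover have "AE x in \<mu>. K (e t) x = v t x" if "t \<in> I" for t
  proof (rule rel_unique[OF K])
    have "comb (e t) (v t)" unfolding comb_def using that
      by (intro exI[of _ "{t}"] exI[of _ "\<lambda>_. 1"]) auto
    then show "rel (e t) (v t)" unfolding rel_def using v[OF that]
      by (auto intro!: exI[of _ "e t"] exI[of _ "v t"] simp: L2_norm_def)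
  qed
  ultimately show ?thesis by blast
qed

lemma is_Lambda_sum:
  assumes L: "is_Lambda P T X \<iota>" and "finite J" "J \<subseteq> {0<..T}"
  shows "\<iota> (\<lambda>s. \<Sum>t\<in>J. c t * indicator {0..<t} s) = (\<Sum>t\<in>J. c t *\<^sub>R \<iota> (indicator {0..<t}))"
  using assms(2,3)
proof (induction J)
  case empty
  have "(\<lambda>s. 0) \<in> step_functions T"
    unfolding step_functions_def by (rule CollectI, rule exI[of _ "{}"]) auto
  then have "\<iota> (\<lambda>s. 0 * (\<lambda>s. 0) s + 0 * (\<lambda>s. 0) s) = 0 *\<^sub>R \<iota> (\<lambda>s. 0) + 0 *\<^sub>R \<iota> (\<lambda>s. 0)"
    using L unfolding is_Lambda_def by fast
  then show ?case by simp
next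
  case (insert r J)
  have 1: "(indicator {0..<r} :: real \<Rightarrow> real) \<in> step_functions T"
    unfolding step_functions_def using insert
    by (intro CollectI exI[of _ "{r}"] exI[of _ "\<lambda>_. 1"]) auto
  have 2: "(\<lambda>s. \<Sum>t\<in>J. c t * indicator {0..<t} s) \<in> step_functions T"
    unfolding step_functions_def using insert by (intro CollectI exI[of _ J] exI[of _ c]) simp
  have "\<iota> (\<lambda>s. c r * indicator {0..<r} s + 1 * (\<Sum>t\<in>J. c t * indicator {0..<t} s)) =
     c r *\<^sub>R \<iota> (indicator {0..<r}) + 1 *\<^sub>R \<iota> (\<lambda>s. \<Sum>t\<in>J. c t * indicator {0..<t} s)"
    using L 1 2 unfolding is_Lambda_def by fast
  then show ?case using insert by (simp only: sum.insert scaleR_one mult_1 insert_subset simp_thms)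
qed

lemma is_Lambda_dense:
  assumes L: "is_Lambda P T X \<iota>"
  shows "closure {\<Sum>t\<in>J. c t *\<^sub>R \<iota> (indicator {0..<t}) | J c. finite J \<and> J \<subseteq> {0<..T}} = UNIV"
proof -
  have "\<iota> ` step_functions T = {\<Sum>t\<in>J. c t *\<^sub>R \<iota> (indicator {0..<t}) | J c. finite J \<and> J \<subseteq> {0<..T}}"
  proof (intro set_eqI iffI)
    fix h assume "h \<in> \<iota> ` step_functions T"
    then obtain J c where J: "finite J" "J \<subseteq> {0<..T}" "h = \<iota> (\<lambda>s. \<Sum>t\<in>J. c t * indicator {0..<t} s)"
      unfolding step_functions_def by auto
    then show "h \<in> {\<Sum>t\<in>J. c t *\<^sub>R \<iota> (indicator {0..<t}) | J c. finite J \<and> J \<subseteq> {0<..T}}"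
      using is_Lambda_sum[OF L J(1,2)] by (intro CollectI exI[of _ J] exI[of _ c]) simp
  next
    fix h assume "h \<in> {\<Sum>t\<in>J. c t *\<^sub>R \<iota> (indicator {0..<t}) | J c. finite J \<and> J \<subseteq> {0<..T}}"
    then obtain J c where J: "finite J" "J \<subseteq> {0<..T}" "h = (\<Sum>t\<in>J. c t *\<^sub>R \<iota> (indicator {0..<t}))"
      by auto
    then have "h = \<iota> (\<lambda>s. \<Sum>t\<in>J. c t * indicator {0..<t} s)" using is_Lambda_sum[OF L J(1,2)] by simp
    moreover have "(\<lambda>s. \<Sum>t\<in>J. c t * indicator {0..<t} s) \<in> step_functions T"
      unfolding step_functions_def using J by (intro CollectI exI[of _ J] exI[of _ c]) simp
    ultimately show "h \<in> \<iota> ` step_functions T" by (intro image_eqI)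
  qed
  then show ?thesis using L unfolding is_Lambda_def by simp
qed

section \<open>Centered Gaussian characteristic functions\<close>

lemma char_distr:
  assumes "Y \<in> borel_measurable P"
  shows "char (distr P borel Y) u = (CLINT \<omega>|P. iexp (u * Y \<omega>))"
  unfolding char_def using assms by (simp add: integral_distr)

lemma norm_iexp_diff: "cmod (iexp a - iexp b) \<le> \<bar>a - b\<bar>"
proof -
  have "iexp a - iexp b = iexp b * (iexp (a - b) - 1)"
    by (simp add: algebra_simps exp_add[symmetric])
  then have "cmod (iexp a - iexp b) = cmod (iexp (a - b) - 1)"
    by (simp add: norm_mult)
  also have "\<dots> \<le> \<bar>a - b\<bar>" using iexp_approx1[of "a - b" 0] by simp
  finally show ?thesis .
qed

text \<open>The variance \<open>q\<close> may be \<open>0\<close>: in contrast to the normal laws with a density, this class is closed under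
  \<open>L\<^sup>2\<close>-limits.\<close>

definition gaussian_char :: "'a measure \<Rightarrow> real \<Rightarrow> ('a \<Rightarrow> real) \<Rightarrow> bool" where
  "gaussian_char P q Y \<longleftrightarrow> Y \<in> borel_measurable P \<and>
     (\<forall>u. (CLINT \<omega>|P. iexp (u * Y \<omega>)) = complex_of_real (exp (- (u\<^sup>2 * q / 2))))"

lemma gaussian_char_normal:
  assumes "prob_space P" and D: "distributed P lborel Y (normal_density 0 \<sigma>)" and "\<sigma> > 0"
  shows "gaussian_char P (\<sigma>\<^sup>2) Y"
proof -
  interpret prob_space P by fact
  have Ym: "Y \<in> borel_measurable P" using distributed_measurable[OF D] by simp
  have "distributed P lborel (\<lambda>\<omega>. Y \<omega> / \<sigma>) std_normal_density"
    using D normal_standard_normal_convert[OF \<open>\<sigma> > 0\<close>, of Y 0] by simp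
  then have "distr P lborel (\<lambda>\<omega>. Y \<omega> / \<sigma>) = std_normal_distribution"
    by (simp add: distributed_def)
  moreover have "distr P lborel (\<lambda>\<omega>. Y \<omega> / \<sigma>) = distr P borel (\<lambda>\<omega>. Y \<omega> / \<sigma>)"
    by (rule distr_cong) auto
  ultimately have Z: "distr P borel (\<lambda>\<omega>. Y \<omega> / \<sigma>) = std_normal_distribution" by simp
  have "(CLINT \<omega>|P. iexp (u * Y \<omega>)) = complex_of_real (exp (- (u\<^sup>2 * \<sigma>\<^sup>2 / 2)))" for u
  proof -
    have "(CLINT \<omega>|P. iexp (u * Y \<omega>)) = (CLINT \<omega>|P. iexp ((u * \<sigma>) * (Y \<omega> / \<sigma>)))"
      using \<open>\<sigma> > 0\<close> by simp
    also have "\<dots> = char (distr P borel (\<lambda>\<omega>. Y \<omega> / \<sigma>)) (u * \<sigma>)"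
      using Ym by (subst char_distr) auto
    also have "\<dots> = complex_of_real (exp (- (u\<^sup>2 * \<sigma>\<^sup>2 / 2)))"
      unfolding Z char_std_normal_distribution by (simp add: power_mult_distrib)
    finally show ?thesis .
  qed
  then show ?thesis using Ym by (simp add: gaussian_char_def)
qed

text \<open>Since \<open>\<bar>exp (\<i> u Y) - exp (\<i> u V)\<bar> \<le> \<bar>u\<bar> \<bar>Y - V\<bar>\<close>, characteristic functions converge under
  \<open>L\<^sup>2\<close>-convergence, and their limit is again of the Gaussian form. Standard deviations are used for the approximation,
  because the triangle inequality controls norms rather than their squares.\<close>

lemma gaussian_char_L2_limit:
  assumes "prob_space P" "Y \<in> L2 P"
    and approx: "\<And>e. e > 0 \<Longrightarrow> \<exists>V m. V \<in> L2 P \<and> gaussian_char P (m\<^sup>2) V \<and>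
        L2_norm P (\<lambda>\<omega>. Y \<omega> - V \<omega>) < e \<and> \<bar>m - N\<bar> < e"
  shows "gaussian_char P (N\<^sup>2) Y"
proof -
  interpret prob_space P by fact
  have fin: "finite_measure P" by unfold_locales
  have Ym [measurable]: "Y \<in> borel_measurable P" using assms(2) by (rule L2_D)
  have "\<forall>n. \<exists>p. fst p \<in> L2 P \<and> gaussian_char P ((snd p)\<^sup>2) (fst p) \<and>
        L2_norm P (\<lambda>\<omega>. Y \<omega> - fst p \<omega>) < 1 / Suc n \<and> \<bar>snd p - N\<bar> < 1 / Suc n"
    using approx[of "1 / Suc n" for n] by simp
  then obtain p where p: "\<forall>n. fst (p n) \<in> L2 P \<and> gaussian_char P ((snd (p n))\<^sup>2) (fst (p n)) \<and>
        L2_norm P (\<lambda>\<omega>. Y \<omega> - fst (p n) \<omega>) < 1 / Suc n \<and> \<bar>snd (p n) - N\<bar> < 1 / Suc n"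
    by (rule choice[THEN exE])
  define V m where "V n = fst (p n)" and "m n = snd (p n)" for n
  have V: "V n \<in> L2 P" "gaussian_char P ((m n)\<^sup>2) (V n)"
    "L2_norm P (\<lambda>\<omega>. Y \<omega> - V n \<omega>) < 1 / Suc n" "\<bar>m n - N\<bar> < 1 / Suc n" for n
    using p by (simp_all add: V_def m_def)
  have Vm [measurable]: "V n \<in> borel_measurable P" for n using V(1) by (rule L2_D)
  have inv0: "(\<lambda>n. 1 / real (Suc n)) \<longlonglongrightarrow> 0"
    using LIMSEQ_inverse_real_of_nat by (simp add: inverse_eq_divide)
  have "(\<lambda>n. m n - N) \<longlonglongrightarrow> 0"
    by (rule tendsto_rabs_zero_cancel, rule tendsto_sandwich[OF _ _ tendsto_const inv0])
       (use V(4) in \<open>auto intro: always_eventually less_imp_le\<close>)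
  then have mlim: "m \<longlonglongrightarrow> N" by (simp add: LIM_zero_iff)
  have "(CLINT \<omega>|P. iexp (u * Y \<omega>)) = complex_of_real (exp (- (u\<^sup>2 * N\<^sup>2 / 2)))" for u
  proof (rule LIMSEQ_unique)
    have eq: "(CLINT \<omega>|P. iexp (u * V n \<omega>)) = complex_of_real (exp (- (u\<^sup>2 * (m n)\<^sup>2 / 2)))" for n
      using V(2)[of n] by (simp add: gaussian_char_def)
    show "(\<lambda>n. CLINT \<omega>|P. iexp (u * V n \<omega>)) \<longlonglongrightarrow> complex_of_real (exp (- (u\<^sup>2 * N\<^sup>2 / 2)))"
      unfolding eq by (intro tendsto_of_real tendsto_intros mlim) simp_all
    have bound: "cmod ((CLINT \<omega>|P. iexp (u * V n \<omega>)) - (CLINT \<omega>|P. iexp (u * Y \<omega>))) \<le> \<bar>u\<bar> * (1 / Suc n)" for n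
    proof -
      have i: "integrable P (\<lambda>\<omega>. iexp (u * V n \<omega>))" "integrable P (\<lambda>\<omega>. iexp (u * Y \<omega>))"
        by (intro integrable_iexp; simp)+
      have d: "integrable P (\<lambda>\<omega>. \<bar>Y \<omega> - V n \<omega>\<bar>)"
        using L2_integrable[OF fin L2_diff[OF assms(2) V(1)]] by simp
      have "cmod ((CLINT \<omega>|P. iexp (u * V n \<omega>)) - (CLINT \<omega>|P. iexp (u * Y \<omega>))) =
          cmod (CLINT \<omega>|P. iexp (u * V n \<omega>) - iexp (u * Y \<omega>))"
        using Bochner_Integration.integral_diff[OF i] by simp
      also have "\<dots> \<le> (LINT \<omega>|P. cmod (iexp (u * V n \<omega>) - iexp (u * Y \<omega>)))"
        by (rule integral_norm_bound)
      also have "\<dots> \<le> (LINT \<omega>|P. \<bar>u\<bar> * \<bar>Y \<omega> - V n \<omega>\<bar>)"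
      proof (rule integral_mono)
        show "integrable P (\<lambda>\<omega>. cmod (iexp (u * V n \<omega>) - iexp (u * Y \<omega>)))"
          by (rule integrable_norm[OF Bochner_Integration.integrable_diff[OF i]])
        show "integrable P (\<lambda>\<omega>. \<bar>u\<bar> * \<bar>Y \<omega> - V n \<omega>\<bar>)" using d by simp
        fix \<omega>
        have "cmod (iexp (u * V n \<omega>) - iexp (u * Y \<omega>)) \<le> \<bar>u * V n \<omega> - u * Y \<omega>\<bar>"
          by (rule norm_iexp_diff)
        also have "\<dots> = \<bar>u\<bar> * \<bar>Y \<omega> - V n \<omega>\<bar>"
          by (simp add: right_diff_distrib[symmetric] abs_mult abs_minus_commute)
        finally show "cmod (iexp (u * V n \<omega>) - iexp (u * Y \<omega>)) \<le> \<bar>u\<bar> * \<bar>Y \<omega> - V n \<omega>\<bar>" .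
      qed
      also have "\<dots> = \<bar>u\<bar> * (LINT \<omega>|P. \<bar>Y \<omega> - V n \<omega>\<bar>)" by simp
      also have "\<dots> \<le> \<bar>u\<bar> * (1 / Suc n)"
        using L1_le_L2_norm[OF fin L2_diff[OF assms(2) V(1)], of n] V(3)[of n]
        by (intro mult_left_mono) (simp_all add: prob_space)
      finally show ?thesis .
    qed
    have "(\<lambda>n. (CLINT \<omega>|P. iexp (u * V n \<omega>)) - (CLINT \<omega>|P. iexp (u * Y \<omega>))) \<longlonglongrightarrow> 0"
    proof (rule Lim_null_comparison)
      show "\<forall>\<^sub>F n in sequentially. cmod ((CLINT \<omega>|P. iexp (u * V n \<omega>)) - (CLINT \<omega>|P. iexp (u * Y \<omega>)))
          \<le> \<bar>u\<bar> * (1 / Suc n)"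
        using bound by (intro always_eventually allI)
      show "(\<lambda>n. \<bar>u\<bar> * (1 / Suc n)) \<longlonglongrightarrow> 0"
        using tendsto_mult_right_zero[OF inv0] by simp
    qed
    then show "(\<lambda>n. CLINT \<omega>|P. iexp (u * V n \<omega>)) \<longlonglongrightarrow> (CLINT \<omega>|P. iexp (u * Y \<omega>))"
      by (simp only: LIM_zero_iff)
  qed
  then show ?thesis by (simp add: gaussian_char_def)
qed

lemma gaussian_char_cong_AE:
  assumes "gaussian_char P q Y" "Y' \<in> borel_measurable P" "AE \<omega> in P. Y \<omega> = Y' \<omega>"
  shows "gaussian_char P q Y'"
proof -
  have [measurable]: "Y \<in> borel_measurable P" using assms by (simp add: gaussian_char_def)
  note [measurable] = assms(2)
  have "(CLINT \<omega>|P. iexp (u * Y' \<omega>)) = (CLINT \<omega>|P. iexp (u * Y \<omega>))" for u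
    by (rule integral_cong_AE) (use assms(3) in \<open>auto\<close>)
  then show ?thesis using assms(1,2) by (simp add: gaussian_char_def)
qed

text \<open>Levy's uniqueness theorem compares \<open>Y\<close> with the point mass at \<open>0\<close> if \<open>q = 0\<close>, and \<open>Y / sqrt q\<close> with the
  standard normal law otherwise.\<close>

lemma gaussian_char_imp_gaussian:
  assumes "prob_space P" and g: "gaussian_char P q Y"
  shows "gaussian_rv P Y" "(LINT \<omega>|P. Y \<omega>) = 0" "(LINT \<omega>|P. (Y \<omega>)\<^sup>2) = q"
proof -
  interpret prob_space P by fact
  have Ym [measurable]: "Y \<in> borel_measurable P" using g by (simp add: gaussian_char_def)
  have ch: "char (distr P borel Y) u = complex_of_real (exp (- (u\<^sup>2 * q / 2)))" for u
    using g char_distr[OF Ym] by (simp add: gaussian_char_def)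
  interpret D: real_distribution "distr P borel Y" by (rule real_distribution_distr) simp
  have q0: "0 \<le> q" using D.cmod_char_le_1[of 1] unfolding ch by simp
  have "gaussian_rv P Y \<and> (LINT \<omega>|P. Y \<omega>) = 0 \<and> (LINT \<omega>|P. (Y \<omega>)\<^sup>2) = q"
  proof (cases "q = 0")
    case True
    interpret R: real_distribution "return borel (0::real)"
      unfolding real_distribution_def real_distribution_axioms_def
      by (auto intro: prob_space_return)
    have "char (distr P borel Y) = char (return borel 0)"
    proof
      fix u show "char (distr P borel Y) u = char (return borel 0) u"
        unfolding ch by (simp add: True char_def integral_return)
    qed
    then have "distr P borel Y = return borel 0"
      by (rule Levy_uniqueness[OF D.real_distribution_axioms R.real_distribution_axioms])
    then have "AE y in distr P borel Y. y = 0"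
      by (simp only:) (subst AE_return, simp_all)
    then have ae: "AE \<omega> in P. Y \<omega> = 0" by (simp add: AE_distr_iff)
    then have "gaussian_rv P Y" unfolding gaussian_rv_def by auto
    moreover have "(LINT \<omega>|P. Y \<omega>) = 0" using ae by (intro integral_eq_zero_AE)
    moreover have "(LINT \<omega>|P. (Y \<omega>)\<^sup>2) = 0" using ae by (intro integral_eq_zero_AE) auto
    ultimately show ?thesis using True by simp
  next
    case False
    with q0 have q: "q > 0" by simp
    define \<sigma> where "\<sigma> = sqrt q"
    have s: "\<sigma> > 0" "\<sigma>\<^sup>2 = q" using q by (simp_all add: \<sigma>_def)
    have [measurable]: "(\<lambda>\<omega>. Y \<omega> / \<sigma>) \<in> borel_measurable P" by measurable
    interpret Z: real_distribution "distr P borel (\<lambda>\<omega>. Y \<omega> / \<sigma>)"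
      by (rule real_distribution_distr) simp
    have "char (distr P borel (\<lambda>\<omega>. Y \<omega> / \<sigma>)) = char std_normal_distribution"
    proof
      fix u
      have "char (distr P borel (\<lambda>\<omega>. Y \<omega> / \<sigma>)) u = (CLINT \<omega>|P. iexp ((u / \<sigma>) * Y \<omega>))"
        by (subst char_distr) auto
      also have "\<dots> = complex_of_real (exp (- ((u / \<sigma>)\<^sup>2 * q / 2)))"
        using g by (simp only: gaussian_char_def)
      also have "(u / \<sigma>)\<^sup>2 * q = u\<^sup>2" using s q by (simp add: power_divide)
      finally show "char (distr P borel (\<lambda>\<omega>. Y \<omega> / \<sigma>)) u = char std_normal_distribution u"
        by (simp add: char_std_normal_distribution)
    qed
    then have "distr P borel (\<lambda>\<omega>. Y \<omega> / \<sigma>) = std_normal_distribution"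
      by (rule Levy_uniqueness[OF Z.real_distribution_axioms real_dist_normal_dist])
    moreover have "distr P lborel (\<lambda>\<omega>. Y \<omega> / \<sigma>) = distr P borel (\<lambda>\<omega>. Y \<omega> / \<sigma>)"
      by (rule distr_cong) auto
    ultimately have "distributed P lborel (\<lambda>\<omega>. Y \<omega> / \<sigma>) std_normal_density"
      by (simp add: distributed_def)
    then have N: "distributed P lborel Y (normal_density 0 \<sigma>)"
      using normal_standard_normal_convert[OF s(1), of Y 0] by simp
    have "gaussian_rv P Y" unfolding gaussian_rv_def using N s(1) Ym by blast
    moreover have e: "(LINT \<omega>|P. Y \<omega>) = 0" by (rule normal_distributed_expectation[OF s(1) N])
    moreover have "(LINT \<omega>|P. (Y \<omega>)\<^sup>2) = q"
      using normal_distributed_variance[OF s(1) N] e s(2) by simp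
    ultimately show ?thesis by simp
  qed
  then show "gaussian_rv P Y" "(LINT \<omega>|P. Y \<omega>) = 0" "(LINT \<omega>|P. (Y \<omega>)\<^sup>2) = q" by simp_all
qed

section \<open>Uniqueness of the law of a process\<close>

text \<open>A nonnegative weight \<open>G\<close> of positive total mass \<open>m\<close> turns \<open>P\<close> into the probability measure with density
  \<open>G / m\<close>, to which Levy's uniqueness theorem for the law of \<open>Z\<close> applies. The weights make it possible to use the
  theorem on the line for one coordinate of a vector after the other.\<close>

lemma weighted_law_unique:
  fixes G Z :: "'a \<Rightarrow> real" and G' Z' :: "'b \<Rightarrow> real"
  assumes P: "prob_space P" and P': "prob_space P'"
    and [measurable]: "G \<in> borel_measurable P" "Z \<in> borel_measurable P"
      "G' \<in> borel_measurable P'" "Z' \<in> borel_measurable P'" "B \<in> sets borel"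
    and G: "\<And>\<omega>. 0 \<le> G \<omega>" "\<And>\<omega>. G \<omega> \<le> b" and G': "\<And>\<omega>. 0 \<le> G' \<omega>" "\<And>\<omega>. G' \<omega> \<le> b"
    and ch: "\<And>u. (CLINT \<omega>|P. G \<omega> * iexp (u * Z \<omega>)) = (CLINT \<omega>|P'. G' \<omega> * iexp (u * Z' \<omega>))"
  shows "(LINT \<omega>|P. G \<omega> * indicator B (Z \<omega>)) = (LINT \<omega>|P'. G' \<omega> * indicator B (Z' \<omega>))"
proof -
  interpret P: prob_space P by fact
  interpret P': prob_space P' by fact
  have int: "integrable P G" by (rule P.integrable_const_bound[of _ b]) (use G in auto)
  have int': "integrable P' G'" by (rule P'.integrable_const_bound[of _ b]) (use G' in auto)
  define m where "m = (LINT \<omega>|P. G \<omega>)"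
  have "complex_of_real m = complex_of_real (LINT \<omega>|P'. G' \<omega>)"
    using ch[of 0] by (simp add: m_def)
  then have m': "m = (LINT \<omega>|P'. G' \<omega>)" by (simp only: of_real_eq_iff)
  have m0: "0 \<le> m" unfolding m_def using G by simp
  show ?thesis
  proof (cases "m = 0")
    case True
    have "AE \<omega> in P. G \<omega> = 0"
      using integral_nonneg_eq_0_iff_AE[OF int] G True by (simp add: m_def)
    then have "(LINT \<omega>|P. G \<omega> * indicator B (Z \<omega>)) = 0" by (intro integral_eq_zero_AE) auto
    moreover have "AE \<omega> in P'. G' \<omega> = 0"
      using integral_nonneg_eq_0_iff_AE[OF int'] G' True m' by simp
    then have "(LINT \<omega>|P'. G' \<omega> * indicator B (Z' \<omega>)) = 0" by (intro integral_eq_zero_AE) auto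
    ultimately show ?thesis by simp
  next
    case False
    with m0 have m: "m > 0" by simp
    have law: "real_distribution (distr (density Q (\<lambda>\<omega>. ennreal (H \<omega> / m))) borel Y) \<and>
        (\<forall>u. char (distr (density Q (\<lambda>\<omega>. ennreal (H \<omega> / m))) borel Y) u
           = (CLINT \<omega>|Q. H \<omega> * iexp (u * Y \<omega>)) / m) \<and>
        measure (distr (density Q (\<lambda>\<omega>. ennreal (H \<omega> / m))) borel Y) B
           = (LINT \<omega>|Q. H \<omega> * indicator B (Y \<omega>)) / m"
      if [measurable]: "H \<in> borel_measurable Q" "Y \<in> borel_measurable Q"
        and H: "\<And>\<omega>. 0 \<le> H \<omega>" "integrable Q H" "(LINT \<omega>|Q. H \<omega>) = m"
      for Q :: "'c measure" and H Y :: "'c \<Rightarrow> real"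
    proof (intro conjI allI)
      let ?D = "density Q (\<lambda>\<omega>. ennreal (H \<omega> / m))"
      have "(\<integral>\<^sup>+\<omega>. ennreal (H \<omega> / m) \<partial>Q) = ennreal (LINT \<omega>|Q. H \<omega> / m)"
        by (rule nn_integral_eq_integral) (use H m in auto)
      also have "\<dots> = 1" using H m by simp
      finally have D: "prob_space ?D"
        by (intro prob_spaceI) (simp add: emeasure_density cong: nn_integral_cong)
      then interpret D: prob_space ?D .
      show "real_distribution (distr ?D borel Y)" by (rule D.real_distribution_distr) simp
      show "char (distr ?D borel Y) u = (CLINT \<omega>|Q. H \<omega> * iexp (u * Y \<omega>)) / m" for u
      proof -
        have "char (distr ?D borel Y) u = (CLINT \<omega>|?D. iexp (u * Y \<omega>))"
          by (rule char_distr) simp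
        also have "\<dots> = (CLINT \<omega>|Q. (H \<omega> / m) *\<^sub>R iexp (u * Y \<omega>))"
          by (rule integral_density) (use H m in auto)
        also have "\<dots> = (CLINT \<omega>|Q. (H \<omega> * iexp (u * Y \<omega>)) / m)"
          by (simp add: scaleR_conv_of_real)
        finally show ?thesis by simp
      qed
      have "measure (distr ?D borel Y) B = (LINT \<omega>|?D. indicator B (Y \<omega>))"
      proof -
        have "measure (distr ?D borel Y) B = (LINT y|distr ?D borel Y. indicator B y)"
          by simp
        also have "\<dots> = (LINT \<omega>|?D. indicator B (Y \<omega>))"
          by (rule integral_distr) auto
        finally show ?thesis .
      qed
      also have "\<dots> = (LINT \<omega>|Q. (H \<omega> / m) *\<^sub>R indicator B (Y \<omega>))"
        by (rule integral_density) (use H m in auto)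
      also have "\<dots> = (LINT \<omega>|Q. (H \<omega> * indicator B (Y \<omega>)) / m)" by simp
      finally show "measure (distr ?D borel Y) B = (LINT \<omega>|Q. H \<omega> * indicator B (Y \<omega>)) / m"
        by simp
    qed
    note lawP = law[OF assms(3,4) G(1) int m_def[symmetric]]
    note lawP' = law[OF assms(5,6) G'(1) int' m'[symmetric]]
    let ?M = "distr (density P (\<lambda>\<omega>. ennreal (G \<omega> / m))) borel Z"
    let ?M' = "distr (density P' (\<lambda>\<omega>. ennreal (G' \<omega> / m))) borel Z'"
    have r: "real_distribution ?M" "real_distribution ?M'"
      using lawP lawP' by auto
    have "char ?M = char ?M'"
    proof
      fix u
      have "char ?M u = (CLINT \<omega>|P. G \<omega> * iexp (u * Z \<omega>)) / m"
        using lawP by blast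
      also have "\<dots> = (CLINT \<omega>|P'. G' \<omega> * iexp (u * Z' \<omega>)) / m" by (simp only: ch)
      also have "\<dots> = char ?M' u"
        using lawP' by simp
      finally show "char ?M u = char ?M' u" .
    qed
    then have "?M = ?M'" by (rule Levy_uniqueness[OF r])
    then have "measure ?M B = measure ?M' B" by simp
    moreover have "measure ?M B = (LINT \<omega>|P. G \<omega> * indicator B (Z \<omega>)) / m"
      using lawP by blast
    moreover have "measure ?M' B = (LINT \<omega>|P'. G' \<omega> * indicator B (Z' \<omega>)) / m"
      using lawP' by blast
    ultimately show ?thesis using m by simp
  qed
qed

text \<open>Complex exponentials of \<open>S\<close> are not admissible as weights; the functions \<open>1 + cos (S + \<theta>)\<close> are, and
  their Fourier transforms are combinations of those of the exponentials.\<close>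

lemma (in prob_space) weighted_cosine_char:
  fixes A S Z :: "'a \<Rightarrow> real"
  assumes [measurable]: "A \<in> borel_measurable M" "S \<in> borel_measurable M" "Z \<in> borel_measurable M"
    and A: "\<And>\<omega>. 0 \<le> A \<omega>" "\<And>\<omega>. A \<omega> \<le> 1"
  shows "(CLINT \<omega>|M. of_real (A \<omega> * (1 + cos (S \<omega> + \<theta>))) * iexp (u * Z \<omega>)) =
     (CLINT \<omega>|M. of_real (A \<omega>) * iexp (0 * S \<omega> + u * Z \<omega>))
     + (iexp \<theta> / 2) * (CLINT \<omega>|M. of_real (A \<omega>) * iexp (1 * S \<omega> + u * Z \<omega>))
     + (iexp (-\<theta>) / 2) * (CLINT \<omega>|M. of_real (A \<omega>) * iexp ((-1) * S \<omega> + u * Z \<omega>))"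
proof -
  have int: "integrable M (\<lambda>\<omega>. of_real (A \<omega>) * iexp (g \<omega>))" if [measurable]: "g \<in> borel_measurable M" for g
    by (rule integrable_const_bound[of _ 1]) (use A in \<open>auto simp: norm_mult\<close>)
  have "of_real (x * (1 + cos (s + \<theta>))) * iexp y = of_real x * iexp (0 * s + y)
      + (iexp \<theta> / 2) * (of_real x * iexp (1 * s + y)) + (iexp (-\<theta>) / 2) * (of_real x * iexp ((-1) * s + y))"
    for x s y :: real
  proof -
    have c: "complex_of_real (cos (s + \<theta>)) = (iexp \<theta> * iexp s + iexp (-\<theta>) * iexp (-s)) / 2"
      by (simp add: cos_of_real[symmetric] cos_exp_eq exp_add[symmetric] algebra_simps)
    have p: "iexp (1 * s + y) = iexp s * iexp y" "iexp ((-1) * s + y) = iexp (-s) * iexp y"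
        "iexp (0 * s + y) = iexp y"
      by (simp_all add: exp_add[symmetric] algebra_simps)
    have "complex_of_real (x * (1 + cos (s + \<theta>))) = of_real x * (1 + of_real (cos (s + \<theta>)))" by simp
    then show ?thesis unfolding c p by (simp add: algebra_simps add_divide_distrib)
  qed
  then show ?thesis
    by (simp only:, subst Bochner_Integration.integral_add,
        (intro Bochner_Integration.integrable_add integrable_mult_right int; measurable)+,
        subst Bochner_Integration.integral_add,
        (intro Bochner_Integration.integrable_add integrable_mult_right int; measurable)+,
        simp only: integral_mult_right_zero)
qed

text \<open>Conversely, the complex exponential of \<open>S\<close> is recovered from the two phases \<open>\<theta> = 0\<close> and
  \<open>\<theta> = - pi / 2\<close> of the cosine.\<close>

lemma (in prob_space) bounded_weight_split:
  fixes R S :: "'a \<Rightarrow> real"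
  assumes [measurable]: "R \<in> borel_measurable M" "S \<in> borel_measurable M" and R: "\<And>\<omega>. \<bar>R \<omega>\<bar> \<le> 1"
  shows "(LINT \<omega>|M. R \<omega> * (1 + cos (S \<omega> + \<theta>))) = (LINT \<omega>|M. R \<omega>) + (LINT \<omega>|M. R \<omega> * cos (S \<omega> + \<theta>))"
    and "(CLINT \<omega>|M. of_real (R \<omega>) * iexp (S \<omega>)) =
      of_real (LINT \<omega>|M. R \<omega> * cos (S \<omega> + 0)) + \<i> * of_real (LINT \<omega>|M. R \<omega> * cos (S \<omega> + (- pi / 2)))"
proof -
  have int: "integrable M (\<lambda>\<omega>. R \<omega> * g \<omega>)" if [measurable]: "g \<in> borel_measurable M" and "\<And>\<omega>. \<bar>g \<omega>\<bar> \<le> 1" for g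
    by (rule integrable_const_bound[of _ 1]) (use R that(2) in \<open>auto simp: abs_mult intro!: mult_le_one\<close>)
  have cos: "integrable M (\<lambda>\<omega>. R \<omega> * cos (S \<omega> + \<theta>))" for \<theta> by (rule int) auto
  have "integrable M R" using int[of "\<lambda>_. 1"] by simp
  then show "(LINT \<omega>|M. R \<omega> * (1 + cos (S \<omega> + \<theta>))) = (LINT \<omega>|M. R \<omega>) + (LINT \<omega>|M. R \<omega> * cos (S \<omega> + \<theta>))"
    using cos[of \<theta>] by (simp add: distrib_left)
  have i: "integrable M (\<lambda>\<omega>. complex_of_real (R \<omega> * cos (S \<omega> + \<theta>)))" for \<theta>
    by (rule integrable_of_real[OF cos])
  have "of_real x * iexp s = complex_of_real (x * cos (s + 0)) + \<i> * complex_of_real (x * cos (s + (- pi / 2)))"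
    for x s :: real
    by (simp add: cis_conv_exp[symmetric] complex_eq_iff cos_diff)
  then show "(CLINT \<omega>|M. of_real (R \<omega>) * iexp (S \<omega>)) =
      of_real (LINT \<omega>|M. R \<omega> * cos (S \<omega> + 0)) + \<i> * of_real (LINT \<omega>|M. R \<omega> * cos (S \<omega> + (- pi / 2)))"
    by (simp only:, subst Bochner_Integration.integral_add[OF i integrable_mult_right[OF i]])
       (simp only: integral_mult_right_zero integral_complex_of_real)
qed

text \<open>Fourier uniqueness in several dimensions is obtained from the case of the line. The induction
  \<open>key\<close> runs over the finite set \<open>K\<close> of coordinates in which the exponential has already been replaced by an
  indicator function. To treat a further coordinate \<open>r\<close>, let \<open>A\<close> be the product of the indicators obtained so far and
  \<open>S\<close> the linear combination that remains in the exponent; the laws of \<open>Y\<^sub>r\<close> under the weights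
  \<open>A (1 + cos (S + \<theta>))\<close> agree for all \<open>\<theta>\<close>, and these weights separate \<open>exp (\<i> S)\<close>.\<close>

theorem law_unique_by_linear_combinations:
  fixes Y :: "'i \<Rightarrow> 'a \<Rightarrow> real" and Y' :: "'i \<Rightarrow> 'b \<Rightarrow> real"
  assumes P: "prob_space P" and P': "prob_space P'"
    and Ym: "\<And>t. t \<in> I \<Longrightarrow> Y t \<in> borel_measurable P"
    and Ym': "\<And>t. t \<in> I \<Longrightarrow> Y' t \<in> borel_measurable P'"
    and ch: "\<And>J c. finite J \<Longrightarrow> J \<subseteq> I \<Longrightarrow>
       (CLINT \<omega>|P. iexp (\<Sum>t\<in>J. c t * Y t \<omega>)) = (CLINT \<omega>|P'. iexp (\<Sum>t\<in>J. c t * Y' t \<omega>))"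
  shows "distr P (\<Pi>\<^sub>M t\<in>I. borel) (\<lambda>\<omega>. \<lambda>t\<in>I. Y t \<omega>) = distr P' (\<Pi>\<^sub>M t\<in>I. borel) (\<lambda>\<omega>. \<lambda>t\<in>I. Y' t \<omega>)"
proof -
  interpret P: prob_space P by fact
  interpret P': prob_space P' by fact
  define lin :: "('a \<Rightarrow> real) \<Rightarrow> ('b \<Rightarrow> real) \<Rightarrow> bool" where
    "lin S S' \<longleftrightarrow> (\<exists>J c. finite J \<and> J \<subseteq> I \<and> S = (\<lambda>\<omega>. \<Sum>t\<in>J. c t * Y t \<omega>) \<and>
       S' = (\<lambda>\<omega>. \<Sum>t\<in>J. c t * Y' t \<omega>))" for S S'
  have linm: "S \<in> borel_measurable P" "S' \<in> borel_measurable P'" if "lin S S'" for S S'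
    using that Ym Ym' unfolding lin_def by (auto intro!: borel_measurable_sum borel_measurable_times)
  have lin_add: "lin (\<lambda>\<omega>. a * S \<omega> + u * Y r \<omega>) (\<lambda>\<omega>. a * S' \<omega> + u * Y' r \<omega>)"
    if S: "lin S S'" and r: "r \<in> I" for S S' a u r
  proof -
    from S obtain J c where J: "finite J" "J \<subseteq> I" "S = (\<lambda>\<omega>. \<Sum>t\<in>J. c t * Y t \<omega>)"
       "S' = (\<lambda>\<omega>. \<Sum>t\<in>J. c t * Y' t \<omega>)"
      unfolding lin_def by (elim exE conjE)
    let ?c = "\<lambda>t. a * (if t \<in> J then c t else 0) + u * (if t \<in> {r} then 1 else 0)"
    have *: "(\<Sum>t\<in>J \<union> {r}. ?c t * f t) = a * (\<Sum>t\<in>J. c t * f t) + u * f r" for f :: "'i \<Rightarrow> real"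
      by (simp only: lincomb_union_real[OF J(1) finite.insertI[OF finite.emptyI], where a = a and b = u and c = c and c' = "\<lambda>_. 1"]) simp
    have "(\<lambda>\<omega>. a * S \<omega> + u * Y r \<omega>) = (\<lambda>\<omega>. \<Sum>t\<in>J \<union> {r}. ?c t * Y t \<omega>)"
      "(\<lambda>\<omega>. a * S' \<omega> + u * Y' r \<omega>) = (\<lambda>\<omega>. \<Sum>t\<in>J \<union> {r}. ?c t * Y' t \<omega>)"
      unfolding J(3,4) * by (rule refl)+
    moreover have "finite (J \<union> {r})" "J \<union> {r} \<subseteq> I" using J r by auto
    ultimately show ?thesis unfolding lin_def by (intro exI[of _ "J \<union> {r}"] exI[of _ ?c] conjI)
  qed
  have lin0: "lin (\<lambda>_. 0) (\<lambda>_. 0)" unfolding lin_def by (intro exI[of _ "{}"]) auto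
  have key: "(CLINT \<omega>|P. of_real (\<Prod>t\<in>K. indicator (B t) (Y t \<omega>)) * iexp (S \<omega>)) =
      (CLINT \<omega>|P'. of_real (\<Prod>t\<in>K. indicator (B t) (Y' t \<omega>)) * iexp (S' \<omega>))"
    if "finite K" "K \<subseteq> I" "\<And>t. t \<in> K \<Longrightarrow> B t \<in> sets borel" "lin S S'" for K S S' and B :: "'i \<Rightarrow> real set"
    using that
  proof (induction K arbitrary: S S')
    case empty
    then show ?case unfolding lin_def using ch by auto
  next
    case (insert r K S S')
    define A where "A \<omega> = (\<Prod>t\<in>K. indicator (B t) (Y t \<omega>) :: real)" for \<omega>
    define A' where "A' \<omega> = (\<Prod>t\<in>K. indicator (B t) (Y' t \<omega>) :: real)" for \<omega>
    have KI: "t \<in> I" "B t \<in> sets borel" if "t \<in> K" for t using insert.prems that by auto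
    have rI: "r \<in> I" and Br [measurable]: "B r \<in> sets borel" using insert.prems by auto
    have mA: "A \<in> borel_measurable P"
      unfolding A_def using KI Ym by (intro borel_measurable_prod) (auto intro!: borel_measurable_indicator')
    have mA': "A' \<in> borel_measurable P'"
      unfolding A'_def using KI Ym' by (intro borel_measurable_prod) (auto intro!: borel_measurable_indicator')
    have A01: "0 \<le> A \<omega>" "A \<omega> \<le> 1" for \<omega> unfolding A_def by (auto intro!: prod_nonneg prod_le_1)
    have A'01: "0 \<le> A' \<omega>" "A' \<omega> \<le> 1" for \<omega> unfolding A'_def by (auto intro!: prod_nonneg prod_le_1)
    note mS = linm[OF insert.prems(3)]
    note [measurable] = mA mA' mS Ym[OF rI] Ym'[OF rI]
    \<comment> \<open>The induction hypothesis allows any linear combination in the exponent, in particular one that also contains \<open>Y\<^sub>r\<close>.\<close>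
    have IH: "(CLINT \<omega>|P. of_real (A \<omega>) * iexp (a * S \<omega> + u * Y r \<omega>)) =
        (CLINT \<omega>|P'. of_real (A' \<omega>) * iexp (a * S' \<omega> + u * Y' r \<omega>))" for a u
      unfolding A_def A'_def using insert.prems
      by (intro insert.IH lin_add[OF insert.prems(3) rI]) auto
    have fourier: "(CLINT \<omega>|P. of_real (A \<omega> * (1 + cos (S \<omega> + \<theta>))) * iexp (u * Y r \<omega>)) =
        (CLINT \<omega>|P'. of_real (A' \<omega> * (1 + cos (S' \<omega> + \<theta>))) * iexp (u * Y' r \<omega>))" for \<theta> u
      unfolding P.weighted_cosine_char[OF mA mS(1) Ym[OF rI] A01]
        P'.weighted_cosine_char[OF mA' mS(2) Ym'[OF rI] A'01] IH ..
    have cos1: "0 \<le> 1 + cos (x::real)" for x using cos_ge_minus_one[of x] by linarith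
    have cos2: "1 + cos (x::real) \<le> 2" for x using cos_le_one[of x] by linarith
    have G2: "a * (1 + cos x) \<le> 2" if "0 \<le> a" "a \<le> 1" for a x :: real
      using mult_mono[OF that(2) cos2[of x]] cos1[of x] that by simp
    have weight: "(LINT \<omega>|P. A \<omega> * (1 + cos (S \<omega> + \<theta>)) * indicator (B r) (Y r \<omega>)) =
        (LINT \<omega>|P'. A' \<omega> * (1 + cos (S' \<omega> + \<theta>)) * indicator (B r) (Y' r \<omega>))" for \<theta>
      by (rule weighted_law_unique[where b = 2, OF P P'])
         (use fourier A01 A'01 cos1 G2 in \<open>auto\<close>)
    have weight0: "(LINT \<omega>|P. A \<omega> * indicator (B r) (Y r \<omega>)) = (LINT \<omega>|P'. A' \<omega> * indicator (B r) (Y' r \<omega>))"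
      by (rule weighted_law_unique[where b = 1, OF P P'])
         (use IH[of 0] A01 A'01 in \<open>auto\<close>)
    define R where "R \<omega> = A \<omega> * indicator (B r) (Y r \<omega>)" for \<omega>
    define R' where "R' \<omega> = A' \<omega> * indicator (B r) (Y' r \<omega>)" for \<omega>
    have mR: "R \<in> borel_measurable P" "R' \<in> borel_measurable P'"
      unfolding R_def R'_def by measurable
    have R01: "\<bar>R \<omega>\<bar> \<le> 1" for \<omega> using A01[of \<omega>] by (auto simp: R_def indicator_def)
    have R'01: "\<bar>R' \<omega>\<bar> \<le> 1" for \<omega> using A'01[of \<omega>] by (auto simp: R'_def indicator_def)
    note split = P.bounded_weight_split[OF mR(1) mS(1) R01] P'.bounded_weight_split[OF mR(2) mS(2) R'01]
    have w0: "(LINT \<omega>|P. R \<omega>) = (LINT \<omega>|P'. R' \<omega>)"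
      using weight0 by (simp only: R_def R'_def)
    have w: "(LINT \<omega>|P. R \<omega> * (1 + cos (S \<omega> + \<theta>))) = (LINT \<omega>|P'. R' \<omega> * (1 + cos (S' \<omega> + \<theta>)))" for \<theta>
      using weight[of \<theta>] by (simp only: R_def R'_def mult_ac)
    have Rcos: "(LINT \<omega>|P. R \<omega> * cos (S \<omega> + \<theta>)) = (LINT \<omega>|P'. R' \<omega> * cos (S' \<omega> + \<theta>))" for \<theta>
      using w[of \<theta>] unfolding split(1,3) w0 by simp
    have "(CLINT \<omega>|P. of_real (R \<omega>) * iexp (S \<omega>)) = (CLINT \<omega>|P'. of_real (R' \<omega>) * iexp (S' \<omega>))"
      unfolding split(2,4) Rcos ..
    then show ?case using insert.hyps
      by (simp add: R_def R'_def A_def A'_def mult.commute)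
  qed
  have mY [measurable]: "(\<lambda>\<omega>. \<lambda>t\<in>I. Y t \<omega>) \<in> P \<rightarrow>\<^sub>M (\<Pi>\<^sub>M t\<in>I. borel)"
    by (intro measurable_restrict Ym)
  have mY' [measurable]: "(\<lambda>\<omega>. \<lambda>t\<in>I. Y' t \<omega>) \<in> P' \<rightarrow>\<^sub>M (\<Pi>\<^sub>M t\<in>I. borel)"
    by (intro measurable_restrict Ym')
  show ?thesis
  proof (rule measure_eqI_PiM_infinite[where M = "\<lambda>_. borel"])
    interpret D: prob_space "distr P (\<Pi>\<^sub>M t\<in>I. borel) (\<lambda>\<omega>. \<lambda>t\<in>I. Y t \<omega>)"
      by (rule P.prob_space_distr[OF mY])
    show "finite_measure (distr P (\<Pi>\<^sub>M t\<in>I. borel) (\<lambda>\<omega>. \<lambda>t\<in>I. Y t \<omega>))" by unfold_locales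
  next
    fix B :: "'i \<Rightarrow> real set" and J assume J: "finite J" "J \<subseteq> I" "\<And>t. t \<in> J \<Longrightarrow> B t \<in> sets borel"
    have emb: "prod_emb I (\<lambda>_. borel) J (Pi\<^sub>E J B) \<in> sets (\<Pi>\<^sub>M t\<in>I. borel)"
      using J by (intro sets_PiM_I) auto
    have pre: "(\<lambda>\<omega>. \<lambda>t\<in>I. f t \<omega>) -` prod_emb I (\<lambda>_. borel) J (Pi\<^sub>E J B) \<inter> \<Omega> =
        {\<omega>\<in>\<Omega>. \<forall>t\<in>J. f t \<omega> \<in> B t}" for f :: "'i \<Rightarrow> 'c \<Rightarrow> real" and \<Omega>
      using J(2) by (auto simp: prod_emb_def space_PiM PiE_iff restrict_def extensional_def subset_iff)
    have ind: "indicator {\<omega>\<in>\<Omega>. \<forall>t\<in>J. f t \<omega> \<in> B t} \<omega> = (\<Prod>t\<in>J. indicator (B t) (f t \<omega>) :: real)"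
      if "\<omega> \<in> \<Omega>" for f :: "'i \<Rightarrow> 'c \<Rightarrow> real" and \<Omega> \<omega>
      using J(1) that by (auto simp: indicator_def prod_zero_iff)
    have "complex_of_real (LINT \<omega>|P. (\<Prod>t\<in>J. indicator (B t) (Y t \<omega>))) =
        complex_of_real (LINT \<omega>|P'. (\<Prod>t\<in>J. indicator (B t) (Y' t \<omega>)))"
      using key[OF J lin0] by (simp del: of_real_prod)
    then have eq: "(LINT \<omega>|P. (\<Prod>t\<in>J. indicator (B t) (Y t \<omega>))) =
        (LINT \<omega>|P'. (\<Prod>t\<in>J. indicator (B t) (Y' t \<omega>) :: real))"
      by (simp only: of_real_eq_iff)
    have s: "{\<omega>\<in>space P. \<forall>t\<in>J. Y t \<omega> \<in> B t} \<in> sets P" "{\<omega>\<in>space P'. \<forall>t\<in>J. Y' t \<omega> \<in> B t} \<in> sets P'"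
      using measurable_sets[OF mY emb] measurable_sets[OF mY' emb] unfolding pre by auto
    have "measure P {\<omega>\<in>space P. \<forall>t\<in>J. Y t \<omega> \<in> B t} = (LINT \<omega>|P. indicator {\<omega>\<in>space P. \<forall>t\<in>J. Y t \<omega> \<in> B t} \<omega>)"
      using s by simp
    also have "\<dots> = (LINT \<omega>|P. (\<Prod>t\<in>J. indicator (B t) (Y t \<omega>)))"
      by (rule Bochner_Integration.integral_cong[OF refl ind])
    also have "\<dots> = (LINT \<omega>|P'. (\<Prod>t\<in>J. indicator (B t) (Y' t \<omega>)))" by (rule eq)
    also have "\<dots> = (LINT \<omega>|P'. indicator {\<omega>\<in>space P'. \<forall>t\<in>J. Y' t \<omega> \<in> B t} \<omega>)"
      by (rule Bochner_Integration.integral_cong[OF refl ind[symmetric]])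
    also have "\<dots> = measure P' {\<omega>\<in>space P'. \<forall>t\<in>J. Y' t \<omega> \<in> B t}"
      using s by simp
    finally show "emeasure (distr P (\<Pi>\<^sub>M t\<in>I. borel) (\<lambda>\<omega>. \<lambda>t\<in>I. Y t \<omega>)) (prod_emb I (\<lambda>_. borel) J (Pi\<^sub>E J B)) =
       emeasure (distr P' (\<Pi>\<^sub>M t\<in>I. borel) (\<lambda>\<omega>. \<lambda>t\<in>I. Y' t \<omega>)) (prod_emb I (\<lambda>_. borel) J (Pi\<^sub>E J B))"
      unfolding emeasure_distr[OF mY emb] emeasure_distr[OF mY' emb] pre
      by (simp add: P.emeasure_eq_measure P'.emeasure_eq_measure)
  qed simp_all
qed

section \<open>Hardy operators for a uniform clock\<close>

text \<open>The integrand is only controlled in the interior of the interval, so that it may have an integrable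
  singularity at an end point, such as \<open>1 / sqrt y\<close> at \<open>0\<close>.\<close>

lemma nn_integral_FTC_open:
  fixes \<Phi> \<phi> :: "real \<Rightarrow> real"
  assumes "a < b" and D: "\<And>y. a < y \<Longrightarrow> y < b \<Longrightarrow> DERIV \<Phi> y :> \<phi> y"
    and C: "\<And>y. a < y \<Longrightarrow> y < b \<Longrightarrow> isCont \<phi> y" and nn: "\<And>y. a < y \<Longrightarrow> y < b \<Longrightarrow> 0 \<le> \<phi> y"
    and cont: "continuous_on {a..b} \<Phi>"
  shows "(\<integral>\<^sup>+y. ennreal (indicator {a<..<b} y * \<phi> y) \<partial>lborel) = ennreal (\<Phi> b - \<Phi> a)"
proof -
  have A: "((\<Phi> \<circ> real_of_ereal) \<longlongrightarrow> \<Phi> a) (at_right (ereal a))"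
    unfolding ereal_tendsto_simps using continuous_on_Icc_at_rightD[OF cont \<open>a < b\<close>] .
  have B: "((\<Phi> \<circ> real_of_ereal) \<longlongrightarrow> \<Phi> b) (at_left (ereal b))"
    unfolding ereal_tendsto_simps using continuous_on_Icc_at_leftD[OF cont \<open>a < b\<close>] .
  note FTC = interval_integral_FTC_nonneg[of "ereal a" "ereal b" \<Phi> \<phi>, OF _ _ _ _ A B]
  have 1: "set_integrable lborel {a<..<b} \<phi>"
    using FTC(1) assms(1) D C nn by simp
  have "(LBINT x=ereal a..ereal b. \<phi> x) = \<Phi> b - \<Phi> a"
    using FTC(2) assms(1) D C nn by simp
  then have 2: "(LINT x:{a<..<b}|lborel. \<phi> x) = \<Phi> b - \<Phi> a"
    using \<open>a < b\<close> by (simp add: interval_lebesgue_integral_def)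
  have "(\<integral>\<^sup>+y. ennreal (indicator {a<..<b} y * \<phi> y) \<partial>lborel) =
      ennreal (LINT y|lborel. indicator {a<..<b} y * \<phi> y)"
    by (rule nn_integral_eq_integral)
       (use 1 nn in \<open>auto simp: set_integrable_def indicator_def\<close>)
  then show ?thesis using 2 by (simp add: set_lebesgue_integral_def)
qed

text \<open>A function \<open>F\<close> under which the image of \<open>M\<close> is Lebesgue measure on \<open>[0,c]\<close> (see \<open>F_law\<close>). The
  operators of both kinds are those of a clock: the bracket \<open>\<langle>M\<rangle>\<close> for the first kind, the remaining bracket
  \<open>\<langle>M\<rangle>\<^sub>T - \<langle>M\<rangle>\<close> for the second kind.\<close>

locale uniform_clock = finite_measure M for M :: "'a measure" +
  fixes F :: "'a \<Rightarrow> real" and c :: real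
  assumes F_measurable [measurable]: "F \<in> borel_measurable M"
    and c_pos: "0 < c"
    and F_le: "AE s in M. F s \<le> c"
    and measure_F_le: "\<And>x. 0 \<le> x \<Longrightarrow> x \<le> c \<Longrightarrow> measure M {s\<in>space M. F s \<le> x} = x"
begin

sublocale MM: pair_sigma_finite M M ..

sublocale MMM: pair_sigma_finite "M \<Otimes>\<^sub>M M" M ..

lemma F_pos: "AE s in M. 0 < F s"
proof -
  have "emeasure M {s\<in>space M. F s \<le> 0} = 0"
    using measure_F_le[of 0] c_pos by (simp add: emeasure_eq_measure)
  then have "AE s in M. s \<notin> {s\<in>space M. F s \<le> 0}"
    by (intro AE_not_in) (auto simp: null_sets_def)
  then show ?thesis using AE_space by eventually_elim auto
qed

lemma measure_space: "measure M (space M) = c"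
proof -
  have "measure M (space M) = measure M {s\<in>space M. F s \<le> c}"
    using F_le by (intro finite_measure_eq_AE) auto
  then show ?thesis using measure_F_le[of c] c_pos by simp
qed

lemma F_law: "distr M borel F = density lborel (indicator {0..c})"
proof (rule cdf_unique')
  interpret D: finite_measure "distr M borel F" by (rule finite_measure_distr) simp
  show "finite_borel_measure (distr M borel F)" by unfold_locales simp
  have "finite_measure (density lborel (indicator {0..c} :: real \<Rightarrow> ennreal))"
    by (rule finite_measureI) (use c_pos in \<open>simp add: emeasure_density\<close>)
  then interpret L: finite_measure "density lborel (indicator {0..c} :: real \<Rightarrow> ennreal)" .
  show "finite_borel_measure (density lborel (indicator {0..c} :: real \<Rightarrow> ennreal))" by unfold_locales simp
  show "cdf (distr M borel F) = cdf (density lborel (indicator {0..c}))"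
  proof
    fix x
    have "cdf (distr M borel F) x = measure M {s\<in>space M. F s \<le> x}"
      unfolding cdf_def by (simp add: measure_distr vimage_def Int_def conj_commute)
    also have "\<dots> = (if x < 0 then 0 else if x \<le> c then x else c)"
    proof -
      have "measure M {s\<in>space M. F s \<le> x} = 0" if "x < 0"
      proof -
        have "measure M {s\<in>space M. F s \<le> x} \<le> measure M {s\<in>space M. F s \<le> 0}"
          using that by (intro finite_measure_mono) auto
        then show ?thesis using measure_F_le[of 0] c_pos measure_nonneg[of M "{s\<in>space M. F s \<le> x}"] by simp
      qed
      moreover have "measure M {s\<in>space M. F s \<le> x} = c" if "x > c"
      proof -
        have "measure M {s\<in>space M. F s \<le> x} = measure M (space M)"
          using that F_le by (intro finite_measure_eq_AE) auto
        then show ?thesis by (simp add: measure_space)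
      qed
      ultimately show ?thesis using measure_F_le[of x] by auto
    qed
    also have "\<dots> = measure lborel ({0..c} \<inter> {..x})"
    proof -
      have "{0..c} \<inter> {..x} = (if x < 0 then {} else if x \<le> c then {0..x} else {0..c})" by auto
      then show ?thesis using c_pos by simp
    qed
    also have "\<dots> = cdf (density lborel (indicator {0..c})) x"
    proof -
      have "emeasure (density lborel (indicator {0..c})) {..x} =
          (\<integral>\<^sup>+y. indicator ({0..c} \<inter> {..x}) y \<partial>lborel)"
        by (simp only: indicator_inter_arith) (rule emeasure_density; simp)
      also have "\<dots> = emeasure lborel ({0..c} \<inter> {..x})"
        by (rule nn_integral_indicator) simp
      finally show ?thesis by (simp only: cdf_def measure_def)
    qed
    finally show "cdf (distr M borel F) x = cdf (density lborel (indicator {0..c})) x" .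
  qed
qed

lemma nn_integral_F:
  assumes [measurable]: "\<phi> \<in> borel_measurable borel"
  shows "(\<integral>\<^sup>+s. \<phi> (F s) \<partial>M) = (\<integral>\<^sup>+y. indicator {0..c} y * \<phi> y \<partial>lborel)"
proof -
  have "(\<integral>\<^sup>+s. \<phi> (F s) \<partial>M) = (\<integral>\<^sup>+y. \<phi> y \<partial>distr M borel F)"
    by (subst nn_integral_distr) auto
  also have "\<dots> = (\<integral>\<^sup>+y. indicator {0..c} y * \<phi> y \<partial>lborel)"
    unfolding F_law by (subst nn_integral_density) auto
  finally show ?thesis .
qed

lemma AE_F_neq: "AE s in M. F s \<noteq> x"
proof -
  have "AE y in distr M borel F. y \<noteq> x"
    unfolding F_law by (subst AE_density) (use AE_lborel_singleton[of x] in auto)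
  then show ?thesis by (simp add: AE_distr_iff)
qed

text \<open>The term \<open>1 / c\<close> comes from the end of the clock at \<open>c\<close>. It is the origin of the defect of \<open>\<alpha>\<close> from being
  an isometry.\<close>

lemma nn_integral_inverse_square:
  assumes "0 < m" "m \<le> c"
  shows "(\<integral>\<^sup>+s. ennreal (if m \<le> F s then 1 / (F s)\<^sup>2 else 0) \<partial>M) = ennreal (1 / m - 1 / c)"
proof (cases "m = c")
  case True
  have "(\<integral>\<^sup>+s. ennreal (if m \<le> F s then 1 / (F s)\<^sup>2 else 0) \<partial>M) = (\<integral>\<^sup>+s. 0 \<partial>M)"
  proof (rule nn_integral_cong_AE)
    show "AE s in M. ennreal (if m \<le> F s then 1 / (F s)\<^sup>2 else 0) = 0"
      using F_le AE_F_neq[of c] by eventually_elim (simp add: True)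
  qed
  then show ?thesis using True by simp
next
  case False
  have "(\<integral>\<^sup>+s. ennreal (if m \<le> F s then 1 / (F s)\<^sup>2 else 0) \<partial>M)
      = (\<integral>\<^sup>+y. indicator {0..c} y * ennreal (if m \<le> y then 1 / y\<^sup>2 else 0) \<partial>lborel)"
    by (rule nn_integral_F) simp
  also have "\<dots> = (\<integral>\<^sup>+y. ennreal (indicator {m<..<c} y * (1 / y\<^sup>2)) \<partial>lborel)"
  proof (rule nn_integral_cong_AE)
    show "AE y in lborel. indicator {0..c} y * ennreal (if m \<le> y then 1 / y\<^sup>2 else 0) =
        ennreal (indicator {m<..<c} y * (1 / y\<^sup>2))"
      using AE_lborel_singleton[of m] AE_lborel_singleton[of c]
      by eventually_elim (use assms in \<open>auto simp: indicator_def\<close>)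
  qed
  also have "\<dots> = ennreal (- (1 / c) - - (1 / m))"
    by (rule nn_integral_FTC_open[where \<Phi> = "\<lambda>y. - (1 / y)"])
       (use assms False in \<open>auto intro!: derivative_eq_intros continuous_intros simp: power2_eq_square\<close>)
  finally show ?thesis by (simp add: algebra_simps)
qed

text \<open>Schur's test for the kernel \<open>1 / max x y\<close> with the test function \<open>1 / sqrt y\<close>. The integrals over \<open>y < x\<close> and
  over \<open>y > x\<close> contribute at most \<open>2\<close> each.\<close>

lemma Schur_bound:
  assumes x: "0 < x" "x \<le> c"
  shows "(\<integral>\<^sup>+s. ennreal (sqrt (x / F s) / max x (F s)) \<partial>M) \<le> 4"
proof -
  have i1: "(\<integral>\<^sup>+y. ennreal (indicator {0<..<x} y * (1 / (sqrt x * sqrt y))) \<partial>lborel) = ennreal 2"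
  proof -
    have "(\<integral>\<^sup>+y. ennreal (indicator {0<..<x} y * (1 / (sqrt x * sqrt y))) \<partial>lborel) =
        ennreal (2 * sqrt x / sqrt x - 2 * sqrt 0 / sqrt x)"
      by (rule nn_integral_FTC_open)
         (use x in \<open>auto intro!: derivative_eq_intros continuous_intros simp: field_simps\<close>)
    then show ?thesis using x by simp
  qed
  have i2: "(\<integral>\<^sup>+y. ennreal (indicator {x<..<c} y * (sqrt x / (y * sqrt y))) \<partial>lborel) \<le> ennreal 2"
  proof (cases "x = c")
    case False
    have "(\<integral>\<^sup>+y. ennreal (indicator {x<..<c} y * (sqrt x / (y * sqrt y))) \<partial>lborel) =
        ennreal (- (2 * sqrt x / sqrt c) - - (2 * sqrt x / sqrt x))"
      by (rule nn_integral_FTC_open)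
         (use x False in \<open>auto intro!: derivative_eq_intros continuous_intros simp: field_simps\<close>)
    also have "\<dots> \<le> ennreal 2" using x by (intro ennreal_leI) simp
    finally show ?thesis .
  qed simp
  have "(\<integral>\<^sup>+s. ennreal (sqrt (x / F s) / max x (F s)) \<partial>M) =
      (\<integral>\<^sup>+y. indicator {0..c} y * ennreal (sqrt (x / y) / max x y) \<partial>lborel)"
    by (rule nn_integral_F) simp
  also have "\<dots> \<le> (\<integral>\<^sup>+y. ennreal (indicator {0<..<x} y * (1 / (sqrt x * sqrt y)))
      + ennreal (indicator {x<..<c} y * (sqrt x / (y * sqrt y))) \<partial>lborel)"
  proof (rule nn_integral_mono_AE)
    show "AE y in lborel. indicator {0..c} y * ennreal (sqrt (x / y) / max x y)
        \<le> ennreal (indicator {0<..<x} y * (1 / (sqrt x * sqrt y)))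
        + ennreal (indicator {x<..<c} y * (sqrt x / (y * sqrt y)))"
      using AE_lborel_singleton[of x] AE_lborel_singleton[of c] AE_lborel_singleton[of 0]
    proof eventually_elim
      case (elim y)
      consider "y < 0 \<or> c < y" | "0 < y" "y < x" | "x < y" "y < c" using elim by linarith
      then show ?case
      proof cases
        case 1 then show ?thesis by auto
      next
        case 2
        have "sqrt (x / y) / max x y = 1 / (sqrt x * sqrt y)"
          using 2 by (simp add: real_sqrt_divide field_simps)
        then show ?thesis using 2 x by (simp add: indicator_def)
      next
        case 3
        have "sqrt (x / y) / max x y = sqrt x / (y * sqrt y)"
          using 3 x by (simp add: real_sqrt_divide field_simps)
        then show ?thesis using 3 x by (simp add: indicator_def)
      qed
    qed
  qed
  also have "\<dots> = (\<integral>\<^sup>+y. ennreal (indicator {0<..<x} y * (1 / (sqrt x * sqrt y))) \<partial>lborel)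
      + (\<integral>\<^sup>+y. ennreal (indicator {x<..<c} y * (sqrt x / (y * sqrt y))) \<partial>lborel)"
    by (rule nn_integral_add) auto
  also have "\<dots> \<le> ennreal 2 + ennreal 2" unfolding i1 by (rule add_left_mono[OF i2])
  also have "\<dots> = 4" by (simp add: ennreal_plus[symmetric] del: ennreal_plus)
  finally show ?thesis .
qed

abbreviation "MxM \<equiv> M \<Otimes>\<^sub>M M"

abbreviation "kern f g p \<equiv> f (fst p) * g (snd p) / max (F (fst p)) (F (snd p))"

abbreviation "schur u v \<equiv> sqrt (F u / F v) / max (F u) (F v)"

lemma AE_pair_F: "AE p in MxM. 0 < F (fst p) \<and> F (fst p) \<le> c \<and> 0 < F (snd p) \<and> F (snd p) \<le> c
    \<and> F (fst p) \<noteq> F (snd p)"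
proof (rule MM.AE_pair_measure)
  show "AE x in M. AE y in M. 0 < F (fst (x, y)) \<and> F (fst (x, y)) \<le> c \<and> 0 < F (snd (x, y)) \<and> F (snd (x, y)) \<le> c
    \<and> F (fst (x, y)) \<noteq> F (snd (x, y))"
    using F_pos F_le
  proof eventually_elim
    case (elim x)
    show ?case using F_pos F_le AE_F_neq[of "F x"] by eventually_elim (use elim in auto)
  qed
qed measurable

text \<open>Hardy's inequality in bilinear form. With \<open>r = sqrt (F u / F v)\<close> one has
  \<open>\<bar>f u * g v\<bar> \<le> (f u)\<^sup>2 * r + (g v)\<^sup>2 / r\<close>, and \<open>Schur_bound\<close> integrates out the variable that the square does not
  contain.\<close>

lemma kernel_integrable:
  assumes f: "f \<in> L2 M" and g: "g \<in> L2 M"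
  shows "integrable MxM (\<lambda>p. kern f g p)"
proof (rule integrableI_bounded)
  have [measurable]: "f \<in> borel_measurable M" "g \<in> borel_measurable M" using f g by (auto dest: L2_D)
  show "(\<lambda>p. kern f g p) \<in> borel_measurable MxM"
    by measurable
  have L: "(\<integral>\<^sup>+u. ennreal ((h u)\<^sup>2) * 4 \<partial>M) < \<infinity>" if "h \<in> L2 M" for h
  proof -
    have [measurable]: "h \<in> borel_measurable M" using that by (rule L2_D)
    have "(\<integral>\<^sup>+u. ennreal ((h u)\<^sup>2) * 4 \<partial>M) = (\<integral>\<^sup>+u. ennreal ((h u)\<^sup>2) \<partial>M) * 4"
      by (rule nn_integral_multc) simp
    also have "(\<integral>\<^sup>+u. ennreal ((h u)\<^sup>2) \<partial>M) = ennreal (LINT u|M. (h u)\<^sup>2)"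
      by (rule nn_integral_eq_integral) (use that in \<open>auto dest: L2_D\<close>)
    finally show ?thesis by (simp add: ennreal_mult_less_top)
  qed
  have S: "(\<integral>\<^sup>+u. (\<integral>\<^sup>+v. ennreal ((h u)\<^sup>2) * ennreal (schur u v) \<partial>M) \<partial>M) < \<infinity>"
    if "h \<in> L2 M" for h
  proof -
    have [measurable]: "h \<in> borel_measurable M" using that by (rule L2_D)
    have "(\<integral>\<^sup>+u. (\<integral>\<^sup>+v. ennreal ((h u)\<^sup>2) * ennreal (schur u v) \<partial>M) \<partial>M)
        \<le> (\<integral>\<^sup>+u. ennreal ((h u)\<^sup>2) * 4 \<partial>M)"
    proof (rule nn_integral_mono_AE)
      show "AE u in M. (\<integral>\<^sup>+v. ennreal ((h u)\<^sup>2) * ennreal (schur u v) \<partial>M)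
          \<le> ennreal ((h u)\<^sup>2) * 4"
        using F_pos F_le
      proof eventually_elim
        case (elim u)
        have "(\<integral>\<^sup>+v. ennreal ((h u)\<^sup>2) * ennreal (schur u v) \<partial>M) =
            ennreal ((h u)\<^sup>2) * (\<integral>\<^sup>+v. ennreal (schur u v) \<partial>M)"
          by (rule nn_integral_cmult) simp
        then show ?case using Schur_bound[OF elim] by (auto intro: mult_left_mono)
      qed
    qed
    also note L[OF that]
    finally show ?thesis .
  qed
  have "(\<integral>\<^sup>+p. ennreal (norm (kern f g p)) \<partial>MxM) \<le>
     (\<integral>\<^sup>+p. ennreal ((f (fst p))\<^sup>2) * ennreal (schur (fst p) (snd p))
        + ennreal ((g (snd p))\<^sup>2) * ennreal (schur (snd p) (fst p)) \<partial>MxM)"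
  proof (rule nn_integral_mono_AE)
    show "AE p in MxM. ennreal (norm (kern f g p)) \<le>
       ennreal ((f (fst p))\<^sup>2) * ennreal (schur (fst p) (snd p))
        + ennreal ((g (snd p))\<^sup>2) * ennreal (schur (snd p) (fst p))"
      using AE_pair_F
    proof eventually_elim
      case (elim p)
      define a b x y where "a = f (fst p)" and "b = g (snd p)" and "x = F (fst p)" and "y = F (snd p)"
      have xy: "0 < x" "0 < y" using elim by (auto simp: x_def y_def)
      define r where "r = sqrt (x / y)"
      have r: "r > 0" "sqrt (y / x) = 1 / r" using xy by (simp_all add: r_def real_sqrt_divide)
      have "2 * (\<bar>a\<bar> * r) * \<bar>b\<bar> \<le> (\<bar>a\<bar> * r)\<^sup>2 + \<bar>b\<bar>\<^sup>2" by (rule sum_squares_bound)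
      moreover have "(a\<^sup>2 * r + b\<^sup>2 * (1 / r)) * r = (\<bar>a\<bar> * r)\<^sup>2 + \<bar>b\<bar>\<^sup>2"
        using r(1) by (simp add: power_mult_distrib power2_eq_square field_simps)
      ultimately have "2 * (\<bar>a\<bar> * \<bar>b\<bar>) * r \<le> (a\<^sup>2 * r + b\<^sup>2 * (1 / r)) * r"
        by (simp only: mult_ac)
      then have "2 * (\<bar>a\<bar> * \<bar>b\<bar>) \<le> a\<^sup>2 * r + b\<^sup>2 * (1 / r)" using r(1) by simp
      then have "\<bar>a * b\<bar> \<le> a\<^sup>2 * r + b\<^sup>2 * (1 / r)"
        unfolding abs_mult using mult_nonneg_nonneg[OF abs_ge_zero[of a] abs_ge_zero[of b]] by linarith
      then have "\<bar>a * b\<bar> / max x y \<le> (a\<^sup>2 * r + b\<^sup>2 * (1 / r)) / max x y"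
        using xy by (intro divide_right_mono) auto
      also have "\<dots> = a\<^sup>2 * (r / max x y) + b\<^sup>2 * ((1 / r) / max y x)"
        by (simp add: add_divide_distrib max.commute)
      finally have "norm (a * b / max x y) \<le> a\<^sup>2 * (sqrt (x / y) / max x y) + b\<^sup>2 * (sqrt (y / x) / max y x)"
        using xy unfolding r(2) by (simp add: r_def abs_mult)
      then have "ennreal (norm (a * b / max x y)) \<le>
          ennreal (a\<^sup>2 * (sqrt (x / y) / max x y) + b\<^sup>2 * (sqrt (y / x) / max y x))" by (rule ennreal_leI)
      also have "\<dots> = ennreal (a\<^sup>2) * ennreal (sqrt (x / y) / max x y) + ennreal (b\<^sup>2) * ennreal (sqrt (y / x) / max y x)"
        using xy by (subst ennreal_plus) (auto intro!: arg_cong2[where f = "(+)"] ennreal_mult simp del: times_divide_eq_right)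
      finally show ?case unfolding a_def b_def x_def y_def .
    qed
  qed
  also have "\<dots> = (\<integral>\<^sup>+p. ennreal ((f (fst p))\<^sup>2) * ennreal (schur (fst p) (snd p)) \<partial>MxM)
        + (\<integral>\<^sup>+p. ennreal ((g (snd p))\<^sup>2) * ennreal (schur (snd p) (fst p)) \<partial>MxM)"
    by (rule nn_integral_add) measurable
  also have "(\<integral>\<^sup>+p. ennreal ((f (fst p))\<^sup>2) * ennreal (schur (fst p) (snd p)) \<partial>MxM)
      = (\<integral>\<^sup>+u. (\<integral>\<^sup>+v. ennreal ((f u)\<^sup>2) * ennreal (schur u v) \<partial>M) \<partial>M)"
  proof -
    have "(\<lambda>p. ennreal ((f (fst p))\<^sup>2) * ennreal (schur (fst p) (snd p)))
        \<in> borel_measurable MxM" by measurable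
    from nn_integral_fst[OF this] show ?thesis by simp
  qed
  also have "(\<integral>\<^sup>+p. ennreal ((g (snd p))\<^sup>2) * ennreal (schur (snd p) (fst p)) \<partial>MxM)
      = (\<integral>\<^sup>+v. (\<integral>\<^sup>+u. ennreal ((g v)\<^sup>2) * ennreal (schur v u) \<partial>M) \<partial>M)"
  proof -
    have "(\<lambda>p. ennreal ((g (snd p))\<^sup>2) * ennreal (schur (snd p) (fst p)))
        \<in> borel_measurable MxM" by measurable
    from MM.nn_integral_snd[OF this] show ?thesis by simp
  qed
  also have "(\<integral>\<^sup>+u. (\<integral>\<^sup>+v. ennreal ((f u)\<^sup>2) * ennreal (schur u v) \<partial>M) \<partial>M) +
      (\<integral>\<^sup>+v. (\<integral>\<^sup>+u. ennreal ((g v)\<^sup>2) * ennreal (schur v u) \<partial>M) \<partial>M) < \<infinity>"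
    using S[OF f] S[OF g] by simp
  finally show "(\<integral>\<^sup>+p. ennreal (norm (kern f g p)) \<partial>MxM) < \<infinity>" .
qed

lemma positive_kernel_bilinear:
  assumes wm [measurable]: "case_prod w \<in> borel_measurable MxM"
    and w: "\<And>s u. 0 < F s \<Longrightarrow> 0 < F u \<Longrightarrow> 0 \<le> w s u \<and> w s u \<le> 1 / max (F s) (F u)"
    and f: "f \<in> L2 M" and g: "g \<in> L2 M"
  shows "integrable MxM (\<lambda>p. f (fst p) * (w (fst p) (snd p) * g (snd p)))"
    and "(LINT s|M. f s * (LINT u|M. w s u * g u)) =
      (LINT p|MxM. f (fst p) * (w (fst p) (snd p) * g (snd p)))"
proof -
  have [measurable]: "f \<in> borel_measurable M" "g \<in> borel_measurable M" using f g by (auto dest: L2_D)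
  have [measurable]: "(\<lambda>p. w (fst p) (snd p)) \<in> borel_measurable MxM"
    using wm by (simp add: case_prod_beta')
  show int: "integrable MxM (\<lambda>p. f (fst p) * (w (fst p) (snd p) * g (snd p)))"
  proof (rule Bochner_Integration.integrable_bound[OF kernel_integrable[OF f g]])
    show "AE p in MxM. norm (f (fst p) * (w (fst p) (snd p) * g (snd p))) \<le>
        norm (kern f g p)"
      using AE_pair_F
    proof eventually_elim
      case (elim p)
      let ?k = "1 / max (F (fst p)) (F (snd p))" and ?w = "w (fst p) (snd p)"
      have "\<bar>?w\<bar> \<le> \<bar>?k\<bar>" using w[of "fst p" "snd p"] elim by auto
      then have "\<bar>f (fst p) * g (snd p)\<bar> * \<bar>?w\<bar> \<le> \<bar>f (fst p) * g (snd p)\<bar> * \<bar>?k\<bar>"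
        by (rule mult_left_mono) simp
      then show ?case by (simp add: abs_mult ac_simps)
    qed
  qed measurable
  have "(LINT s|M. f s * (LINT u|M. w s u * g u)) = (LINT s|M. (LINT u|M. f s * (w s u * g u)))"
    by simp
  also have "\<dots> = (LINT p|MxM. f (fst p) * (w (fst p) (snd p) * g (snd p)))"
    using MM.integral_fst'[OF int] by simp
  finally show "(LINT s|M. f s * (LINT u|M. w s u * g u)) =
      (LINT p|MxM. f (fst p) * (w (fst p) (snd p) * g (snd p)))" .
qed

text \<open>If \<open>A\<close> is the integral operator with kernel \<open>w\<close>, then \<open>A\<^sup>* A\<close> has the kernel
  \<open>\<integral> w(s,u) w(s,v) dM(s)\<close>, by Fubini's theorem in three variables. The constant \<open>d\<close> covers the tail operator,
  where it is \<open>0\<close>, and its adjoint, where it is \<open>1 / c\<close>.\<close>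

lemma positive_kernel_Gram:
  assumes wm [measurable]: "case_prod w \<in> borel_measurable MxM"
    and w0: "\<And>s u. 0 < F s \<Longrightarrow> 0 < F u \<Longrightarrow> 0 \<le> w s u"
    and W: "\<And>u v. 0 < F u \<Longrightarrow> F u \<le> c \<Longrightarrow> 0 < F v \<Longrightarrow> F v \<le> c \<Longrightarrow>
        has_bochner_integral M (\<lambda>s. w s u * w s v) (1 / max (F u) (F v) - d)"
    and Wle: "\<And>u v. 0 < F u \<Longrightarrow> F u \<le> c \<Longrightarrow> 0 < F v \<Longrightarrow> F v \<le> c \<Longrightarrow>
        0 \<le> 1 / max (F u) (F v) - d"
    and d: "0 \<le> d"
    and f: "f \<in> L2 M" and g: "g \<in> L2 M"
  shows "(\<lambda>s. \<integral>u. w s u * f u \<partial>M) \<in> L2 M"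
    and "(LINT s|M. (LINT u|M. w s u * f u) * (LINT u|M. w s u * g u)) =
      (LINT p|MxM. kern f g p)
      - d * (LINT u|M. f u) * (LINT u|M. g u)"
proof -
  have wm' [measurable]: "(\<lambda>x. w (a x) (b x)) \<in> borel_measurable N"
    if [measurable]: "a \<in> N \<rightarrow>\<^sub>M M" "b \<in> N \<rightarrow>\<^sub>M M" for a b N
    using measurable_compose[OF measurable_Pair[OF that] wm] by simp
  let ?A = "\<lambda>f s. \<integral>u. w s u * f u \<partial>M"
  let ?k = "\<lambda>p. 1 / max (F (fst p)) (F (snd p))"
  have gen: "integrable M (\<lambda>s. ?A f s * ?A g s) \<and> (LINT s|M. ?A f s * ?A g s) =
      (LINT p|MxM. f (fst p) * g (snd p) * (?k p - d))" if f: "f \<in> L2 M" and g: "g \<in> L2 M" for f g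
  proof -
    have [measurable]: "f \<in> borel_measurable M" "g \<in> borel_measurable M" using f g by (auto dest: L2_D)
    define \<Psi> where "\<Psi> = (\<lambda>(p, s). w s (fst p) * w s (snd p) * (f (fst p) * g (snd p)))"
    have hbi: "AE p in MxM. 0 \<le> ?k p - d \<and> ?k p - d \<le> ?k p \<and>
        has_bochner_integral M (\<lambda>s. w s (fst p) * w s (snd p)) (?k p - d)"
      using AE_pair_F by eventually_elim (use W Wle d in auto)
    have \<Psi>m [measurable]: "\<Psi> \<in> borel_measurable (MxM \<Otimes>\<^sub>M M)"
      unfolding \<Psi>_def case_prod_beta' by measurable
    have k_int: "integrable MxM (\<lambda>p. f (fst p) * g (snd p) * (?k p - d))"
    proof (rule Bochner_Integration.integrable_bound[OF kernel_integrable[OF f g]])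
      show "AE p in MxM. norm (f (fst p) * g (snd p) * (?k p - d)) \<le>
          norm (kern f g p)"
        using hbi
      proof eventually_elim
        case (elim p)
        have "\<bar>?k p - d\<bar> \<le> \<bar>?k p\<bar>" using elim by linarith
        then have "\<bar>f (fst p) * g (snd p)\<bar> * \<bar>?k p - d\<bar> \<le> \<bar>f (fst p) * g (snd p)\<bar> * \<bar>?k p\<bar>"
          by (rule mult_left_mono) simp
        then show ?case by (simp add: abs_mult)
      qed
    qed measurable
    have \<Psi>_s: "AE p in MxM. integrable M (\<lambda>s. \<Psi> (p, s)) \<and> (LINT s|M. norm (\<Psi> (p, s))) = norm (f (fst p) * g (snd p) * (?k p - d))
        \<and> (LINT s|M. \<Psi> (p, s)) = f (fst p) * g (snd p) * (?k p - d)"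
      using hbi AE_pair_F
    proof eventually_elim
      case (elim p)
      have i: "integrable M (\<lambda>s. w s (fst p) * w s (snd p))"
        and v: "(LINT s|M. w s (fst p) * w s (snd p)) = ?k p - d"
        using elim by (auto simp: has_bochner_integral_iff)
      have nn: "AE s in M. 0 \<le> w s (fst p) * w s (snd p)"
        using F_pos by eventually_elim (use w0 elim in auto)
      have "(LINT s|M. norm (\<Psi> (p, s))) = (LINT s|M. (w s (fst p) * w s (snd p)) * \<bar>f (fst p) * g (snd p)\<bar>)"
      proof (rule integral_cong_AE)
        show "AE s in M. norm (\<Psi> (p, s)) = (w s (fst p) * w s (snd p)) * \<bar>f (fst p) * g (snd p)\<bar>"
          using nn
        proof eventually_elim
          case (elim s)
          then show ?case
            using abs_mult[of "w s (fst p) * w s (snd p)" "f (fst p) * g (snd p)"]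
            by (simp only: \<Psi>_def prod.case real_norm_def abs_of_nonneg)
        qed
        show "(\<lambda>s. norm (\<Psi> (p, s))) \<in> borel_measurable M" 
          unfolding \<Psi>_def using borel_measurable_integrable[OF i] by simp
        show "(\<lambda>s. (w s (fst p) * w s (snd p)) * \<bar>f (fst p) * g (snd p)\<bar>) \<in> borel_measurable M"
          using borel_measurable_integrable[OF i] by simp
      qed
      also have "\<dots> = norm (f (fst p) * g (snd p) * (?k p - d))"
        using v elim by (simp add: abs_mult)
      finally show ?case using i v by (simp add: \<Psi>_def)
    qed
    have \<Psi>_int: "integrable (MxM \<Otimes>\<^sub>M M) \<Psi>"
    proof (rule MMM.Fubini_integrable[OF \<Psi>m])
      show "integrable MxM (\<lambda>p. \<integral>s. norm (\<Psi> (p, s)) \<partial>M)"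
      proof (rule Bochner_Integration.integrable_cong_AE_imp[OF integrable_norm[OF k_int]])
        show "AE p in MxM. norm (f (fst p) * g (snd p) * (?k p - d)) = (LINT s|M. norm (\<Psi> (p, s)))"
          using \<Psi>_s by eventually_elim simp
      qed measurable
      show "AE p in MxM. integrable M (\<lambda>s. \<Psi> (p, s))"
        using \<Psi>_s by eventually_elim simp
    qed
    then have \<Psi>_int': "integrable (MxM \<Otimes>\<^sub>M M) (\<lambda>(p, s). \<Psi> (p, s))" by simp
    \<comment> \<open>For fixed \<open>s\<close> the integrand is a product of a function of \<open>u\<close> and one of \<open>v\<close>.\<close>
    have inner: "AE s in M. (LINT p|MxM. \<Psi> (p, s)) = ?A f s * ?A g s"
      using MMM.AE_integrable_snd[OF \<Psi>_int']
    proof eventually_elim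
      case (elim s)
      have "(LINT p|MxM. \<Psi> (p, s)) = (LINT u|M. (LINT v|M. \<Psi> ((u, v), s)))"
        by (rule MM.integral_fst'[OF elim, symmetric])
      also have "\<dots> = (LINT u|M. (LINT v|M. (w s u * f u) * (w s v * g v)))"
        by (simp add: \<Psi>_def ac_simps)
      also have "\<dots> = ?A f s * ?A g s" by simp
      finally show ?case .
    qed
    have m2: "(\<lambda>s. \<integral>p. \<Psi> (p, s) \<partial>MxM) \<in> borel_measurable M"
      using MMM.integrable_snd[OF \<Psi>_int'] by (rule borel_measurable_integrable)
    have i: "integrable M (\<lambda>s. ?A f s * ?A g s)"
    proof (rule Bochner_Integration.integrable_cong_AE_imp[OF MMM.integrable_snd[OF \<Psi>_int']])
      show "(\<lambda>s. ?A f s * ?A g s) \<in> borel_measurable M" by measurable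
    qed (use inner in auto)
    have "(LINT s|M. ?A f s * ?A g s) = (LINT s|M. (LINT p|MxM. \<Psi> (p, s)))"
      by (rule integral_cong_AE) (use m2 inner i in auto)
    also have "\<dots> = (LINT p|MxM. (LINT s|M. \<Psi> (p, s)))"
      by (rule MMM.Fubini_integral[OF \<Psi>_int'])
    also have "\<dots> = (LINT p|MxM. f (fst p) * g (snd p) * (?k p - d))"
    proof (rule integral_cong_AE)
      show "AE p in MxM. (LINT s|M. \<Psi> (p, s)) = f (fst p) * g (snd p) * (?k p - d)"
        using \<Psi>_s by eventually_elim simp
    qed measurable
    finally show ?thesis using i by simp
  qed
  have [measurable]: "f \<in> borel_measurable M" "g \<in> borel_measurable M" using f g by (auto dest: L2_D)
  show "(\<lambda>s. ?A f s) \<in> L2 M"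
  proof (rule L2_I)
    show "?A f \<in> borel_measurable M" by measurable
  qed (use gen[OF f f] in \<open>simp add: power2_eq_square\<close>)
  have fi: "integrable M f" "integrable M g" using L2_integrable[OF _ f] L2_integrable[OF _ g] finite_measure_axioms by auto
  have prod_int: "integrable MxM (\<lambda>p. f (fst p) * g (snd p))"
  proof (rule MM.Fubini_integrable)
    show "integrable M (\<lambda>x. \<integral>y. norm (f (fst (x, y)) * g (snd (x, y))) \<partial>M)"
      using fi by (simp add: abs_mult)
    show "AE x in M. integrable M (\<lambda>y. f (fst (x, y)) * g (snd (x, y)))"
      using fi by simp
  qed measurable
  have prod_val: "(LINT p|MxM. f (fst p) * g (snd p)) = (LINT u|M. f u) * (LINT u|M. g u)"
    using MM.integral_fst'[OF prod_int] by simp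
  have "(LINT s|M. ?A f s * ?A g s) = (LINT p|MxM. kern f g p - d * (f (fst p) * g (snd p)))"
    using gen[OF f g] by (simp add: right_diff_distrib mult.commute)
  also have "\<dots> = (LINT p|MxM. kern f g p) - d * (LINT p|MxM. f (fst p) * g (snd p))"
    using kernel_integrable[OF f g] prod_int by simp
  finally show "(LINT s|M. ?A f s * ?A g s) =
      (LINT p|MxM. kern f g p)
      - d * (LINT u|M. f u) * (LINT u|M. g u)"
    by (simp add: prod_val)
qed

text \<open>The kernel of \<open>f \<mapsto> \<integral>\<^bsub>{F \<ge> F s}\<^esub> f / F dM\<close>. With its arguments exchanged, it is the kernel of the adjoint, which
  is the average of \<open>f\<close> over \<open>{F \<le> F s}\<close>.\<close>

definition tail_kernel :: "'a \<Rightarrow> 'a \<Rightarrow> real" where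
  "tail_kernel s u = (if F s \<le> F u then 1 / F u else 0)"

lemma tail_kernel_measurable [measurable]: "case_prod tail_kernel \<in> borel_measurable MxM"
  unfolding tail_kernel_def case_prod_beta' by measurable

lemma tail_kernel_measurable' [measurable]: "(\<lambda>(s, u). tail_kernel u s) \<in> borel_measurable MxM"
  unfolding tail_kernel_def case_prod_beta' by measurable

lemma tail_kernel_bound:
  assumes "0 < F s" "0 < F u"
  shows "0 \<le> tail_kernel s u \<and> tail_kernel s u \<le> 1 / max (F s) (F u)"
  using assms by (auto simp: tail_kernel_def max_def)

lemma tail_kernel_bound':
  assumes "0 < F s" "0 < F u"
  shows "0 \<le> tail_kernel u s \<and> tail_kernel u s \<le> 1 / max (F s) (F u)"
  using tail_kernel_bound[OF assms(2,1)] by (simp add: max.commute)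

lemma tail_kernel_Gram:
  assumes "0 < F u" "F u \<le> c" "0 < F v" "F v \<le> c"
  shows "has_bochner_integral M (\<lambda>s. tail_kernel s u * tail_kernel s v) (1 / max (F u) (F v) - 0)"
proof -
  let ?m = "min (F u) (F v)" and ?A = "{s\<in>space M. F s \<le> min (F u) (F v)}"
  have "has_bochner_integral M (\<lambda>s. indicator ?A s *\<^sub>R (1 / (F u * F v))) (measure M ?A *\<^sub>R (1 / (F u * F v)))"
    by (intro has_bochner_integral_scaleR_left has_bochner_integral_real_indicator) (auto simp: less_top[symmetric])
  moreover have "measure M ?A *\<^sub>R (1 / (F u * F v)) = 1 / max (F u) (F v) - 0"
    using assms measure_F_le[of ?m] by (auto simp: min_def max_def)
  moreover have "tail_kernel s u * tail_kernel s v = indicator ?A s *\<^sub>R (1 / (F u * F v))" if "s \<in> space M" for s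
    using that by (auto simp: tail_kernel_def indicator_def)
  ultimately show ?thesis by (simp cong: has_bochner_integral_cong)
qed

lemma average_kernel_Gram:
  assumes "0 < F u" "F u \<le> c" "0 < F v" "F v \<le> c"
  shows "has_bochner_integral M (\<lambda>s. tail_kernel u s * tail_kernel v s) (1 / max (F u) (F v) - 1 / c)"
proof -
  let ?m = "max (F u) (F v)"
  have "has_bochner_integral M (\<lambda>s. if ?m \<le> F s then 1 / (F s)\<^sup>2 else 0) (1 / ?m - 1 / c)"
  proof (rule has_bochner_integral_nn_integral)
    show "0 \<le> 1 / ?m - 1 / c" using assms c_pos by (simp add: frac_le)
    show "(\<integral>\<^sup>+s. ennreal (if ?m \<le> F s then 1 / (F s)\<^sup>2 else 0) \<partial>M) = ennreal (1 / ?m - 1 / c)"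
      by (rule nn_integral_inverse_square) (use assms in auto)
  qed auto
  moreover have "tail_kernel u s * tail_kernel v s = (if ?m \<le> F s then 1 / (F s)\<^sup>2 else 0)" for s
    by (auto simp: tail_kernel_def power2_eq_square)
  ultimately show ?thesis by simp
qed

definition beta :: "('a \<Rightarrow> real) \<Rightarrow> 'a \<Rightarrow> real" where
  "beta f s = f s - (LINT u|M. tail_kernel s u * f u)"

definition alpha :: "('a \<Rightarrow> real) \<Rightarrow> 'a \<Rightarrow> real" where
  "alpha f s = f s - (LINT u|M. tail_kernel u s * f u)"

lemma tail_adjoint:
  assumes f: "f \<in> L2 M" and g: "g \<in> L2 M"
  shows "(LINT s|M. f s * (LINT u|M. tail_kernel u s * g u)) = (LINT s|M. g s * (LINT u|M. tail_kernel s u * f u))"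
proof -
  have [measurable]: "f \<in> borel_measurable M" "g \<in> borel_measurable M" using f g by (auto dest: L2_D)
  have "(LINT s|M. f s * (LINT u|M. tail_kernel u s * g u)) =
      (LINT p|MxM. f (fst p) * (tail_kernel (snd p) (fst p) * g (snd p)))"
    by (rule positive_kernel_bilinear(2)[of "\<lambda>s u. tail_kernel u s", OF tail_kernel_measurable' _ f g])
       (rule tail_kernel_bound')
  also have "\<dots> = (\<integral>(s, u). g s * (tail_kernel s u * f u) \<partial>MxM)"
    by (subst MM.integral_product_swap[symmetric])
       (simp_all add: case_prod_beta' ac_simps, measurable)
  also have "\<dots> = (LINT s|M. g s * (LINT u|M. tail_kernel s u * f u))"
    using positive_kernel_bilinear(2)[of tail_kernel g f] f g tail_kernel_bound
    by (simp add: case_prod_beta')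
  finally show ?thesis .
qed

text \<open>For distinct positive values \<open>F s\<close> and \<open>F u\<close> exactly one of \<open>tail_kernel s u\<close> and \<open>tail_kernel u s\<close> is nonzero, and it is
  \<open>1 / max (F s) (F u)\<close>; the set where \<open>F s = F u\<close> is a null set of the product measure.\<close>

lemma tail_symmetrised:
  assumes f: "f \<in> L2 M" and g: "g \<in> L2 M"
  shows "(LINT s|M. f s * (LINT u|M. tail_kernel s u * g u)) + (LINT s|M. g s * (LINT u|M. tail_kernel s u * f u))
     = (LINT p|MxM. kern f g p)"
proof -
  have [measurable]: "f \<in> borel_measurable M" "g \<in> borel_measurable M" using f g by (auto dest: L2_D)
  have i1: "integrable MxM (\<lambda>p. f (fst p) * (tail_kernel (fst p) (snd p) * g (snd p)))"
    by (rule positive_kernel_bilinear(1)[OF tail_kernel_measurable _ f g]) (rule tail_kernel_bound)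
  have v1: "(LINT s|M. f s * (LINT u|M. tail_kernel s u * g u)) =
      (LINT p|MxM. f (fst p) * (tail_kernel (fst p) (snd p) * g (snd p)))"
    by (rule positive_kernel_bilinear(2)[OF tail_kernel_measurable _ f g]) (rule tail_kernel_bound)
  have i2: "integrable MxM (\<lambda>p. f (fst p) * (tail_kernel (snd p) (fst p) * g (snd p)))"
    by (rule positive_kernel_bilinear(1)[of "\<lambda>s u. tail_kernel u s", OF tail_kernel_measurable' _ f g])
       (rule tail_kernel_bound')
  have v2: "(LINT s|M. f s * (LINT u|M. tail_kernel u s * g u)) =
      (LINT p|MxM. f (fst p) * (tail_kernel (snd p) (fst p) * g (snd p)))"
    by (rule positive_kernel_bilinear(2)[of "\<lambda>s u. tail_kernel u s", OF tail_kernel_measurable' _ f g])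
       (rule tail_kernel_bound')
  have "(LINT s|M. f s * (LINT u|M. tail_kernel s u * g u)) + (LINT s|M. g s * (LINT u|M. tail_kernel s u * f u)) =
     (LINT p|MxM. f (fst p) * (tail_kernel (fst p) (snd p) * g (snd p)) + f (fst p) * (tail_kernel (snd p) (fst p) * g (snd p)))"
    unfolding tail_adjoint[OF f g, symmetric] v1 v2
    by (rule Bochner_Integration.integral_add[OF i1 i2, symmetric])
  also have "\<dots> = (LINT p|MxM. kern f g p)"
  proof (rule integral_cong_AE)
    show "AE p in MxM. f (fst p) * (tail_kernel (fst p) (snd p) * g (snd p)) + f (fst p) * (tail_kernel (snd p) (fst p) * g (snd p))
       = kern f g p"
      using AE_pair_F by eventually_elim (auto simp: tail_kernel_def max_def)
    show "(\<lambda>p. f (fst p) * (tail_kernel (fst p) (snd p) * g (snd p)) + f (fst p) * (tail_kernel (snd p) (fst p) * g (snd p)))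
        \<in> borel_measurable MxM"
      by (rule borel_measurable_integrable[OF Bochner_Integration.integrable_add[OF i1 i2]])
  qed measurable
  finally show ?thesis .
qed

lemma tail_L2: "f \<in> L2 M \<Longrightarrow> (\<lambda>s. \<integral>u. tail_kernel s u * f u \<partial>M) \<in> L2 M"
  by (rule positive_kernel_Gram(1)[where d = 0 and g = f])
     (use tail_kernel_bound tail_kernel_Gram in \<open>auto\<close>)

lemma tail_Gram:
  assumes "f \<in> L2 M" "g \<in> L2 M"
  shows "(LINT s|M. (LINT u|M. tail_kernel s u * f u) * (LINT u|M. tail_kernel s u * g u)) =
     (LINT p|MxM. kern f g p)"
  using positive_kernel_Gram(2)[of tail_kernel 0 f g] assms tail_kernel_bound tail_kernel_Gram by auto

lemma average_bounds:
  assumes "0 < F u" "F u \<le> c" "0 < F v" "F v \<le> c"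
  shows "0 \<le> 1 / max (F u) (F v) - 1 / c"
  using assms c_pos by (simp add: frac_le)

lemma average_L2: "f \<in> L2 M \<Longrightarrow> (\<lambda>s. \<integral>u. tail_kernel u s * f u \<partial>M) \<in> L2 M"
  by (rule positive_kernel_Gram(1)[of "\<lambda>s u. tail_kernel u s" "1 / c" f f,
        OF tail_kernel_measurable' _ average_kernel_Gram average_bounds])
     (use tail_kernel_bound c_pos in \<open>auto\<close>)

lemma average_Gram:
  assumes "f \<in> L2 M" "g \<in> L2 M"
  shows "(LINT s|M. (LINT u|M. tail_kernel u s * f u) * (LINT u|M. tail_kernel u s * g u)) =
     (LINT p|MxM. kern f g p)
     - (LINT u|M. f u) * (LINT u|M. g u) / c"
  using positive_kernel_Gram(2)[of "\<lambda>s u. tail_kernel u s" "1 / c" f g,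
      OF tail_kernel_measurable' _ average_kernel_Gram average_bounds _ assms] tail_kernel_bound c_pos
  by auto

lemma diff_Gram:
  assumes "f \<in> L2 M" "g \<in> L2 M" "a \<in> L2 M" "b \<in> L2 M"
  shows "(LINT s|M. (f s - a s) * (g s - b s)) =
    (LINT s|M. f s * g s) - (LINT s|M. f s * b s) - (LINT s|M. g s * a s) + (LINT s|M. a s * b s)"
proof -
  have "(LINT s|M. (f s - a s) * (g s - b s)) = (LINT s|M. f s * g s - f s * b s - g s * a s + a s * b s)"
    by (simp add: algebra_simps)
  then show ?thesis
    using L2_mult_integrable[OF assms(1,2)] L2_mult_integrable[OF assms(1,4)]
      L2_mult_integrable[OF assms(2,3)] L2_mult_integrable[OF assms(3,4)] by simp
qed

theorem beta_L2: "f \<in> L2 M \<Longrightarrow> beta f \<in> L2 M"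
  unfolding beta_def by (intro L2_diff tail_L2)

theorem alpha_L2: "f \<in> L2 M \<Longrightarrow> alpha f \<in> L2 M"
  unfolding alpha_def by (intro L2_diff average_L2)

text \<open>With the tail operator \<open>A\<close>, this is \<open>(I - A)\<^sup>* (I - A) = I\<close>, that is \<open>A\<^sup>* A = A + A\<^sup>*\<close>.\<close>

theorem beta_isometry:
  assumes "f \<in> L2 M" "g \<in> L2 M"
  shows "(LINT s|M. beta f s * beta g s) = (LINT s|M. f s * g s)"
  unfolding beta_def diff_Gram[OF assms tail_L2 tail_L2, OF assms]
  using tail_Gram[OF assms] tail_symmetrised[OF assms] by simp

text \<open>Here \<open>A A\<^sup>*\<close> differs from \<open>A + A\<^sup>*\<close> by the rank one operator \<open>f \<mapsto> (\<integral> f dM) / c\<close>.\<close>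

theorem alpha_Gram:
  assumes "f \<in> L2 M" "g \<in> L2 M"
  shows "(LINT s|M. alpha f s * alpha g s) = (LINT s|M. f s * g s) - (LINT s|M. f s) * (LINT s|M. g s) / c"
  unfolding alpha_def diff_Gram[OF assms average_L2 average_L2, OF assms]
  using average_Gram[OF assms] tail_symmetrised[OF assms] tail_adjoint[OF assms] tail_adjoint[OF assms(2,1)]
  by simp

end

section \<open>Volterra processes are Gaussian\<close>

text \<open>Combinations of the values of \<open>a\<close> become combinations of its increments over the grid \<open>t\<close>, with coefficients
  that do not depend on \<open>a\<close>. Below, \<open>a\<close> is a Brownian path, or the function \<open>x \<mapsto> 1\<^bsub>[0,x)\<^esub>(s)\<close> for fixed \<open>s\<close>.\<close>

lemma Abel_summation_increments:
  fixes c :: "real \<Rightarrow> real" and t :: "nat \<Rightarrow> real" and a :: "real \<Rightarrow> real"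
  assumes t: "inj_on t {..n}" "t ` {..n} = insert 0 J" "t 0 = 0" and J: "finite J" "0 \<notin> J" and a0: "a 0 = 0"
  shows "(\<Sum>x\<in>J. c x * a x) = (\<Sum>j<n. (\<Sum>k=Suc j..n. c (t k)) * (a (t (Suc j)) - a (t j)))"
proof -
  have "(\<Sum>x\<in>J. c x * a x) = (\<Sum>x\<in>insert 0 J. c x * a x)" using J a0 by simp
  also have "\<dots> = (\<Sum>k\<le>n. c (t k) * a (t k))"
    unfolding t(2)[symmetric] by (rule sum.reindex_cong[OF t(1)]) auto
  also have "\<dots> = (\<Sum>k\<le>n. \<Sum>j<k. c (t k) * (a (t (Suc j)) - a (t j)))"
    by (simp add: sum_distrib_left[symmetric] sum_lessThan_telescope[of "\<lambda>j. a (t j)"] t(3) a0)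
  also have "\<dots> = (\<Sum>j<n. \<Sum>k=Suc j..n. c (t k) * (a (t (Suc j)) - a (t j)))"
    by (rule sum.nested_swap')
  finally show ?thesis by (simp add: sum_distrib_right)
qed

lemma brownian_L2:
  assumes P: "prob_space P" and W: "brownian_motion P T W" and t: "0 < t" "t \<le> T"
  shows "W t \<in> L2 P"
proof -
  interpret prob_space P by fact
  have m: "W t \<in> borel_measurable P" "W 0 \<in> borel_measurable P"
    using W t by (auto simp: brownian_motion_def)
  have D: "distributed P lborel (\<lambda>\<omega>. W t \<omega> - W 0 \<omega>) (normal_density 0 (sqrt t))"
    using W t unfolding brownian_motion_def by force
  have "integrable lborel (\<lambda>x. normal_density 0 (sqrt t) x * x\<^sup>2)"
    using integrable_normal_moment[of "sqrt t" 0 2] t by simp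
  then have "integrable P (\<lambda>\<omega>. (W t \<omega> - W 0 \<omega>)\<^sup>2)"
    by (subst (asm) distributed_integrable[OF D]) auto
  moreover have "AE \<omega> in P. W 0 \<omega> = 0" using W by (simp add: brownian_motion_def)
  ultimately have "integrable P (\<lambda>\<omega>. (W t \<omega>)\<^sup>2)"
    by (rule_tac Bochner_Integration.integrable_cong_AE_imp[of P "\<lambda>\<omega>. (W t \<omega> - W 0 \<omega>)\<^sup>2"]) (use m in auto)
  then show ?thesis using m by (auto intro: L2_I)
qed

text \<open>On the grid formed by \<open>0\<close> and \<open>J\<close>, the random variable is a combination \<open>\<Sum> d\<^sub>j \<Delta>W\<^sub>j\<close> of independent
  increments, and the step function is the combination of the indicators of the disjoint grid intervals with the same
  coefficients. Both the variance and the squared norm are therefore \<open>\<Sum> d\<^sub>j\<^sup>2 (t\<^sub>j\<^sub>+\<^sub>1 - t\<^sub>j)\<close>.\<close>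

lemma brownian_step_integral_gaussian:
  assumes P: "prob_space P" and W: "brownian_motion P T W" and J: "finite J" "J \<subseteq> {0<..T}"
  shows "gaussian_char P ((L2_norm (lebesgue_on {0..T}) (\<lambda>s. \<Sum>t\<in>J. c t * indicator {0..<t} s))\<^sup>2)
     (\<lambda>\<omega>. \<Sum>t\<in>J. c t * W t \<omega>)"
proof (cases "J = {}")
  case True
  interpret prob_space P by fact
  show ?thesis using True by (simp add: gaussian_char_def L2_norm_def prob_space)
next
  case False
  interpret prob_space P by fact
  have T0: "0 \<le> T" using False J by force
  define ts where "ts = sorted_list_of_set (insert 0 J)"
  define n where "n = card J"
  have J0: "0 \<notin> J" using J by auto
  have set_ts: "set ts = insert 0 J" unfolding ts_def by (rule set_sorted_list_of_set) (use J in simp)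
  have sorted: "sorted ts" unfolding ts_def by (rule sorted_sorted_list_of_set)
  have dist: "distinct ts" unfolding ts_def by (rule distinct_sorted_list_of_set)
  have len: "length ts = Suc n"
    using distinct_card[OF dist] J J0 unfolding set_ts n_def by simp
  define t where "t k = ts ! k" for k
  have tmono: "t i < t j" if "i < j" "j \<le> n" for i j
    using sorted dist len that unfolding t_def
    by (metis le_imp_less_Suc less_trans nth_eq_iff_index_eq order_less_le sorted_nth_mono less_imp_le)
  have inj: "inj_on t {..n}"
    by (rule inj_onI) (metis atMost_iff less_irrefl linorder_neqE_nat tmono)
  have img: "t ` {..n} = insert 0 J"
    unfolding set_ts[symmetric] t_def set_conv_nth len by (auto simp: less_Suc_eq_le image_def)
  have tge: "0 \<le> t k" "t k \<le> T" if "k \<le> n" for k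
  proof -
    have "t k \<in> insert 0 J" using img that by auto
    then show "0 \<le> t k" "t k \<le> T" using J T0 by auto
  qed
  have t0: "t 0 = 0"
  proof -
    obtain k where k: "k \<le> n" "t k = 0" using img by (metis atMost_iff imageE insertI1)
    then show ?thesis using tmono[of 0 k] tge[of 0] by (cases "k = 0") auto
  qed
  define d where "d j = (\<Sum>k=Suc j..n. c (t k))" for j
  define \<Delta> where "\<Delta> j \<omega> = W (t (Suc j)) \<omega> - W (t j) \<omega>" for j \<omega>
  have Wm [measurable]: "W (t k) \<in> borel_measurable P" if "k \<le> n" for k
    using W tge[OF that] by (simp add: brownian_motion_def)
  have \<Delta>m: "\<Delta> j \<in> borel_measurable P" if "j < n" for j
    unfolding \<Delta>_def using that by (intro borel_measurable_diff Wm) auto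
  have indep: "indep_vars (\<lambda>_. borel) \<Delta> {..<n}"
  proof -
    have "0 \<le> t 0 \<and> (\<forall>i<n. t i \<le> t (Suc i)) \<and> t n \<le> T"
      using tge tmono by (auto intro: less_imp_le)
    then show ?thesis using W unfolding brownian_motion_def \<Delta>_def by blast
  qed
  have indep': "indep_vars (\<lambda>_. borel) (\<lambda>j \<omega>. d j * \<Delta> j \<omega>) {..<n}"
    by (rule indep_vars_compose2[OF indep]) simp
  have char1: "char (distr P borel (\<lambda>\<omega>. d j * \<Delta> j \<omega>)) u =
      complex_of_real (exp (- (u\<^sup>2 * ((d j)\<^sup>2 * (t (Suc j) - t j)) / 2)))" if j: "j < n" for u j
  proof -
    have lt: "t j < t (Suc j)" using tmono[of j "Suc j"] j by simp
    have D: "distributed P lborel (\<Delta> j) (normal_density 0 (sqrt (t (Suc j) - t j)))"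
      using W lt tge[of j] tge[of "Suc j"] j unfolding brownian_motion_def \<Delta>_def by simp
    have "gaussian_char P (t (Suc j) - t j) (\<Delta> j)"
      using gaussian_char_normal[OF P D] lt by simp
    then have A: "(CLINT \<omega>|P. iexp ((u * d j) * \<Delta> j \<omega>)) =
        complex_of_real (exp (- ((u * d j)\<^sup>2 * (t (Suc j) - t j) / 2)))"
      unfolding gaussian_char_def by blast
    have "char (distr P borel (\<lambda>\<omega>. d j * \<Delta> j \<omega>)) u = (CLINT \<omega>|P. iexp (u * (d j * \<Delta> j \<omega>)))"
      by (rule char_distr) (use \<Delta>m[OF j] in simp)
    also have "\<dots> = (CLINT \<omega>|P. iexp ((u * d j) * \<Delta> j \<omega>))" by (simp only: mult.assoc)
    finally show ?thesis unfolding A by (simp only: power_mult_distrib mult.assoc)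
  qed
  define q where "q = (\<Sum>j<n. (d j)\<^sup>2 * (t (Suc j) - t j))"
  have Sm: "(\<lambda>\<omega>. \<Sum>j<n. d j * \<Delta> j \<omega>) \<in> borel_measurable P"
    using \<Delta>m by (intro borel_measurable_sum borel_measurable_times) auto
  have "(CLINT \<omega>|P. iexp (u * (\<Sum>j<n. d j * \<Delta> j \<omega>))) = complex_of_real (exp (- (u\<^sup>2 * q / 2)))" for u
  proof -
    have "(CLINT \<omega>|P. iexp (u * (\<Sum>j<n. d j * \<Delta> j \<omega>))) = char (distr P borel (\<lambda>\<omega>. \<Sum>j<n. d j * \<Delta> j \<omega>)) u"
      by (rule char_distr[OF Sm, symmetric])
    also have "\<dots> = (\<Prod>j<n. char (distr P borel (\<lambda>\<omega>. d j * \<Delta> j \<omega>)) u)"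
      by (rule char_distr_sum[OF indep'])
    also have "\<dots> = (\<Prod>j<n. complex_of_real (exp (- (u\<^sup>2 * ((d j)\<^sup>2 * (t (Suc j) - t j)) / 2))))"
      by (rule prod.cong[OF refl]) (simp only: char1 lessThan_iff)
    also have "\<dots> = complex_of_real (exp (\<Sum>j<n. - (u\<^sup>2 * ((d j)\<^sup>2 * (t (Suc j) - t j)) / 2)))"
      by (simp only: of_real_prod[symmetric] exp_sum finite_lessThan)
    also have "(\<Sum>j<n. - (u\<^sup>2 * ((d j)\<^sup>2 * (t (Suc j) - t j)) / 2)) = - (u\<^sup>2 * q / 2)"
      by (simp only: q_def sum_negf sum_divide_distrib sum_distrib_left)
    finally show ?thesis .
  qed
  then have G: "gaussian_char P q (\<lambda>\<omega>. \<Sum>j<n. d j * \<Delta> j \<omega>)" using Sm by (simp add: gaussian_char_def)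
  have W0: "AE \<omega> in P. W 0 \<omega> = 0" using W by (simp add: brownian_motion_def)
  have combo: "gaussian_char P q (\<lambda>\<omega>. \<Sum>x\<in>J. c x * W x \<omega>)"
  proof (rule gaussian_char_cong_AE[OF G])
    show "(\<lambda>\<omega>. \<Sum>x\<in>J. c x * W x \<omega>) \<in> borel_measurable P"
      using W J by (intro borel_measurable_sum borel_measurable_times) (auto simp: brownian_motion_def)
    show "AE \<omega> in P. (\<Sum>j<n. d j * \<Delta> j \<omega>) = (\<Sum>x\<in>J. c x * W x \<omega>)"
      using W0
    proof eventually_elim
      case (elim \<omega>)
      show ?case
        using Abel_summation_increments[OF inj img t0 J(1) J0, of "\<lambda>x. W x \<omega>" c] elim
        by (simp add: d_def \<Delta>_def)
    qed
  qed
  define \<delta> where "\<delta> j s = (indicator {0..<t (Suc j)} s - indicator {0..<t j} s :: real)" for j s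
  have \<delta>: "\<delta> j = indicator {t j..<t (Suc j)}" if "j < n" for j
    using tge[of j] tmono[of j "Suc j"] that by (auto simp: \<delta>_def indicator_def fun_eq_iff)
  have disj: "\<delta> i s * \<delta> j s = (if i = j then \<delta> i s else 0)" if ij: "i < n" "j < n" for i j s
  proof -
    have le: "t (Suc i) \<le> t j" if "i < j" "j < n" for i j
      using tmono[of "Suc i" j] that by (cases "Suc i = j") auto
    consider "i = j" | "i < j" | "j < i" by linarith
    then show ?thesis
    proof cases
      case 1 then show ?thesis using ij by (auto simp: \<delta> indicator_def)
    next
      case 2 then show ?thesis using ij le[of i j] by (auto simp: \<delta> indicator_def)
    next
      case 3 then show ?thesis using ij le[of j i] by (auto simp: \<delta> indicator_def)
    qed
  qed
  have sq: "(\<Sum>x\<in>J. c x * indicator {0..<x} s)\<^sup>2 = (\<Sum>j<n. (d j)\<^sup>2 * \<delta> j s)" for s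
  proof -
    have "(\<Sum>x\<in>J. c x * indicator {0..<x} s) = (\<Sum>j<n. d j * \<delta> j s)"
      using Abel_summation_increments[OF inj img t0 J(1) J0, of "\<lambda>x. indicator {0..<x} s" c]
      by (simp add: d_def \<delta>_def)
    then have "(\<Sum>x\<in>J. c x * indicator {0..<x} s)\<^sup>2 = (\<Sum>i<n. \<Sum>j<n. (d i * d j) * (\<delta> i s * \<delta> j s))"
      by (simp only: power2_eq_square sum_product mult_ac)
    also have "\<dots> = (\<Sum>i<n. \<Sum>j<n. if i = j then (d i)\<^sup>2 * \<delta> i s else 0)"
      by (intro sum.cong refl) (auto simp: disj power2_eq_square)
    also have "\<dots> = (\<Sum>i<n. (d i)\<^sup>2 * \<delta> i s)" by (simp add: sum.delta)
    finally show ?thesis .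
  qed
  have \<delta>int: "integrable (lebesgue_on {0..T}) (\<delta> j)" "(LINT s|lebesgue_on {0..T}. \<delta> j s) = t (Suc j) - t j" if "j < n" for j
  proof -
    have sub: "{t j..<t (Suc j)} \<subseteq> {0..T}" using tge[of j] tge[of "Suc j"] that by auto
    have S: "{t j..<t (Suc j)} \<in> sets (lebesgue_on {0..T})"
      using sub by (auto simp: sets_restrict_space_iff)
    have e: "emeasure (lebesgue_on {0..T}) {t j..<t (Suc j)} = ennreal (t (Suc j) - t j)"
      using sub tmono[of j "Suc j"] that by (subst emeasure_restrict_space) auto
    show "integrable (lebesgue_on {0..T}) (\<delta> j)"
      unfolding \<delta>[OF that] using S e by (intro integrable_real_indicator) auto
    show "(LINT s|lebesgue_on {0..T}. \<delta> j s) = t (Suc j) - t j"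
      unfolding \<delta>[OF that] using S e tmono[of j "Suc j"] that by (simp add: measure_def Int_absorb2[OF sub])
  qed
  have "(L2_norm (lebesgue_on {0..T}) (\<lambda>s. \<Sum>x\<in>J. c x * indicator {0..<x} s))\<^sup>2 =
      (LINT s|lebesgue_on {0..T}. (\<Sum>j<n. (d j)\<^sup>2 * \<delta> j s))"
    unfolding L2_norm_power2 sq ..
  also have "\<dots> = q"
    using \<delta>int by (simp add: q_def)
  finally show ?thesis using combo by simp
qed

lemma indicator_L2: "(\<lambda>s. indicator {0..<t} s) \<in> L2 (lebesgue_on {0..T::real})"
proof (rule L2_I)
  show m: "(\<lambda>s. indicator {0..<t} s :: real) \<in> borel_measurable (lebesgue_on {0..T})"
    by (intro measurable_restrict_space1 borel_measurable_indicator) auto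
  have fin: "finite_measure (lebesgue_on {0..T})"
    by (rule finite_measureI) (simp add: emeasure_restrict_space emeasure_lborel_Icc_eq)
  interpret finite_measure "lebesgue_on {0..T}" by fact
  show "integrable (lebesgue_on {0..T}) (\<lambda>s. (indicator {0..<t} s :: real)\<^sup>2)"
    by (rule integrable_const_bound[of _ 1]) (use m in \<open>auto simp: indicator_def\<close>)
qed

lemma wiener_integral_BM_iff:
  "is_wiener_integral_BM P T W f Y \<longleftrightarrow> f \<in> L2 (lebesgue_on {0..T}) \<and> Y \<in> L2 P \<and>
     (\<forall>e>0. \<exists>J c. finite J \<and> J \<subseteq> {0<..T} \<and>
        L2_norm (lebesgue_on {0..T}) (\<lambda>s. f s - (\<Sum>t\<in>J. c t * indicator {0..<t} s)) < e \<and>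
        L2_norm P (\<lambda>\<omega>. Y \<omega> - (\<Sum>t\<in>J. c t * W t \<omega>)) < e)"
proof -
  define Q where "Q e \<longleftrightarrow> (\<exists>J c. finite J \<and> J \<subseteq> {0<..T} \<and>
        (LINT s|lebesgue_on {0..T}. (f s - (\<Sum>t\<in>J. c t * indicator {0..<t} s))\<^sup>2) < e \<and>
        (LINT \<omega>|P. (Y \<omega> - (\<Sum>t\<in>J. c t * W t \<omega>))\<^sup>2) < e)" for e
  have "Q (e\<^sup>2) \<longleftrightarrow> (\<exists>J c. finite J \<and> J \<subseteq> {0<..T} \<and>
        L2_norm (lebesgue_on {0..T}) (\<lambda>s. f s - (\<Sum>t\<in>J. c t * indicator {0..<t} s)) < e \<and>
        L2_norm P (\<lambda>\<omega>. Y \<omega> - (\<Sum>t\<in>J. c t * W t \<omega>)) < e)" if "e > 0" for e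
    unfolding Q_def L2_norm_less_iff[OF that] ..
  then show ?thesis unfolding is_wiener_integral_BM_def Q_def[symmetric] all_pos_square_iff[of Q, symmetric] by simp
qed

lemma wiener_integral_BM_lincomb:
  assumes P: "prob_space P" and W: "brownian_motion P T W"
    and f: "is_wiener_integral_BM P T W f Y" and g: "is_wiener_integral_BM P T W g Z"
  shows "is_wiener_integral_BM P T W (\<lambda>s. a * f s + b * g s) (\<lambda>\<omega>. a * Y \<omega> + b * Z \<omega>)"
  unfolding wiener_integral_BM_iff
proof (intro conjI allI impI)
  have L: "f \<in> L2 (lebesgue_on {0..T})" "g \<in> L2 (lebesgue_on {0..T})" "Y \<in> L2 P" "Z \<in> L2 P"
    using f g by (auto simp: wiener_integral_BM_iff)
  then show "(\<lambda>s. a * f s + b * g s) \<in> L2 (lebesgue_on {0..T})" "(\<lambda>\<omega>. a * Y \<omega> + b * Z \<omega>) \<in> L2 P"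
    by (auto intro: L2_lincomb)
  fix e :: real assume e: "e > 0"
  from small_radius_exists[OF e] obtain r where r: "r > 0" and re: "\<bar>a\<bar> * r + \<bar>b\<bar> * r < e" .
  from f r obtain J c where J: "finite J" "J \<subseteq> {0<..T}"
      "L2_norm (lebesgue_on {0..T}) (\<lambda>s. f s - (\<Sum>t\<in>J. c t * indicator {0..<t} s)) < r"
      "L2_norm P (\<lambda>\<omega>. Y \<omega> - (\<Sum>t\<in>J. c t * W t \<omega>)) < r"
    unfolding wiener_integral_BM_iff by blast
  from g r obtain J' c' where J': "finite J'" "J' \<subseteq> {0<..T}"
      "L2_norm (lebesgue_on {0..T}) (\<lambda>s. g s - (\<Sum>t\<in>J'. c' t * indicator {0..<t} s)) < r"
      "L2_norm P (\<lambda>\<omega>. Z \<omega> - (\<Sum>t\<in>J'. c' t * W t \<omega>)) < r"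
    unfolding wiener_integral_BM_iff by blast
  let ?c = "\<lambda>t. a * (if t \<in> J then c t else 0) + b * (if t \<in> J' then c' t else 0)"
  have u: "(\<Sum>t\<in>J \<union> J'. ?c t * h t) = a * (\<Sum>t\<in>J. c t * h t) + b * (\<Sum>t\<in>J'. c' t * h t)" for h :: "real \<Rightarrow> real"
    by (rule lincomb_union_real[OF J(1) J'(1)])
  have bound: "L2_norm \<mu> (\<lambda>x. (a * p x + b * p' x) - (\<Sum>t\<in>J \<union> J'. ?c t * v t x)) < e"
    if "p \<in> L2 \<mu>" "p' \<in> L2 \<mu>" and v: "\<And>t. t \<in> {0<..T} \<Longrightarrow> v t \<in> L2 \<mu>"
      and "L2_norm \<mu> (\<lambda>x. p x - (\<Sum>t\<in>J. c t * v t x)) < r" "L2_norm \<mu> (\<lambda>x. p' x - (\<Sum>t\<in>J'. c' t * v t x)) < r"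
    for p p' :: "'c \<Rightarrow> real" and v \<mu>
  proof -
    have "(\<lambda>x. \<Sum>t\<in>J. c t * v t x) \<in> L2 \<mu>" "(\<lambda>x. \<Sum>t\<in>J'. c' t * v t x) \<in> L2 \<mu>"
      using v J(2) J'(2) by (auto intro!: L2_sum)
    then show ?thesis unfolding u by (intro L2_norm_lincomb_diff_less[OF that(1) _ that(2) _ that(4,5) re])
  qed
  show "\<exists>J c. finite J \<and> J \<subseteq> {0<..T} \<and>
        L2_norm (lebesgue_on {0..T}) (\<lambda>s. (a * f s + b * g s) - (\<Sum>t\<in>J. c t * indicator {0..<t} s)) < e \<and>
        L2_norm P (\<lambda>\<omega>. (a * Y \<omega> + b * Z \<omega>) - (\<Sum>t\<in>J. c t * W t \<omega>)) < e"
  proof (rule exI[of _ "J \<union> J'"], rule exI[of _ ?c], intro conjI)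
    show "finite (J \<union> J')" "J \<union> J' \<subseteq> {0<..T}" using J J' by auto
    show "L2_norm (lebesgue_on {0..T}) (\<lambda>s. (a * f s + b * g s) - (\<Sum>t\<in>J \<union> J'. ?c t * indicator {0..<t} s)) < e"
      by (rule bound[OF L(1,2) indicator_L2 J(3) J'(3)])
    show "L2_norm P (\<lambda>\<omega>. (a * Y \<omega> + b * Z \<omega>) - (\<Sum>t\<in>J \<union> J'. ?c t * W t \<omega>)) < e"
      by (rule bound[OF L(3,4) brownian_L2[OF P W] J(4) J'(4)]) auto
  qed
qed

lemma wiener_integral_BM_gaussian:
  assumes P: "prob_space P" and W: "brownian_motion P T W" and f: "is_wiener_integral_BM P T W f Y"
  shows "gaussian_char P ((L2_norm (lebesgue_on {0..T}) f)\<^sup>2) Y"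
proof (rule gaussian_char_L2_limit[OF P])
  show "Y \<in> L2 P" using f by (simp add: wiener_integral_BM_iff)
  have fL: "f \<in> L2 (lebesgue_on {0..T})" using f by (simp add: wiener_integral_BM_iff)
  fix e :: real assume "e > 0"
  with f obtain J c where J: "finite J" "J \<subseteq> {0<..T}"
      "L2_norm (lebesgue_on {0..T}) (\<lambda>s. f s - (\<Sum>t\<in>J. c t * indicator {0..<t} s)) < e"
      "L2_norm P (\<lambda>\<omega>. Y \<omega> - (\<Sum>t\<in>J. c t * W t \<omega>)) < e"
    unfolding wiener_integral_BM_iff by blast
  let ?g = "\<lambda>s. \<Sum>t\<in>J. c t * indicator {0..<t} s"
  have gL: "?g \<in> L2 (lebesgue_on {0..T})" by (intro L2_sum indicator_L2)
  have "\<bar>L2_norm (lebesgue_on {0..T}) ?g - L2_norm (lebesgue_on {0..T}) f\<bar> < e"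
    using L2_norm_diff_abs[OF gL fL] J(3) L2_norm_minus_commute[of "lebesgue_on {0..T}" f ?g] by linarith
  moreover have "(\<lambda>\<omega>. \<Sum>t\<in>J. c t * W t \<omega>) \<in> L2 P"
    using J(2) by (intro L2_sum brownian_L2[OF P W]) auto
  ultimately show "\<exists>V m. V \<in> L2 P \<and> gaussian_char P (m\<^sup>2) V \<and> L2_norm P (\<lambda>\<omega>. Y \<omega> - V \<omega>) < e \<and>
      \<bar>m - L2_norm (lebesgue_on {0..T}) f\<bar> < e"
    using brownian_step_integral_gaussian[OF P W J(1,2), of c] J(4)
    by (intro exI[of _ "\<lambda>\<omega>. \<Sum>t\<in>J. c t * W t \<omega>"] exI[of _ "L2_norm (lebesgue_on {0..T}) ?g"]) simp
qed

lemma volterra_sum: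
  assumes P: "prob_space P" and W: "brownian_motion P T W" and X: "volterra_gaussian P T W z X"
    and J: "finite J" "J \<subseteq> {0..T}"
  shows "is_wiener_integral_BM P T W (\<lambda>s. \<Sum>t\<in>J. c t * z t s) (\<lambda>\<omega>. \<Sum>t\<in>J. c t * X t \<omega>)"
  using J
proof (induction J)
  case empty
  show ?case unfolding wiener_integral_BM_iff
    by (auto simp: L2_zero L2_norm_def intro!: exI[of _ "{}"])
next
  case (insert r J)
  have "is_wiener_integral_BM P T W (z r) (X r)" using X insert.prems by (simp add: volterra_gaussian_def)
  from wiener_integral_BM_lincomb[OF P W this insert.IH, of "c r" 1]
  show ?case using insert by simp
qed

lemma volterra_L2:
  assumes "volterra_gaussian P T W z X" "t \<in> {0..T}"
  shows "X t \<in> L2 P" "z t \<in> L2 (lebesgue_on {0..T})"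
  using assms by (auto simp: volterra_gaussian_def wiener_integral_BM_iff)

text \<open>The isometry between combinations of \<open>X\<^sub>t\<close> and of \<open>z\<^sub>t\<close> is read off from the variance in the characteristic
  function.\<close>

lemma volterra_gaussian_char:
  assumes P: "prob_space P" and W: "brownian_motion P T W" and X: "volterra_gaussian P T W z X"
    and J: "finite J" "J \<subseteq> {0..T}"
  shows "gaussian_char P ((L2_norm P (\<lambda>\<omega>. \<Sum>t\<in>J. c t * X t \<omega>))\<^sup>2) (\<lambda>\<omega>. \<Sum>t\<in>J. c t * X t \<omega>)"
    and "L2_norm P (\<lambda>\<omega>. \<Sum>t\<in>J. c t * X t \<omega>) = L2_norm (lebesgue_on {0..T}) (\<lambda>s. \<Sum>t\<in>J. c t * z t s)"
proof -
  note g = wiener_integral_BM_gaussian[OF P W volterra_sum[OF P W X J]]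
  from gaussian_char_imp_gaussian(3)[OF P g, of c]
  have "(L2_norm P (\<lambda>\<omega>. \<Sum>t\<in>J. c t * X t \<omega>))\<^sup>2 = (L2_norm (lebesgue_on {0..T}) (\<lambda>s. \<Sum>t\<in>J. c t * z t s))\<^sup>2"
    by (simp add: L2_norm_power2)
  then show "L2_norm P (\<lambda>\<omega>. \<Sum>t\<in>J. c t * X t \<omega>) = L2_norm (lebesgue_on {0..T}) (\<lambda>s. \<Sum>t\<in>J. c t * z t s)"
    by simp
  then show "gaussian_char P ((L2_norm P (\<lambda>\<omega>. \<Sum>t\<in>J. c t * X t \<omega>))\<^sup>2) (\<lambda>\<omega>. \<Sum>t\<in>J. c t * X t \<omega>)"
    using g[of c] by simp
qed

lemma volterra_covariance:
  assumes P: "prob_space P" and W: "brownian_motion P T W" and X: "volterra_gaussian P T W z X"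
    and st: "s \<in> {0..T}" "t \<in> {0..T}"
  shows "(LINT \<omega>|P. X t \<omega>) = 0"
    and "(LINT \<omega>|P. X s \<omega> * X t \<omega>) = (LINT u|lebesgue_on {0..T}. z s u * z t u)"
    and "cov P X s t = (LINT u|lebesgue_on {0..T}. z s u * z t u)"
proof -
  have wi: "is_wiener_integral_BM P T W (z r) (X r)" if "r \<in> {0..T}" for r
    using X that by (simp add: volterra_gaussian_def)
  have sq: "(L2_norm P Y)\<^sup>2 = (L2_norm (lebesgue_on {0..T}) f)\<^sup>2" if "is_wiener_integral_BM P T W f Y" for f Y
    using gaussian_char_imp_gaussian(3)[OF P wiener_integral_BM_gaussian[OF P W that]]
    by (simp add: L2_norm_power2)
  have mean: "(LINT \<omega>|P. X r \<omega>) = 0" if "r \<in> {0..T}" for r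
    using gaussian_char_imp_gaussian(2)[OF P wiener_integral_BM_gaussian[OF P W wi[OF that]]] .
  then show "(LINT \<omega>|P. X t \<omega>) = 0" using st by simp
  have "(L2_norm P (\<lambda>\<omega>. 1 * X s \<omega> + 1 * X t \<omega>))\<^sup>2 = (L2_norm (lebesgue_on {0..T}) (\<lambda>u. 1 * z s u + 1 * z t u))\<^sup>2"
    by (rule sq[OF wiener_integral_BM_lincomb[OF P W wi wi, OF st]])
  then show eq: "(LINT \<omega>|P. X s \<omega> * X t \<omega>) = (LINT u|lebesgue_on {0..T}. z s u * z t u)"
    using L2_norm_lincomb_power2[OF volterra_L2(1)[OF X st(1)] volterra_L2(1)[OF X st(2)], of 1 1]
      L2_norm_lincomb_power2[OF volterra_L2(2)[OF X st(1)] volterra_L2(2)[OF X st(2)], of 1 1]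
      sq[OF wi[OF st(1)]] sq[OF wi[OF st(2)]] by simp
  show "cov P X s t = (LINT u|lebesgue_on {0..T}. z s u * z t u)"
    unfolding cov_def using mean st eq by simp
qed

lemma closed_span_gaussian:
  assumes P: "prob_space P" and X: "\<And>t. t \<in> I \<Longrightarrow> X t \<in> L2 P"
    and g: "\<And>J c. finite J \<Longrightarrow> J \<subseteq> I \<Longrightarrow>
      gaussian_char P ((L2_norm P (\<lambda>\<omega>. \<Sum>t\<in>J. c t * X t \<omega>))\<^sup>2) (\<lambda>\<omega>. \<Sum>t\<in>J. c t * X t \<omega>)"
    and Y: "Y \<in> L2_closed_span P I X"
  shows "gaussian_char P ((L2_norm P Y)\<^sup>2) Y"
proof (rule gaussian_char_L2_limit[OF P])
  show YL: "Y \<in> L2 P" using Y by (simp add: L2_closed_span_def)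
  fix e :: real assume e: "e > 0"
  then have "e\<^sup>2 > 0" by simp
  with Y obtain J c where J: "finite J" "J \<subseteq> I" "(LINT \<omega>|P. (Y \<omega> - (\<Sum>t\<in>J. c t * X t \<omega>))\<^sup>2) < e\<^sup>2"
    unfolding L2_closed_span_def by blast
  let ?V = "\<lambda>\<omega>. \<Sum>t\<in>J. c t * X t \<omega>"
  have V: "?V \<in> L2 P" using X J(2) by (intro L2_sum) auto
  have n: "L2_norm P (\<lambda>\<omega>. Y \<omega> - ?V \<omega>) < e" using J(3) L2_norm_less_iff[OF e] by blast
  moreover have "\<bar>L2_norm P ?V - L2_norm P Y\<bar> < e"
    using L2_norm_diff_abs[OF V YL] n L2_norm_minus_commute[of P Y ?V] by linarith
  ultimately show "\<exists>V m. V \<in> L2 P \<and> gaussian_char P (m\<^sup>2) V \<and> L2_norm P (\<lambda>\<omega>. Y \<omega> - V \<omega>) < e \<and>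
      \<bar>m - L2_norm P Y\<bar> < e"
    using V g[OF J(1,2), of c] by (intro exI[of _ ?V] exI[of _ "L2_norm P ?V"]) simp
qed

section \<open>The bracket of the prediction martingale as a clock\<close>

locale bracket_kernel =
  fixes T :: real and z :: "real \<Rightarrow> real \<Rightarrow> real"
  assumes T_pos: "0 < T" and zT: "z T \<in> L2 (lebesgue_on {0..T})"
    and zT_nz: "AE s in lebesgue_on {0..T}. z T s \<noteq> 0"
begin

abbreviation \<mu> where "\<mu> \<equiv> d_bracket T z"
abbreviation br where "br \<equiv> bracket T z"

lemma zT_measurable [measurable]: "z T \<in> borel_measurable (lebesgue_on {0..T})"
  using zT by (rule L2_D)

lemma space_d_bracket [simp]: "space \<mu> = {0..T}"
  by (simp add: d_bracket_def)

lemma sets_d_bracket [measurable_cong]: "sets \<mu> = sets (lebesgue_on {0..T})"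
  by (simp add: d_bracket_def)

lemma Icc_sets: "A \<in> sets borel \<Longrightarrow> A \<subseteq> {0..T} \<Longrightarrow> A \<in> sets \<mu>"
  unfolding sets_d_bracket by (auto simp: sets_restrict_space_iff)

lemma finite_measure_d_bracket: "finite_measure \<mu>"
proof (rule finite_measureI)
  have "emeasure \<mu> (space \<mu>) = (\<integral>\<^sup>+s. ennreal ((z T s)\<^sup>2) \<partial>lebesgue_on {0..T})"
    unfolding d_bracket_def by (subst emeasure_density) (auto intro!: nn_integral_cong)
  also have "\<dots> = ennreal (LINT s|lebesgue_on {0..T}. (z T s)\<^sup>2)"
    using zT by (intro nn_integral_eq_integral) (auto dest: L2_D)
  finally show "emeasure \<mu> (space \<mu>) \<noteq> \<infinity>" by simp
qed

sublocale finite_measure \<mu> by (rule finite_measure_d_bracket)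

lemma integral_d_bracket:
  assumes "f \<in> borel_measurable (lebesgue_on {0..T})"
  shows "(LINT s|\<mu>. f s) = (LINT s|lebesgue_on {0..T}. (z T s)\<^sup>2 * f s)"
  unfolding d_bracket_def using assms by (subst integral_density) auto

lemma AE_d_bracket: "(AE s in \<mu>. Q s) \<longleftrightarrow> (AE s in lebesgue_on {0..T}. Q s)"
proof -
  have "(AE s in \<mu>. Q s) \<longleftrightarrow> (AE s in lebesgue_on {0..T}. 0 < ennreal ((z T s)\<^sup>2) \<longrightarrow> Q s)"
    unfolding d_bracket_def by (rule AE_density) simp
  also have "\<dots> \<longleftrightarrow> (AE s in lebesgue_on {0..T}. Q s)"
  proof
    assume "AE s in lebesgue_on {0..T}. 0 < ennreal ((z T s)\<^sup>2) \<longrightarrow> Q s"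
    with zT_nz show "AE s in lebesgue_on {0..T}. Q s" by eventually_elim simp
  qed (auto elim: eventually_mono)
  finally show ?thesis .
qed

text \<open>Multiplication by \<open>z\<^sub>T\<close> maps \<open>L\<^sup>2(d\<langle>M\<rangle>)\<close> isometrically into \<open>L\<^sup>2(\<lambda>)\<close>.\<close>

lemma L2_d_bracket_iff: "f \<in> L2 \<mu> \<longleftrightarrow> f \<in> borel_measurable (lebesgue_on {0..T}) \<and> (\<lambda>s. z T s * f s) \<in> L2 (lebesgue_on {0..T})"
proof -
  have m: "f \<in> borel_measurable \<mu> \<longleftrightarrow> f \<in> borel_measurable (lebesgue_on {0..T})"
    by (rule measurable_cong_sets[THEN arg_cong[where f = "\<lambda>A. f \<in> A"]]) (auto simp: sets_d_bracket)
  show ?thesis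
  proof (cases "f \<in> borel_measurable (lebesgue_on {0..T})")
    case True
    then have [measurable]: "f \<in> borel_measurable (lebesgue_on {0..T})" .
    have "integrable \<mu> (\<lambda>s. (f s)\<^sup>2) \<longleftrightarrow> integrable (lebesgue_on {0..T}) (\<lambda>s. (z T s)\<^sup>2 *\<^sub>R (f s)\<^sup>2)"
      unfolding d_bracket_def by (rule integrable_density) auto
    then show ?thesis using True m by (simp add: L2_def power_mult_distrib)
  next
    case False
    then show ?thesis using m by (auto dest: L2_D)
  qed
qed

lemma bracket_eq_measure:
  assumes x: "0 \<le> x" "x \<le> T"
  shows "br x = measure \<mu> {0..x}"
proof -
  have S: "{0..x} \<in> sets \<mu>" using x by (intro Icc_sets) auto
  have "br x = (LINT s|lebesgue. indicator {0..x} s *\<^sub>R (z T s)\<^sup>2)"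
    unfolding bracket_def by (subst integral_restrict_space) (auto simp: set_lebesgue_integral_def)
  also have "\<dots> = (LINT s|lebesgue. indicator {0..T} s *\<^sub>R ((z T s)\<^sup>2 * indicator {0..x} s))"
    using x by (intro Bochner_Integration.integral_cong) (auto simp: indicator_def)
  also have "\<dots> = (LINT s|lebesgue_on {0..T}. (z T s)\<^sup>2 * indicator {0..x} s)"
    by (subst integral_restrict_space) (auto simp: set_lebesgue_integral_def)
  also have "\<dots> = (LINT s|\<mu>. indicator {0..x} s)"
    using S by (subst integral_d_bracket) (auto simp: sets_d_bracket)
  also have "\<dots> = measure \<mu> {0..x}" using x by (simp add: min_absorb1)
  finally show ?thesis .
qed

lemma AE_neq: "AE s in \<mu>. s \<noteq> x"
  unfolding AE_d_bracket
proof -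
  have "AE s in lebesgue. s \<noteq> x"
    by (rule AE_completion) (rule AE_lborel_singleton)
  then show "AE s in lebesgue_on {0..T}. s \<noteq> x"
    by (subst AE_restrict_space_iff) auto
qed

lemma bracket_0: "br 0 = 0"
proof -
  have "measure \<mu> {0..0} = measure \<mu> {}"
    using T_pos AE_neq[of 0] by (intro finite_measure_eq_AE Icc_sets) auto
  then show ?thesis using bracket_eq_measure[of 0] T_pos by simp
qed

lemma bracket_diff:
  assumes "0 \<le> x" "x \<le> y" "y \<le> T"
  shows "br y - br x = measure \<mu> {x<..y}"
proof -
  have "measure \<mu> ({0..x} \<union> {x<..y}) = measure \<mu> {0..x} + measure \<mu> {x<..y}"
    using assms by (intro finite_measure_Union Icc_sets) auto
  moreover have "{0..x} \<union> {x<..y} = {0..y}" using assms by auto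
  ultimately show ?thesis using assms by (simp add: bracket_eq_measure)
qed

lemma bracket_strict_mono:
  assumes "0 \<le> x" "x < y" "y \<le> T"
  shows "br x < br y"
proof -
  have S: "{x<..y} \<in> sets \<mu>" using assms by (intro Icc_sets) auto
  have "measure \<mu> {x<..y} \<noteq> 0"
  proof
    assume "measure \<mu> {x<..y} = 0"
    then have "{x<..y} \<in> null_sets \<mu>" using S by (simp add: emeasure_eq_measure null_sets_def)
    then have "AE s in lebesgue_on {0..T}. s \<notin> {x<..y}" unfolding AE_d_bracket[symmetric] by (rule AE_not_in)
    then have "{x<..y} \<in> null_sets (lebesgue_on {0..T})"
      using S unfolding sets_d_bracket by (subst AE_iff_null_sets) auto
    then have "emeasure (lebesgue_on {0..T}) {x<..y} = 0" by auto
    moreover have "emeasure (lebesgue_on {0..T}) {x<..y} = ennreal (y - x)"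
      using assms by (subst emeasure_restrict_space) auto
    ultimately show False using assms by simp
  qed
  then have "0 < measure \<mu> {x<..y}" using measure_nonneg[of \<mu> "{x<..y}"] by linarith
  then show ?thesis using bracket_diff[of x y] assms by simp
qed

lemma bracket_le_iff: "x \<in> {0..T} \<Longrightarrow> y \<in> {0..T} \<Longrightarrow> br x \<le> br y \<longleftrightarrow> x \<le> y"
  using bracket_strict_mono[of x y] bracket_strict_mono[of y x]
  by (cases "x = y") (auto simp: not_le[symmetric] intro: less_imp_le)

lemma bracket_continuous: "continuous_on {0..T} br"
proof -
  have i: "integrable (lebesgue_on {0..T}) (\<lambda>s. (z T s)\<^sup>2)" using zT by (rule L2_D)
  have "(\<lambda>s. (z T s)\<^sup>2) integrable_on {0..T}"
    using integrable_on_lebesgue_on[OF i] by simp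
  then have "continuous_on {0..T} (\<lambda>x. integral {0..x} (\<lambda>s. (z T s)\<^sup>2))"
    by (rule indefinite_integral_continuous_1)
  moreover have "integral {0..x} (\<lambda>s. (z T s)\<^sup>2) = br x" if "x \<in> {0..T}" for x
  proof -
    have "integrable (lebesgue_on {0..x}) (\<lambda>s. (z T s)\<^sup>2)"
      by (rule integrable_subinterval[OF i]) (use that in auto)
    then show ?thesis unfolding bracket_def by (subst lebesgue_integral_eq_integral) auto
  qed
  ultimately show ?thesis by (rule continuous_on_eq)
qed

lemma bracket_measurable: "br \<in> borel_measurable \<mu>"
proof -
  have "br \<in> borel_measurable (lebesgue_on {0..T})"
    by (rule continuous_imp_measurable_on_sets_lebesgue[OF bracket_continuous]) simp
  then show ?thesis by (simp add: measurable_def sets_d_bracket)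
qed

lemma bracket_surj:
  assumes "0 \<le> v" "v \<le> br T"
  obtains x where "0 \<le> x" "x \<le> T" "br x = v"
  using IVT'[of br 0 v T] assms bracket_0 bracket_continuous T_pos by auto

lemma bracket_T_pos: "0 < br T"
  using bracket_strict_mono[of 0 T] T_pos bracket_0 by simp

text \<open>By continuity every level \<open>v\<close> is attained at some \<open>x\<close>, and by strict monotonicity the sublevel set of \<open>v\<close> is
  \<open>[0,x]\<close>.\<close>

lemma forward_clock: "uniform_clock \<mu> br (br T)"
proof unfold_locales
  show "br \<in> borel_measurable \<mu>" by (rule bracket_measurable)
  show "0 < br T" by (rule bracket_T_pos)
  show "AE s in \<mu>. br s \<le> br T"
    by (rule AE_I2) (use bracket_le_iff T_pos in auto)
  fix v assume v: "0 \<le> v" "v \<le> br T"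
  then obtain x where x: "0 \<le> x" "x \<le> T" "br x = v" by (rule bracket_surj)
  have "{s \<in> space \<mu>. br s \<le> v} = {0..x}"
    using x bracket_le_iff[of _ x] by auto
  then show "measure \<mu> {s \<in> space \<mu>. br s \<le> v} = v"
    using x bracket_eq_measure[of x] by simp
qed

lemma backward_clock: "uniform_clock \<mu> (\<lambda>s. br T - br s) (br T)"
proof unfold_locales
  show "(\<lambda>s. br T - br s) \<in> borel_measurable \<mu>"
    using bracket_measurable by simp
  show "0 < br T" by (rule bracket_T_pos)
  show "AE s in \<mu>. br T - br s \<le> br T"
    by (rule AE_I2) (use bracket_le_iff[of 0] bracket_0 T_pos in auto)
  fix v assume v: "0 \<le> v" "v \<le> br T"
  then have "0 \<le> br T - v" "br T - v \<le> br T" by auto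
  then obtain x where x: "0 \<le> x" "x \<le> T" "br x = br T - v" by (rule bracket_surj)
  have "br T - br s \<le> v \<longleftrightarrow> x \<le> s" if "s \<in> {0..T}" for s
    using bracket_le_iff[of x s] x that by auto
  then have "{s \<in> space \<mu>. br T - br s \<le> v} = {x..T}"
    using x by auto
  moreover have "measure \<mu> {x..T} = measure \<mu> {x<..T}"
    using AE_neq[of x] x by (intro finite_measure_eq_AE Icc_sets) auto
  moreover have "measure \<mu> {x<..T} = v"
    using bracket_diff[of x T] x by simp
  ultimately show "measure \<mu> {s \<in> space \<mu>. br T - br s \<le> v} = v" by simp
qed

lemma LINT_indicator:
  "(LINT u:A|\<mu>. f u) = (LINT u|\<mu>. indicator A u * f u)" for f :: "real \<Rightarrow> real"
  by (simp add: set_lebesgue_integral_def)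

lemma operators_forward:
  assumes s: "s \<in> {0..T}"
  shows "alpha_M1 T z f s = uniform_clock.alpha \<mu> br f s" "beta_M1 T z f s = uniform_clock.beta \<mu> br f s"
proof -
  interpret U: uniform_clock \<mu> br "br T" by (rule forward_clock)
  have "(LINT u|\<mu>. U.tail_kernel u s * f u) = (LINT u|\<mu>. 1 / br s * (indicator {0..s} u * f u))"
    using s by (intro Bochner_Integration.integral_cong) (auto simp: U.tail_kernel_def bracket_le_iff indicator_def)
  then show "alpha_M1 T z f s = U.alpha f s"
    by (simp add: alpha_M1_def U.alpha_def LINT_indicator)
  have "(LINT u|\<mu>. U.tail_kernel s u * f u) = (LINT u|\<mu>. indicator {s..T} u * (f u / br u))"
    using s by (intro Bochner_Integration.integral_cong) (auto simp: U.tail_kernel_def bracket_le_iff indicator_def)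
  then show "beta_M1 T z f s = U.beta f s"
    by (simp add: beta_M1_def U.beta_def LINT_indicator)
qed

lemma operators_backward:
  assumes s: "s \<in> {0..T}"
  shows "alpha_M2 T z f s = uniform_clock.alpha \<mu> (\<lambda>s. br T - br s) f s"
    "beta_M2 T z f s = uniform_clock.beta \<mu> (\<lambda>s. br T - br s) f s"
proof -
  interpret U: uniform_clock \<mu> "\<lambda>s. br T - br s" "br T" by (rule backward_clock)
  have "(LINT u|\<mu>. U.tail_kernel u s * f u) = (LINT u|\<mu>. 1 / (br T - br s) * (indicator {s..T} u * f u))"
    using s by (intro Bochner_Integration.integral_cong) (auto simp: U.tail_kernel_def bracket_le_iff indicator_def)
  then show "alpha_M2 T z f s = U.alpha f s"
    by (simp add: alpha_M2_def U.alpha_def LINT_indicator)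
  have "(LINT u|\<mu>. U.tail_kernel s u * f u) = (LINT u|\<mu>. indicator {0..s} u * (f u / (br T - br u)))"
    using s by (intro Bochner_Integration.integral_cong) (auto simp: U.tail_kernel_def bracket_le_iff indicator_def)
  then show "beta_M2 T z f s = U.beta f s"
    by (simp add: beta_M2_def U.beta_def LINT_indicator)
qed

lemma L2_cong_space:
  assumes "\<And>s. s \<in> {0..T} \<Longrightarrow> f s = g s"
  shows "f \<in> L2 \<mu> \<longleftrightarrow> g \<in> L2 \<mu>"
proof -
  have "f \<in> borel_measurable \<mu> \<longleftrightarrow> g \<in> borel_measurable \<mu>"
    by (rule measurable_cong) (simp add: assms)
  moreover have "integrable \<mu> (\<lambda>x. (f x)\<^sup>2) \<longleftrightarrow> integrable \<mu> (\<lambda>x. (g x)\<^sup>2)"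
    by (rule Bochner_Integration.integrable_cong) (simp_all add: assms)
  ultimately show ?thesis by (simp add: L2_def)
qed

lemma operators_are_clock_operators:
  assumes i: "i \<in> {1, 2::nat}"
  obtains F where "uniform_clock \<mu> F (br T)"
    "\<And>f s. s \<in> {0..T} \<Longrightarrow> alpha_M i T z f s = uniform_clock.alpha \<mu> F f s"
    "\<And>f s. s \<in> {0..T} \<Longrightarrow> beta_M i T z f s = uniform_clock.beta \<mu> F f s"
proof (cases "i = 1")
  case True
  show ?thesis
    by (rule that[OF forward_clock]) (simp_all add: True alpha_M_def beta_M_def operators_forward)
next
  case False
  then have "alpha_M i = alpha_M2" "beta_M i = beta_M2" by (simp_all add: alpha_M_def beta_M_def)
  then show ?thesis
    by (intro that[OF backward_clock]) (simp_all add: operators_backward)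
qed

theorem operators_isometry:
  assumes i: "i \<in> {1, 2::nat}" and f: "f \<in> L2 \<mu>"
  shows "beta_M i T z f \<in> L2 \<mu>" "alpha_M i T z f \<in> L2 \<mu>"
    and "g \<in> L2 \<mu> \<Longrightarrow> (LINT s|\<mu>. beta_M i T z f s * beta_M i T z g s) = (LINT s|\<mu>. f s * g s)"
    and "g \<in> L2 \<mu> \<Longrightarrow> (LINT s|\<mu>. alpha_M i T z f s * alpha_M i T z g s) =
      (LINT s|\<mu>. f s * g s) - (LINT s|\<mu>. f s) * (LINT s|\<mu>. g s) / br T"
proof -
  obtain F where F: "uniform_clock \<mu> F (br T)"
    "\<And>f s. s \<in> {0..T} \<Longrightarrow> alpha_M i T z f s = uniform_clock.alpha \<mu> F f s"
    "\<And>f s. s \<in> {0..T} \<Longrightarrow> beta_M i T z f s = uniform_clock.beta \<mu> F f s"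
    using operators_are_clock_operators[OF i] by metis
  interpret U: uniform_clock \<mu> F "br T" by (rule F(1))
  show "beta_M i T z f \<in> L2 \<mu>" using L2_cong_space[of "beta_M i T z f" "U.beta f"] F(3) U.beta_L2[OF f] by blast
  show "alpha_M i T z f \<in> L2 \<mu>" using L2_cong_space[of "alpha_M i T z f" "U.alpha f"] F(2) U.alpha_L2[OF f] by blast
  assume g: "g \<in> L2 \<mu>"
  have "(LINT s|\<mu>. beta_M i T z f s * beta_M i T z g s) = (LINT s|\<mu>. U.beta f s * U.beta g s)"
    by (rule Bochner_Integration.integral_cong) (simp_all add: F(3))
  then show "(LINT s|\<mu>. beta_M i T z f s * beta_M i T z g s) = (LINT s|\<mu>. f s * g s)"
    by (simp add: U.beta_isometry[OF f g])
  have "(LINT s|\<mu>. alpha_M i T z f s * alpha_M i T z g s) = (LINT s|\<mu>. U.alpha f s * U.alpha g s)"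
    by (rule Bochner_Integration.integral_cong) (simp_all add: F(2))
  then show "(LINT s|\<mu>. alpha_M i T z f s * alpha_M i T z g s) =
      (LINT s|\<mu>. f s * g s) - (LINT s|\<mu>. f s) * (LINT s|\<mu>. g s) / br T"
    by (simp add: U.alpha_Gram[OF f g])
qed

end

section \<open>Gaussian processes given by vectors and their bridges\<close>

context
  fixes \<mu> :: "'a measure" and S and K :: "'h::{real_inner, complete_space} \<Rightarrow> 'a \<Rightarrow> real"
  assumes K: "isometric_iso_L2 \<mu> S K"
begin

lemma iso_L2: "K h \<in> L2 \<mu>" and iso_range: "K h \<in> S"
  using K by (auto simp: isometric_iso_L2_def)

lemma iso_inner: "(LINT x|\<mu>. K g x * K h x) = g \<bullet> h"
  using K by (auto simp: isometric_iso_L2_def)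

lemma iso_lin: "AE x in \<mu>. K (a *\<^sub>R g + b *\<^sub>R h) x = a * K g x + b * K h x"
  using K unfolding isometric_iso_L2_def by blast

lemma iso_norm: "(L2_norm \<mu> (K h))\<^sup>2 = (norm h)\<^sup>2"
  using iso_inner[of h h] by (simp add: L2_norm_power2 power2_eq_square[symmetric] power2_norm_eq_inner)

lemma iso_eq_0_AE: "h = 0 \<Longrightarrow> AE x in \<mu>. K h x = 0"
  using iso_norm[of h] by (intro L2_norm_eq_0 iso_L2) simp

lemma iso_inj:
  assumes "AE x in \<mu>. K g x = K h x"
  shows "g = h"
proof -
  have "AE x in \<mu>. K (1 *\<^sub>R g + (-1) *\<^sub>R h) x = 0"
    using iso_lin[of 1 g "-1" h] assms by eventually_elim simp
  then have "L2_norm \<mu> (K (1 *\<^sub>R g + (-1) *\<^sub>R h)) = L2_norm \<mu> (\<lambda>x. 0)"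
    using L2_D(1)[OF iso_L2] by (intro L2_norm_cong_AE) auto
  then have "(norm (1 *\<^sub>R g + (-1) *\<^sub>R h))\<^sup>2 = 0"
    unfolding iso_norm[symmetric] by (simp add: L2_norm_def)
  then show ?thesis by simp
qed

text \<open>This makes definite descriptions such as the one defining \<open>\<kappa>\<^sup>-\<^sup>1\<close> usable: the vector is unique because an isometry is
  injective.\<close>

lemma iso_the:
  assumes "f \<in> S"
  shows "AE x in \<mu>. K (THE h. AE x in \<mu>. K h x = f x) x = f x"
proof -
  obtain h where h: "AE x in \<mu>. K h x = f x" using K assms unfolding isometric_iso_L2_def by blast
  show ?thesis
  proof (rule theI2[of _ h])
    fix g assume "AE x in \<mu>. K g x = f x"
    with h have "AE x in \<mu>. K g x = K h x" by eventually_elim simp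
    then show "g = h" by (rule iso_inj)
  qed (use h in auto)
qed

lemma iso_sum:
  assumes "finite J"
  shows "AE x in \<mu>. K (\<Sum>t\<in>J. c t *\<^sub>R h t) x = (\<Sum>t\<in>J. c t * K (h t) x)"
  using assms
proof (induction J)
  case empty
  show ?case using iso_eq_0_AE[of 0] by simp
next
  case (insert r J)
  show ?case
    using insert.IH iso_lin[of "c r" "h r" 1 "\<Sum>t\<in>J. c t *\<^sub>R h t"]
    by eventually_elim (use insert.hyps in simp)
qed

end

lemma norm_sum_Gram:
  fixes h :: "'i \<Rightarrow> 'h::real_inner"
  shows "(norm (\<Sum>t\<in>J. c t *\<^sub>R h t))\<^sup>2 = (\<Sum>s\<in>J. \<Sum>t\<in>J. c s * c t * (h s \<bullet> h t))"
  unfolding power2_norm_eq_inner inner_sum_left inner_sum_right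
  by (intro sum.cong refl) (simp add: inner_commute)

text \<open>On a product of uncountably many lines, continuity does not imply measurability for the product
  \<open>\<sigma>\<close>-algebra. The function \<open>g (restrict \<omega> J)\<close>, however, is a pointwise limit of functions of the finitely many
  integers \<open>\<lfloor>n \<omega>\<^sub>t\<rfloor>\<close>, \<open>t \<in> J\<close>, and every function of finitely many measurable integer-valued functions is measurable.\<close>

lemma cylinder_function_measurable:
  fixes g :: "(real \<Rightarrow> real) \<Rightarrow> real"
  assumes J: "finite J" "J \<subseteq> I" and g: "continuous_on UNIV g"
  shows "(\<lambda>\<omega>. g (restrict \<omega> J)) \<in> borel_measurable (\<Pi>\<^sub>M t\<in>I. borel)"
proof (rule borel_measurable_LIMSEQ_real)
  define q where "q n x = real_of_int \<lfloor>x * real (Suc n)\<rfloor> / real (Suc n)" for n x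
  fix n
  let ?N = "\<Pi>\<^sub>M t\<in>J. (count_space UNIV :: int measure)"
  have 1: "(\<lambda>\<omega>. \<lambda>t\<in>J. \<lfloor>\<omega> t * real (Suc n)\<rfloor>) \<in> (\<Pi>\<^sub>M t\<in>I. borel) \<rightarrow>\<^sub>M ?N"
  proof (rule measurable_restrict)
    fix t assume "t \<in> J"
    then have [measurable]: "(\<lambda>\<omega>. \<omega> t) \<in> borel_measurable (\<Pi>\<^sub>M t\<in>I. borel)"
      using J(2) by (intro measurable_component_singleton) auto
    show "(\<lambda>\<omega>. \<lfloor>\<omega> t * real (Suc n)\<rfloor>) \<in> (\<Pi>\<^sub>M t\<in>I. borel) \<rightarrow>\<^sub>M count_space UNIV"
      by measurable
  qed
  have "?N = count_space (Pi\<^sub>E J (\<lambda>_. UNIV))" by (rule count_space_PiM_finite[OF J(1)]) simp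
  then have 2: "(\<lambda>k. g (\<lambda>t\<in>J. real_of_int (k t) / real (Suc n))) \<in> borel_measurable ?N" by simp
  have "(\<lambda>\<omega>. g (\<lambda>t\<in>J. real_of_int ((\<lambda>t\<in>J. \<lfloor>\<omega> t * real (Suc n)\<rfloor>) t) / real (Suc n)))
      \<in> borel_measurable (\<Pi>\<^sub>M t\<in>I. borel)"
    by (rule measurable_compose[OF 1 2])
  moreover have "(\<lambda>t\<in>J. real_of_int ((\<lambda>t\<in>J. \<lfloor>\<omega> t * real (Suc n)\<rfloor>) t) / real (Suc n)) = (\<lambda>t\<in>J. q n (\<omega> t))" for \<omega> :: "real \<Rightarrow> real"
    by (auto simp: q_def restrict_def)
  ultimately show "(\<lambda>\<omega>. g (\<lambda>t\<in>J. q n (\<omega> t))) \<in> borel_measurable (\<Pi>\<^sub>M t\<in>I. borel)" by simp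
next
  define q where "q n x = real_of_int \<lfloor>x * real (Suc n)\<rfloor> / real (Suc n)" for n x
  have qlim: "(\<lambda>n. q n x) \<longlonglongrightarrow> x" for x
  proof (rule LIM_zero_cancel, rule Lim_null_comparison)
    show "(\<lambda>n. 1 / real (Suc n)) \<longlonglongrightarrow> 0"
      using LIMSEQ_inverse_real_of_nat by (simp add: inverse_eq_divide)
    have "norm (q n x - x) \<le> 1 / real (Suc n)" for n
    proof -
      have "q n x - x = (real_of_int \<lfloor>x * real (Suc n)\<rfloor> - x * real (Suc n)) / real (Suc n)"
        by (simp add: q_def field_simps)
      moreover have "\<bar>real_of_int \<lfloor>x * real (Suc n)\<rfloor> - x * real (Suc n)\<bar> \<le> 1" by linarith
      ultimately show ?thesis by (simp add: abs_divide divide_right_mono del: of_nat_Suc)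
    qed
    then show "\<forall>\<^sub>F n in sequentially. norm (q n x - x) \<le> 1 / real (Suc n)" by simp
  qed
  fix \<omega> :: "real \<Rightarrow> real"
  have "(\<lambda>n. \<lambda>t\<in>J. q n (\<omega> t)) \<longlonglongrightarrow> restrict \<omega> J"
  proof -
    have "limitin (product_topology (\<lambda>_. euclidean) UNIV) (\<lambda>n. \<lambda>t\<in>J. q n (\<omega> t)) (restrict \<omega> J) sequentially"
      unfolding limitin_componentwise using qlim by (auto simp: restrict_def)
    then show ?thesis unfolding euclidean_product_topology limitin_canonical_iff .
  qed
  from continuous_on_tendsto_compose[OF g this]
  show "(\<lambda>n. g (\<lambda>t\<in>J. real_of_int \<lfloor>\<omega> t * real (Suc n)\<rfloor> / real (Suc n))) \<longlonglongrightarrow> g (restrict \<omega> J)"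
    unfolding q_def by simp
qed

lemma path_law_alt: "path_law P T Y = distr P (\<Pi>\<^sub>M t\<in>{0..T}. borel) (\<lambda>\<omega>. \<lambda>t\<in>{0..T}. Y t \<omega>)"
  by (simp add: path_law_def sample_path_def[abs_def])

text \<open>The vectors \<open>h\<^sub>t\<close> represent the process \<open>Y\<close>: combinations of \<open>Y\<^sub>t\<close> are centered Gaussian with the variance given by
  the combination of \<open>h\<^sub>t\<close>. In other words, \<open>Y\<close> is a centered Gaussian process with covariance \<open>h\<^sub>s \<bullet> h\<^sub>t\<close>.\<close>

definition gaussian_embedding ::
    "'a measure \<Rightarrow> real \<Rightarrow> (real \<Rightarrow> 'h::real_inner) \<Rightarrow> (real \<Rightarrow> 'a \<Rightarrow> real) \<Rightarrow> bool" where
  "gaussian_embedding P T h Y \<longleftrightarrow> (\<forall>t\<in>{0..T}. Y t \<in> L2 P) \<and>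
     (\<forall>J c. finite J \<and> J \<subseteq> {0..T} \<longrightarrow>
       gaussian_char P ((norm (\<Sum>t\<in>J. c t *\<^sub>R h t))\<^sup>2) (\<lambda>\<omega>. \<Sum>t\<in>J. c t * Y t \<omega>))"

lemma gaussian_embedding_char:
  assumes "gaussian_embedding P T h Y" "finite J" "J \<subseteq> {0..T}"
  shows "(CLINT \<omega>|P. iexp (\<Sum>t\<in>J. c t * Y t \<omega>)) =
    complex_of_real (exp (- ((norm (\<Sum>t\<in>J. c t *\<^sub>R h t))\<^sup>2 / 2)))"
proof -
  have "\<forall>u. (CLINT \<omega>|P. iexp (u * (\<Sum>t\<in>J. c t * Y t \<omega>))) =
    complex_of_real (exp (- (u\<^sup>2 * (norm (\<Sum>t\<in>J. c t *\<^sub>R h t))\<^sup>2 / 2)))"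
    using assms unfolding gaussian_embedding_def gaussian_char_def by blast
  from spec[OF this, of 1] show ?thesis by simp
qed

lemma gaussian_embedding_centered:
  assumes P: "prob_space P" and Y: "gaussian_embedding P T h Y"
  shows "centered_gaussian_process P T Y"
    and "\<And>s t. s \<in> {0..T} \<Longrightarrow> t \<in> {0..T} \<Longrightarrow> cov P Y s t = h s \<bullet> h t"
proof -
  have g: "gaussian_char P ((norm (\<Sum>t\<in>J. c t *\<^sub>R h t))\<^sup>2) (\<lambda>\<omega>. \<Sum>t\<in>J. c t * Y t \<omega>)"
    if "finite J" "J \<subseteq> {0..T}" for J c
    using Y that unfolding gaussian_embedding_def by blast
  have L: "Y t \<in> L2 P" if "t \<in> {0..T}" for t using Y that unfolding gaussian_embedding_def by blast
  have mean: "(LINT \<omega>|P. Y t \<omega>) = 0" if "t \<in> {0..T}" for t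
    using gaussian_char_imp_gaussian(2)[OF P g[of "{t}" "\<lambda>_. 1"]] that by simp
  show "centered_gaussian_process P T Y"
    unfolding centered_gaussian_process_def using gaussian_char_imp_gaussian(1)[OF P g] mean by blast
  fix s t assume st: "s \<in> {0..T}" "t \<in> {0..T}"
  have sq: "(LINT \<omega>|P. (Y r \<omega>)\<^sup>2) = (norm (h r))\<^sup>2" if "r \<in> {0..T}" for r
    using gaussian_char_imp_gaussian(3)[OF P g[of "{r}" "\<lambda>_. 1"]] that by simp
  have "(LINT \<omega>|P. Y s \<omega> * Y t \<omega>) = h s \<bullet> h t"
  proof (cases "s = t")
    case True
    then show ?thesis using sq[OF st(1)] by (simp add: power2_eq_square[symmetric] power2_norm_eq_inner)
  next
    case False
    have "(LINT \<omega>|P. (1 * Y s \<omega> + 1 * Y t \<omega>)\<^sup>2) = (norm (h s + h t))\<^sup>2"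
      using gaussian_char_imp_gaussian(3)[OF P g[of "{s, t}" "\<lambda>_. 1"]] st False by simp
    then show ?thesis
      using L2_norm_lincomb_power2[OF L L, OF st, of 1 1] sq[OF st(1)] sq[OF st(2)]
      by (simp add: L2_norm_power2 power2_norm_eq_inner inner_add_left inner_add_right inner_commute)
  qed
  then show "cov P Y s t = h s \<bullet> h t"
    unfolding cov_def using mean st by simp
qed

lemma path_law_cong_Gram:
  assumes P: "prob_space P" and Y: "gaussian_embedding P T h Y" and Y': "gaussian_embedding P T h' Y'"
    and eq: "\<And>s t. s \<in> {0..T} \<Longrightarrow> t \<in> {0..T} \<Longrightarrow> h s \<bullet> h t = h' s \<bullet> h' t"
  shows "path_law P T Y = path_law P T Y'"
  unfolding path_law_alt
proof (rule law_unique_by_linear_combinations[OF P P])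
  show "Y t \<in> borel_measurable P" "Y' t \<in> borel_measurable P" if "t \<in> {0..T}" for t
    using Y Y' that by (auto simp: gaussian_embedding_def intro: L2_D)
  fix J and c :: "real \<Rightarrow> real" assume J: "finite J" "J \<subseteq> {0..T}"
  have "(norm (\<Sum>t\<in>J. c t *\<^sub>R h t))\<^sup>2 = (norm (\<Sum>t\<in>J. c t *\<^sub>R h' t))\<^sup>2"
    unfolding norm_sum_Gram using J(2) eq by (intro sum.cong refl) (auto simp: subset_iff)
  then show "(CLINT \<omega>|P. iexp (\<Sum>t\<in>J. c t * Y t \<omega>)) = (CLINT \<omega>|P. iexp (\<Sum>t\<in>J. c t * Y' t \<omega>))"
    unfolding gaussian_embedding_char[OF Y J] gaussian_embedding_char[OF Y' J] by simp
qed

text \<open>Let \<open>r\<^sub>t\<close> be the regression coefficient of \<open>X\<^sub>t\<close> on \<open>X\<^sub>T\<close>. For independent copies \<open>\<omega>, \<omega>'\<close>, the process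
  \<open>B\<^sub>t(\<omega>) + r\<^sub>t X\<^sub>T(\<omega>')\<close> has the covariance of \<open>X\<close>, hence its law. Since \<open>B\<^sub>T = 0\<close> and \<open>r\<^sub>T = 1\<close>, its value at \<open>T\<close> is
  \<open>X\<^sub>T(\<omega>')\<close>. Integrating over \<open>\<omega>\<close> first shows that the law of \<open>X\<close> given \<open>X\<^sub>T = x\<close> is the law \<open>Q x\<close> of
  \<open>B\<^sub>t + r\<^sub>t x\<close>. This version is weakly continuous in \<open>x\<close>, and \<open>Q 0\<close> is the law of \<open>B\<close>.\<close>

theorem bridge_by_covariance:
  fixes e b :: "real \<Rightarrow> 'h::real_inner"
  assumes P: "prob_space P" and T: "0 < T"
    and X: "gaussian_embedding P T e X" and B: "gaussian_embedding P T b B"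
    and v: "v = e T \<bullet> e T" "0 < v"
    and Gram: "\<And>s t. s \<in> {0..T} \<Longrightarrow> t \<in> {0..T} \<Longrightarrow> b s \<bullet> b t = e s \<bullet> e t - (e s \<bullet> e T) * (e t \<bullet> e T) / v"
    and BT: "AE \<omega> in P. B T \<omega> = 0"
  shows "is_bridge P T X B"
proof -
  interpret P: prob_space P by fact
  interpret PP: pair_sigma_finite P P ..
  interpret PP: pair_prob_space P P ..
  let ?\<Pi> = "\<Pi>\<^sub>M t\<in>{0..T}. (borel :: real measure)"
  have Xm: "X t \<in> borel_measurable P" if "t \<in> {0..T}" for t
    using X that by (auto simp: gaussian_embedding_def intro: L2_D)
  have Bm: "B t \<in> borel_measurable P" if "t \<in> {0..T}" for t
    using B that by (auto simp: gaussian_embedding_def intro: L2_D)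
  have TT: "T \<in> {0..T}" using T by simp
  note [measurable] = Xm[OF TT] Bm[OF TT]
  define r where "r t = (e t \<bullet> e T) / v" for t
  have rT: "r T = 1" using v by (simp add: r_def)
  define \<Phi> where "\<Phi> x \<omega> = (\<lambda>t\<in>{0..T}. B t \<omega> + r t * x)" for x \<omega>
  have \<Phi>_m [measurable]: "(\<lambda>(x, \<omega>). \<Phi> x \<omega>) \<in> borel \<Otimes>\<^sub>M P \<rightarrow>\<^sub>M ?\<Pi>"
    unfolding \<Phi>_def case_prod_beta'
    by (intro measurable_restrict borel_measurable_add borel_measurable_times borel_measurable_const
        measurable_compose[OF measurable_snd Bm] measurable_fst)
  have \<Phi>_m' [measurable]: "\<Phi> x \<in> P \<rightarrow>\<^sub>M ?\<Pi>" for x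
    using measurable_compose[OF measurable_Pair1'[of x borel P] \<Phi>_m] by simp
  define Q where "Q x = distr P ?\<Pi> (\<Phi> x)" for x
  have Qm [measurable]: "Q \<in> borel \<rightarrow>\<^sub>M prob_algebra ?\<Pi>"
    unfolding Q_def
    by (rule measurable_distr_prob_space2[where M = P])
       (use \<Phi>_m P in \<open>auto simp: space_prob_algebra\<close>)
  define Y where "Y t p = B t (fst p) + r t * X T (snd p)" for t p
  have Ym: "Y t \<in> borel_measurable (P \<Otimes>\<^sub>M P)" if "t \<in> {0..T}" for t
    unfolding Y_def using Bm[OF that] by measurable
  have law: "distr (P \<Otimes>\<^sub>M P) ?\<Pi> (\<lambda>p. \<lambda>t\<in>{0..T}. Y t p) = path_law P T X"
    unfolding path_law_alt
  proof (rule law_unique_by_linear_combinations[OF PP.prob_space_axioms P Ym Xm])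
    fix J and c :: "real \<Rightarrow> real" assume J: "finite J" "J \<subseteq> {0..T}"
    define \<rho> where "\<rho> = (\<Sum>t\<in>J. c t * r t)"
    define S where "S \<omega> = (\<Sum>t\<in>J. c t * B t \<omega>)" for \<omega>
    have [measurable]: "S \<in> borel_measurable P"
      unfolding S_def using J(2) Bm by (intro borel_measurable_sum borel_measurable_times) auto
    have dec: "(\<Sum>t\<in>J. c t * Y t p) = S (fst p) + \<rho> * X T (snd p)" for p
      unfolding Y_def S_def \<rho>_def by (simp add: distrib_left sum.distrib sum_distrib_right mult.assoc)
    have int: "integrable (P \<Otimes>\<^sub>M P) (\<lambda>p. iexp (S (fst p) + \<rho> * X T (snd p)))"
      by (rule PP.integrable_iexp) simp_all
    \<comment> \<open>The variance of the combination of \<open>X\<close> splits into that of \<open>B\<close> and that of \<open>\<rho> X\<^sub>T\<close>.\<close>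
    have eb: "(norm (\<Sum>t\<in>J. c t *\<^sub>R b t))\<^sup>2 = (norm (\<Sum>t\<in>J. c t *\<^sub>R e t))\<^sup>2 - \<rho>\<^sup>2 * v"
    proof -
      have "(norm (\<Sum>t\<in>J. c t *\<^sub>R b t))\<^sup>2 = (\<Sum>s\<in>J. \<Sum>t\<in>J. c s * c t * (e s \<bullet> e t) - (c s * r s) * (c t * r t) * v)"
        unfolding norm_sum_Gram
      proof (intro sum.cong refl)
        fix s t assume "s \<in> J" "t \<in> J"
        then have "s \<in> {0..T}" "t \<in> {0..T}" using J(2) by auto
        from Gram[OF this] have bst: "b s \<bullet> b t = e s \<bullet> e t - r s * r t * v"
          using v(2) by (simp add: r_def)
        show "c s * c t * (b s \<bullet> b t) = c s * c t * (e s \<bullet> e t) - (c s * r s) * (c t * r t) * v"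
          unfolding bst by (simp add: algebra_simps)
      qed
      also have "\<dots> = (norm (\<Sum>t\<in>J. c t *\<^sub>R e t))\<^sup>2 - (\<Sum>s\<in>J. \<Sum>t\<in>J. (c s * r s) * (c t * r t)) * v"
        unfolding norm_sum_Gram by (simp add: sum_subtractf sum_distrib_right)
      also have "(\<Sum>s\<in>J. \<Sum>t\<in>J. (c s * r s) * (c t * r t)) = \<rho>\<^sup>2"
        unfolding \<rho>_def power2_eq_square by (rule sum_product[symmetric])
      finally show ?thesis .
    qed
    have XT: "(CLINT \<omega>|P. iexp (\<rho> * X T \<omega>)) = complex_of_real (exp (- (\<rho>\<^sup>2 * v / 2)))"
      using gaussian_embedding_char[OF X, of "{T}" "\<lambda>_. \<rho>"] T v(1)
      by (simp add: power_mult_distrib power2_norm_eq_inner)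
    have "(CLINT p|P \<Otimes>\<^sub>M P. iexp (\<Sum>t\<in>J. c t * Y t p)) =
        (CLINT \<omega>|P. CLINT \<omega>'|P. iexp (S \<omega> + \<rho> * X T \<omega>'))"
      unfolding dec using PP.integral_fst'[OF int] by simp
    also have "\<dots> = (CLINT \<omega>|P. CLINT \<omega>'|P. iexp (S \<omega>) * iexp (\<rho> * X T \<omega>'))"
      by (simp only: of_real_add distrib_left exp_add)
    also have "\<dots> = (CLINT \<omega>|P. iexp (S \<omega>)) * (CLINT \<omega>'|P. iexp (\<rho> * X T \<omega>'))"
      by (simp only: integral_mult_right_zero integral_mult_left_zero)
    also have "\<dots> = complex_of_real (exp (- ((norm (\<Sum>t\<in>J. c t *\<^sub>R b t))\<^sup>2 / 2)) * exp (- (\<rho>\<^sup>2 * v / 2)))"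
      unfolding XT S_def gaussian_embedding_char[OF B J] by simp
    also have "exp (- ((norm (\<Sum>t\<in>J. c t *\<^sub>R b t))\<^sup>2 / 2)) * exp (- (\<rho>\<^sup>2 * v / 2)) =
        exp (- ((norm (\<Sum>t\<in>J. c t *\<^sub>R e t))\<^sup>2 / 2))"
      unfolding eb exp_add[symmetric] by (simp add: field_simps)
    also have "complex_of_real \<dots> = (CLINT \<omega>|P. iexp (\<Sum>t\<in>J. c t * X t \<omega>))"
      by (rule gaussian_embedding_char[OF X J, symmetric])
    finally show "(CLINT p|P \<Otimes>\<^sub>M P. iexp (\<Sum>t\<in>J. c t * Y t p)) = (CLINT \<omega>|P. iexp (\<Sum>t\<in>J. c t * X t \<omega>))" .
  qed
  have Ypath: "(\<lambda>t\<in>{0..T}. Y t p) = \<Phi> (X T (snd p)) (fst p)" for p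
    by (simp add: Y_def \<Phi>_def)
  have disint: "measure P {\<omega>\<in>space P. sample_path T X \<omega> \<in> A \<and> X T \<omega> \<in> C} =
      (LINT x|distr P borel (X T). indicator C x * measure (Q x) A)"
    if A: "A \<in> sets ?\<Pi>" and C: "C \<in> sets borel" for A C
  proof -
    note [measurable] = A C
    let ?D = "{\<xi>\<in>space ?\<Pi>. \<xi> \<in> A \<and> \<xi> T \<in> C}"
    have [measurable]: "(\<lambda>\<xi>. \<xi> T) \<in> borel_measurable ?\<Pi>"
      using TT by (intro measurable_component_singleton)
    have D: "?D \<in> sets ?\<Pi>" by measurable
    have sp [measurable]: "sample_path T X \<in> P \<rightarrow>\<^sub>M ?\<Pi>"
      unfolding sample_path_def[abs_def] by (intro measurable_restrict Xm)
    have YP [measurable]: "(\<lambda>p. \<lambda>t\<in>{0..T}. Y t p) \<in> P \<Otimes>\<^sub>M P \<rightarrow>\<^sub>M ?\<Pi>"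
      by (intro measurable_restrict Ym)
    let ?I = "\<lambda>p. indicator C (X T (snd p)) * indicator A (\<Phi> (X T (snd p)) (fst p)) :: real"
    have "(\<lambda>p. (\<lambda>(x, \<omega>). \<Phi> x \<omega>) (X T (snd p), fst p)) \<in> P \<Otimes>\<^sub>M P \<rightarrow>\<^sub>M ?\<Pi>" by measurable
    then have [measurable]: "(\<lambda>p. \<Phi> (X T (snd p)) (fst p)) \<in> P \<Otimes>\<^sub>M P \<rightarrow>\<^sub>M ?\<Pi>" by simp
    have Im: "?I \<in> borel_measurable (P \<Otimes>\<^sub>M P)" by measurable
    have Iint: "integrable (P \<Otimes>\<^sub>M P) (\<lambda>(\<omega>, \<omega>'). ?I (\<omega>, \<omega>'))"
      by (rule PP.integrable_const_bound[of _ 1]) (use Im in \<open>auto simp: indicator_def case_prod_beta'\<close>)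
    have "measure P {\<omega>\<in>space P. sample_path T X \<omega> \<in> A \<and> X T \<omega> \<in> C} = measure (path_law P T X) ?D"
    proof -
      have "sample_path T X -` ?D \<inter> space P = {\<omega>\<in>space P. sample_path T X \<omega> \<in> A \<and> X T \<omega> \<in> C}"
        using measurable_space[OF sp] T by (auto simp: sample_path_def)
      then show ?thesis unfolding path_law_def by (simp add: measure_distr[OF sp D])
    qed
    also have "\<dots> = measure (P \<Otimes>\<^sub>M P) ((\<lambda>p. \<lambda>t\<in>{0..T}. Y t p) -` ?D \<inter> space (P \<Otimes>\<^sub>M P))"
      unfolding law[symmetric] by (rule measure_distr[OF YP D])
    also have "\<dots> = (LINT p|(P \<Otimes>\<^sub>M P). indicator ((\<lambda>p. \<lambda>t\<in>{0..T}. Y t p) -` ?D \<inter> space (P \<Otimes>\<^sub>M P)) p)"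
      by simp
    also have "\<dots> = (LINT p|(P \<Otimes>\<^sub>M P). ?I p)"
    proof (rule integral_cong_AE)
      have "AE p in P \<Otimes>\<^sub>M P. B T (fst p) = 0"
        by (rule PP.AE_pair_measure) (use BT in \<open>measurable, auto\<close>)
      then show "AE p in P \<Otimes>\<^sub>M P. indicator ((\<lambda>p. \<lambda>t\<in>{0..T}. Y t p) -` ?D \<inter> space (P \<Otimes>\<^sub>M P)) p = ?I p"
        using AE_space
      proof eventually_elim
        case (elim p)
        have "Y T p = X T (snd p)" using elim rT by (simp add: Y_def)
        moreover have "(\<lambda>t\<in>{0..T}. Y t p) \<in> space ?\<Pi>" using measurable_space[OF YP elim(2)] .
        ultimately show ?case using elim(2) T unfolding Ypath[symmetric] by (auto simp: indicator_def)
      qed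
      show "(\<lambda>p. indicator ((\<lambda>p. \<lambda>t\<in>{0..T}. Y t p) -` ?D \<inter> space (P \<Otimes>\<^sub>M P)) p :: real) \<in> borel_measurable (P \<Otimes>\<^sub>M P)"
        using measurable_sets[OF YP D] by simp
      show "?I \<in> borel_measurable (P \<Otimes>\<^sub>M P)" by (rule Im)
    qed
    also have "\<dots> = (LINT \<omega>'|P. (LINT \<omega>|P. ?I (\<omega>, \<omega>')))"
      using PP.integral_snd[OF Iint] by (simp add: case_prod_beta')
    also have "\<dots> = (LINT \<omega>'|P. indicator C (X T \<omega>') * measure (Q (X T \<omega>')) A)"
    proof (rule Bochner_Integration.integral_cong[OF refl])
      fix \<omega>'
      have "measure (Q x) A = (LINT \<omega>|P. indicator A (\<Phi> x \<omega>))" for x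
      proof -
        have "measure (Q x) A = measure P (\<Phi> x -` A \<inter> space P)"
          unfolding Q_def by (rule measure_distr) measurable
        also have "\<dots> = (LINT \<omega>|P. indicator (\<Phi> x -` A \<inter> space P) \<omega>)" by simp
        also have "\<dots> = (LINT \<omega>|P. indicator A (\<Phi> x \<omega>))"
          by (rule Bochner_Integration.integral_cong) (auto simp: indicator_def)
        finally show ?thesis .
      qed
      then show "(LINT \<omega>|P. ?I (\<omega>, \<omega>')) = indicator C (X T \<omega>') * measure (Q (X T \<omega>')) A" by simp
    qed
    also have "\<dots> = (LINT x|distr P borel (X T). indicator C x * measure (Q x) A)"
      by (rule integral_distr[symmetric])
         (auto intro!: borel_measurable_times measurable_compose[OF Qm measurable_measure_prob_algebra[OF A]])
    finally show ?thesis .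
  qed
  have weak: "continuous_on UNIV (\<lambda>x. \<integral>\<xi>. g (restrict \<xi> J) \<partial>Q x)"
    if J: "finite J" "J \<subseteq> {0..T}" and g: "continuous_on UNIV g" "bounded (range g)"
    for J and g :: "(real \<Rightarrow> real) \<Rightarrow> real"
  proof -
    obtain b where b: "\<And>\<xi>. norm (g \<xi>) \<le> b" using g(2) unfolding bounded_iff by auto
    have gm: "(\<lambda>\<xi>. g (restrict \<xi> J)) \<in> borel_measurable ?\<Pi>"
      by (rule cylinder_function_measurable[OF J g(1)])
    have gm' [measurable]: "(\<lambda>\<omega>. g (restrict (\<Phi> x \<omega>) J)) \<in> borel_measurable P" for x
      by (rule measurable_compose[OF \<Phi>_m' gm])
    have eq: "(LINT \<xi>|Q x. g (restrict \<xi> J)) = (LINT \<omega>|P. g (restrict (\<Phi> x \<omega>) J))" for x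
      unfolding Q_def by (rule integral_distr[OF \<Phi>_m' gm])
    have c: "continuous_on UNIV (\<lambda>x. g (restrict (\<Phi> x \<omega>) J))" for \<omega>
    proof (rule continuous_on_compose2[OF g(1)])
      show "continuous_on UNIV (\<lambda>x. restrict (\<Phi> x \<omega>) J)"
      proof (rule continuous_on_coordinatewise_then_product)
        fix t
        show "continuous_on UNIV (\<lambda>x. restrict (\<Phi> x \<omega>) J t)"
          using J(2) by (cases "t \<in> J") (auto simp: \<Phi>_def intro!: continuous_intros)
      qed
    qed simp
    show ?thesis unfolding eq
    proof (rule continuous_on_sequentiallyI)
      fix xs :: "nat \<Rightarrow> real" and x assume "xs \<longlonglongrightarrow> x"
      show "(\<lambda>n. \<integral>\<omega>. g (restrict (\<Phi> (xs n) \<omega>) J) \<partial>P) \<longlonglongrightarrow> (LINT \<omega>|P. g (restrict (\<Phi> x \<omega>) J))"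
      proof (rule integral_dominated_convergence[where w = "\<lambda>_. b"])
        show "AE \<omega> in P. (\<lambda>n. g (restrict (\<Phi> (xs n) \<omega>) J)) \<longlonglongrightarrow> g (restrict (\<Phi> x \<omega>) J)"
        proof (rule AE_I2)
          fix \<omega>
          have "isCont (\<lambda>x. g (restrict (\<Phi> x \<omega>) J)) x"
            using c[of \<omega>] by (simp add: continuous_on_eq_continuous_at)
          from isCont_tendsto_compose[OF this \<open>xs \<longlonglongrightarrow> x\<close>]
          show "(\<lambda>n. g (restrict (\<Phi> (xs n) \<omega>) J)) \<longlonglongrightarrow> g (restrict (\<Phi> x \<omega>) J)" .
        qed
      qed (use b in auto)
    qed
  qed
  have "conditional_law P T X Q"
    unfolding conditional_law_def using Qm disint weak by blast
  moreover have "path_law P T B = Q 0"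
    unfolding path_law_alt Q_def \<Phi>_def by simp
  ultimately show ?thesis unfolding is_bridge_def using Bm by blast
qed

section \<open>The transformations of the coordinate process\<close>

text \<open>The Gram matrix of \<open>z\<^sub>t / z\<^sub>T\<close> in \<open>L\<^sup>2(d\<langle>M\<rangle>)\<close> is that of \<open>z\<^sub>t\<close> in \<open>L\<^sup>2(\<lambda>)\<close>, which is the covariance of \<open>X\<close>. The closed
  span is everything because the \<open>z\<^sub>t\<close> generate \<open>L\<^sup>2(\<lambda>)\<close> and multiplication by \<open>z\<^sub>T\<close>
  is an isometry that maps \<open>z\<^sub>t / z\<^sub>T\<close> to \<open>z\<^sub>t\<close>.\<close>

lemma kappa_isometry:
  fixes \<iota> :: "(real \<Rightarrow> real) \<Rightarrow> 'h::{real_inner, complete_space}"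
  assumes T: "T > 0" and P: "prob_space P" and W: "brownian_motion P T W"
    and X: "volterra_gaussian P T W z X" and nd: "nondegenerate_kernel T z"
    and nz: "AE s in lebesgue_on {0..T}. z T s \<noteq> 0" and L: "is_Lambda P T X \<iota>"
  shows "isometric_iso_L2 (d_bracket T z) (L2 (d_bracket T z)) (kappa T z \<iota>)"
    and "t \<in> {0<..T} \<Longrightarrow> AE s in d_bracket T z. kappa T z \<iota> (\<iota> (indicator {0..<t})) s = z t s / z T s"
proof -
  have TT: "T \<in> {0..T}" using T by simp
  interpret bracket_kernel T z
    by unfold_locales (use T volterra_L2(2)[OF X TT] nz in auto)
  define v where "v t s = z t s / z T s" for t s
  have zm [measurable]: "z t \<in> borel_measurable (lebesgue_on {0..T})" if "t \<in> {0..T}" for t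
    using volterra_L2(2)[OF X that] by (rule L2_D)
  have vm [measurable]: "v t \<in> borel_measurable (lebesgue_on {0..T})" if "t \<in> {0..T}" for t
    unfolding v_def[abs_def] using zm[OF that] by measurable
  have vL: "v t \<in> L2 \<mu>" if "t \<in> {0<..T}" for t
  proof -
    have t: "t \<in> {0..T}" using that by auto
    have "(\<lambda>s. z T s * v t s) \<in> L2 (lebesgue_on {0..T})"
    proof (rule L2_cong_AE[OF volterra_L2(2)[OF X t]])
      show "(\<lambda>s. z T s * v t s) \<in> borel_measurable (lebesgue_on {0..T})"
        using vm[OF t] by measurable
    qed (use nz in \<open>auto simp: v_def\<close>)
    then show ?thesis using vm[OF t] by (simp add: L2_d_bracket_iff)
  qed
  have gram: "(LINT u|\<mu>. v s u * v t u) = \<iota> (indicator {0..<s}) \<bullet> \<iota> (indicator {0..<t})"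
    if "s \<in> {0<..T}" "t \<in> {0<..T}" for s t
  proof -
    have st: "s \<in> {0..T}" "t \<in> {0..T}" using that by auto
    note [measurable] = vm[OF st(1)] vm[OF st(2)] zm[OF st(1)] zm[OF st(2)]
    have "(LINT u|\<mu>. v s u * v t u) = (LINT u|lebesgue_on {0..T}. (z T u)\<^sup>2 * (v s u * v t u))"
      by (rule integral_d_bracket) measurable
    also have "\<dots> = (LINT u|lebesgue_on {0..T}. z s u * z t u)"
    proof (rule integral_cong_AE)
      show "AE u in lebesgue_on {0..T}. (z T u)\<^sup>2 * (v s u * v t u) = z s u * z t u"
        using nz by eventually_elim (simp add: v_def power2_eq_square)
    qed measurable
    also have "\<dots> = cov P X s t" using volterra_covariance(3)[OF P W X st] ..
    finally show ?thesis using L that by (simp add: is_Lambda_def)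
  qed
  have span: "L2_closed_span \<mu> {0<..T} v = L2 \<mu>"
  proof
    show "L2_closed_span \<mu> {0<..T} v \<subseteq> L2 \<mu>" by (auto simp: L2_closed_span_def)
    show "L2 \<mu> \<subseteq> L2_closed_span \<mu> {0<..T} v"
    proof
      fix f assume f: "f \<in> L2 \<mu>"
      then have fm [measurable]: "f \<in> borel_measurable (lebesgue_on {0..T})" by (simp add: L2_d_bracket_iff)
      have "(\<lambda>s. z T s * f s) \<in> L2_closed_span (lebesgue_on {0..T}) {0<..T} z"
        using f nd by (simp add: L2_d_bracket_iff nondegenerate_kernel_def)
      then have ap: "\<exists>J c. finite J \<and> J \<subseteq> {0<..T} \<and>
          (LINT s|lebesgue_on {0..T}. (z T s * f s - (\<Sum>t\<in>J. c t * z t s))\<^sup>2) < d" if "d > 0" for d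
        using that unfolding L2_closed_span_def by blast
      have eq: "(LINT s|\<mu>. (f s - (\<Sum>t\<in>J. c t * v t s))\<^sup>2) =
          (LINT s|lebesgue_on {0..T}. (z T s * f s - (\<Sum>t\<in>J. c t * z t s))\<^sup>2)"
        if J: "J \<subseteq> {0<..T}" for J c
      proof -
        have [measurable]: "(\<lambda>s. \<Sum>t\<in>J. c t * v t s) \<in> borel_measurable (lebesgue_on {0..T})"
          "(\<lambda>s. \<Sum>t\<in>J. c t * z t s) \<in> borel_measurable (lebesgue_on {0..T})"
          using J by (auto intro!: borel_measurable_sum borel_measurable_times vm zm)
        have "(LINT s|\<mu>. (f s - (\<Sum>t\<in>J. c t * v t s))\<^sup>2) =
            (LINT s|lebesgue_on {0..T}. (z T s)\<^sup>2 * (f s - (\<Sum>t\<in>J. c t * v t s))\<^sup>2)"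
          by (rule integral_d_bracket) measurable
        also have "\<dots> = (LINT s|lebesgue_on {0..T}. (z T s * f s - (\<Sum>t\<in>J. c t * z t s))\<^sup>2)"
        proof (rule integral_cong_AE)
          show "AE s in lebesgue_on {0..T}. (z T s)\<^sup>2 * (f s - (\<Sum>t\<in>J. c t * v t s))\<^sup>2
              = (z T s * f s - (\<Sum>t\<in>J. c t * z t s))\<^sup>2"
            using nz
          proof eventually_elim
            case (elim s)
            have "z T s * (\<Sum>t\<in>J. c t * v t s) = (\<Sum>t\<in>J. c t * z t s)"
              unfolding sum_distrib_left v_def using elim by (intro sum.cong) auto
            then show ?case
              unfolding power_mult_distrib[symmetric] by (simp add: right_diff_distrib)
          qed
        qed measurable
        finally show ?thesis .
      qed
      show "f \<in> L2_closed_span \<mu> {0<..T} v"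
        unfolding L2_closed_span_def
      proof (intro CollectI conjI allI impI f)
        fix d :: real assume "d > 0"
        from ap[OF this] obtain J c where "finite J" "J \<subseteq> {0<..T}"
          "(LINT s|lebesgue_on {0..T}. (z T s * f s - (\<Sum>t\<in>J. c t * z t s))\<^sup>2) < d" by blast
        then show "\<exists>J c. finite J \<and> J \<subseteq> {0<..T} \<and> (LINT s|\<mu>. (f s - (\<Sum>t\<in>J. c t * v t s))\<^sup>2) < d"
          by (intro exI[of _ J] exI[of _ c]) (simp add: eq)
      qed
    qed
  qed
  have "\<exists>K. isometric_iso_L2 \<mu> (L2_closed_span \<mu> {0<..T} v) K \<and>
      (\<forall>t\<in>{0<..T}. AE s in \<mu>. K (\<iota> (indicator {0..<t})) s = v t s)"
    by (rule closed_span_isometry_exists[OF finite_measure_d_bracket vL gram is_Lambda_dense[OF L]])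
  then have "isometric_iso_L2 \<mu> (L2 \<mu>) (kappa T z \<iota>) \<and>
      (\<forall>t\<in>{0<..T}. AE s in \<mu>. kappa T z \<iota> (\<iota> (indicator {0..<t})) s = z t s / z T s)"
    unfolding span v_def kappa_def by (rule someI_ex)
  then show "isometric_iso_L2 \<mu> (L2 \<mu>) (kappa T z \<iota>)"
    "t \<in> {0<..T} \<Longrightarrow> AE s in \<mu>. kappa T z \<iota> (\<iota> (indicator {0..<t})) s = z t s / z T s" by auto
qed

lemma volterra_starts_at_0:
  assumes T: "T > 0" and P: "prob_space P" and W: "brownian_motion P T W"
    and X: "volterra_gaussian P T W z X"
  shows "AE \<omega> in P. X 0 \<omega> = 0"
proof (rule L2_norm_eq_0)
  have 0: "0 \<in> {0..T}" using T by simp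
  show "X 0 \<in> L2 P" by (rule volterra_L2(1)[OF X 0])
  have "(LINT \<omega>|P. X 0 \<omega> * X 0 \<omega>) = (LINT u|lebesgue_on {0..T}. z 0 u * z 0 u)"
    by (rule volterra_covariance(2)[OF P W X 0 0])
  also have "\<dots> = (LINT u|lebesgue_on {0..T}. 0)"
    using X T by (intro Bochner_Integration.integral_cong) (auto simp: volterra_gaussian_def)
  finally show "L2_norm P (X 0) = 0" by (simp add: L2_norm_def power2_eq_square)
qed

text \<open>The index \<open>0\<close> may be added to the spanning family, because \<open>X\<^sub>0 = 0\<close> almost surely and \<open>1\<^bsub>[0,0)\<^esub> = 0\<close>.\<close>

lemma wiener_integral_isometry:
  fixes \<iota> :: "(real \<Rightarrow> real) \<Rightarrow> 'h::{real_inner, complete_space}"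
  assumes T: "T > 0" and P: "prob_space P" and W: "brownian_motion P T W"
    and X: "volterra_gaussian P T W z X" and L: "is_Lambda P T X \<iota>"
  shows "isometric_iso_L2 P (L2_closed_span P {0..T} X) (wiener_integral P T X \<iota>)"
    and "t \<in> {0..T} \<Longrightarrow> AE \<omega> in P. wiener_integral P T X \<iota> (\<iota> (indicator {0..<t})) \<omega> = X t \<omega>"
proof -
  interpret prob_space P by fact
  have e0: "\<iota> (indicator {0..<0}) = 0"
    using is_Lambda_sum[OF L, of "{}"] by (simp add: indicator_def[abs_def])
  have gram: "(LINT \<omega>|P. X s \<omega> * X t \<omega>) = \<iota> (indicator {0..<s}) \<bullet> \<iota> (indicator {0..<t})"
    if st: "s \<in> {0..T}" "t \<in> {0..T}" for s t
  proof (cases "s = 0 \<or> t = 0")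
    case True
    have "AE \<omega> in P. X s \<omega> * X t \<omega> = 0"
      using volterra_starts_at_0[OF T P W X] by eventually_elim (use True in auto)
    then have "(LINT \<omega>|P. X s \<omega> * X t \<omega>) = 0" by (rule integral_eq_zero_AE)
    then show ?thesis using True by (auto simp: e0 simp del: atLeastLessThan_empty)
  next
    case False
    then show ?thesis
      using L st volterra_covariance(2,3)[OF P W X st] by (simp add: is_Lambda_def)
  qed
  have "UNIV \<subseteq> closure {\<Sum>t\<in>J. c t *\<^sub>R \<iota> (indicator {0..<t}) | J c. finite J \<and> J \<subseteq> {0..T}}"
    unfolding is_Lambda_dense[OF L, symmetric] by (rule closure_mono) force
  then have dense: "closure {\<Sum>t\<in>J. c t *\<^sub>R \<iota> (indicator {0..<t}) | J c. finite J \<and> J \<subseteq> {0..T}} = UNIV"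
    by blast
  have "\<exists>K. isometric_iso_L2 P (L2_closed_span P {0..T} X) K \<and>
      (\<forall>t\<in>{0..T}. AE \<omega> in P. K (\<iota> (indicator {0..<t})) \<omega> = X t \<omega>)"
    by (rule closed_span_isometry_exists[OF finite_measure_axioms volterra_L2(1)[OF X] gram dense])
  then have "\<exists>K. isometric_iso_L2 P (L2_closed_span P {0..T} X) K \<and>
      (\<forall>t\<in>{0<..T}. AE \<omega> in P. K (\<iota> (indicator {0..<t})) \<omega> = X t \<omega>)" by force
  then have *: "isometric_iso_L2 P (L2_closed_span P {0..T} X) (wiener_integral P T X \<iota>) \<and>
      (\<forall>t\<in>{0<..T}. AE \<omega> in P. wiener_integral P T X \<iota> (\<iota> (indicator {0..<t})) \<omega> = X t \<omega>)"
    unfolding wiener_integral_def by (rule someI_ex)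
  then show iso: "isometric_iso_L2 P (L2_closed_span P {0..T} X) (wiener_integral P T X \<iota>)" by simp
  assume t: "t \<in> {0..T}"
  show "AE \<omega> in P. wiener_integral P T X \<iota> (\<iota> (indicator {0..<t})) \<omega> = X t \<omega>"
  proof (cases "t = 0")
    case True
    from iso_eq_0_AE[OF iso e0] volterra_starts_at_0[OF T P W X] show ?thesis
      by eventually_elim (simp only: True)
  qed (use * t in auto)
qed

text \<open>A linear combination of the integrals of \<open>h\<^sub>t\<close> is the integral of the combination, hence a member of the closed
  span of \<open>X\<close>, whose members are all Gaussian.\<close>

lemma wiener_integral_embedding:
  fixes \<iota> :: "(real \<Rightarrow> real) \<Rightarrow> 'h::{real_inner, complete_space}"
  assumes T: "T > 0" and P: "prob_space P" and W: "brownian_motion P T W"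
    and X: "volterra_gaussian P T W z X" and L: "is_Lambda P T X \<iota>"
    and Y: "\<And>t. t \<in> {0..T} \<Longrightarrow> Y t \<in> borel_measurable P"
      "\<And>t. t \<in> {0..T} \<Longrightarrow> AE \<omega> in P. wiener_integral P T X \<iota> (h t) \<omega> = Y t \<omega>"
  shows "gaussian_embedding P T h Y"
  unfolding gaussian_embedding_def
proof (intro conjI ballI allI impI)
  let ?K = "wiener_integral P T X \<iota>"
  note iso = wiener_integral_isometry(1)[OF T P W X L]
  show "Y t \<in> L2 P" if "t \<in> {0..T}" for t
    by (rule L2_cong_AE[OF iso_L2[OF iso] Y(1)[OF that] Y(2)[OF that]])
  fix J and c :: "real \<Rightarrow> real" assume J: "finite J \<and> J \<subseteq> {0..T}"
  have "gaussian_char P ((L2_norm P (?K (\<Sum>t\<in>J. c t *\<^sub>R h t)))\<^sup>2) (?K (\<Sum>t\<in>J. c t *\<^sub>R h t))"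
    by (rule closed_span_gaussian[OF P volterra_L2(1)[OF X] volterra_gaussian_char(1)[OF P W X] iso_range[OF iso]])
  then have G: "gaussian_char P ((norm (\<Sum>t\<in>J. c t *\<^sub>R h t))\<^sup>2) (?K (\<Sum>t\<in>J. c t *\<^sub>R h t))"
    unfolding iso_norm[OF iso] .
  show "gaussian_char P ((norm (\<Sum>t\<in>J. c t *\<^sub>R h t))\<^sup>2) (\<lambda>\<omega>. \<Sum>t\<in>J. c t * Y t \<omega>)"
  proof (rule gaussian_char_cong_AE[OF G])
    show "(\<lambda>\<omega>. \<Sum>t\<in>J. c t * Y t \<omega>) \<in> borel_measurable P"
      using J Y(1) by (intro borel_measurable_sum borel_measurable_times) auto
    have "AE \<omega> in P. \<forall>t\<in>J. ?K (h t) \<omega> = Y t \<omega>"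
      using J Y(2) by (intro AE_finite_allI) auto
    with iso_sum[OF iso, of J c h] J
    show "AE \<omega> in P. ?K (\<Sum>t\<in>J. c t *\<^sub>R h t) \<omega> = (\<Sum>t\<in>J. c t * Y t \<omega>)"
      by (auto elim!: eventually_elim2)
  qed
qed

theorem theorem4p4:
  fixes T :: real
    and P :: "(real \<Rightarrow> real) measure"
    and W :: "real \<Rightarrow> (real \<Rightarrow> real) \<Rightarrow> real"
    and z :: "real \<Rightarrow> real \<Rightarrow> real"
    and \<iota> :: "(real \<Rightarrow> real) \<Rightarrow> 'h::{real_inner, complete_space}"
    and i :: nat
  assumes "T > 0"
    and "coordinate_space T P"
    and "brownian_motion P T W"
    and "volterra_gaussian P T W z coord"
    and "nondegenerate_kernel T z"
    and "AE s in lebesgue_on {0..T}. z T s \<noteq> 0"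
    and "\<forall>s\<in>{0<..<T}. \<forall>u\<in>{s<..<T}. bounded_variation_on u T (\<lambda>t. z t s)"
    and "\<forall>t\<in>{0<..T}. \<exists>f\<in>Lambda_check T z.
           AE s in lebesgue_on {0<..<T}. K_op T z f s = z T s * indicator {0..<t} s"
    and "is_Lambda P T coord \<iota>"
    and "i \<in> {1, 2}"
  shows "path_law P T (T_process i P T z coord \<iota>) = path_law P T coord \<and>
         centered_gaussian_process P T (T_process i P T z coord \<iota>) \<and>
         (AE \<omega> in P. T_process i P T z coord \<iota> 0 \<omega> = 0) \<and>
         (\<forall>s\<in>{0..T}. \<forall>t\<in>{0..T}. cov P (T_process i P T z coord \<iota>) s t = cov P coord s t) \<and>
         is_bridge P T coord (B_process i P T z coord \<iota>)"
proof -
  note T = assms(1) and W = assms(3) and X = assms(4) and nd = assms(5) and nz = assms(6)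
    and L = assms(9) and i = assms(10)
  have P: "prob_space P"
    using assms(2) unfolding coordinate_space_def by (auto intro: prob_space.prob_space_completion)
  have TT: "T \<in> {0..T}" "T \<in> {0<..T}" "0 \<in> {0..T}" using T by auto
  interpret bracket_kernel T z
    by unfold_locales (use T volterra_L2(2)[OF X TT(1)] nz in auto)
  define e where "e t = \<iota> (indicator {0..<t})" for t
  let ?\<kappa> = "kappa T z \<iota>" and ?K = "wiener_integral P T coord \<iota>"
  note \<kappa> = kappa_isometry(1)[OF T P W X nd nz L] and \<kappa>_e = kappa_isometry(2)[OF T P W X nd nz L, folded e_def]
  note K = wiener_integral_isometry(1)[OF T P W X L] and K_e = wiener_integral_isometry(2)[OF T P W X L, folded e_def]
  have \<kappa>L: "?\<kappa> h \<in> L2 \<mu>" for h by (rule iso_L2[OF \<kappa>])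
  have \<kappa>m: "?\<kappa> h \<in> borel_measurable \<mu>" for h using \<kappa>L by (rule L2_D)
  have pull: "kappa_inv T z \<iota> f \<bullet> kappa_inv T z \<iota> g = (LINT s|\<mu>. f s * g s)"
    if f: "f \<in> L2 \<mu>" and g: "g \<in> L2 \<mu>" for f g
  proof -
    have "kappa_inv T z \<iota> f \<bullet> kappa_inv T z \<iota> g =
        (LINT s|\<mu>. ?\<kappa> (kappa_inv T z \<iota> f) s * ?\<kappa> (kappa_inv T z \<iota> g) s)"
      by (rule iso_inner[OF \<kappa>, symmetric])
    also have "\<dots> = (LINT s|\<mu>. f s * g s)"
    proof (rule integral_cong_AE)
      show "AE s in \<mu>. ?\<kappa> (kappa_inv T z \<iota> f) s * ?\<kappa> (kappa_inv T z \<iota> g) s = f s * g s"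
        using iso_the[OF \<kappa> f] iso_the[OF \<kappa> g] unfolding kappa_inv_def by eventually_elim simp
    qed (use \<kappa>m f g in \<open>auto intro!: borel_measurable_times dest: L2_D\<close>)
    finally show ?thesis .
  qed
  have beta: "beta_X i T z \<iota> g \<bullet> beta_X i T z \<iota> h = g \<bullet> h" for g h
    unfolding beta_X_def pull[OF operators_isometry(1)[OF i \<kappa>L] operators_isometry(1)[OF i \<kappa>L]]
      operators_isometry(3)[OF i \<kappa>L \<kappa>L] by (rule iso_inner[OF \<kappa>])
  have mean: "(LINT s|\<mu>. ?\<kappa> h s) = h \<bullet> e T" for h
  proof -
    have "(LINT s|\<mu>. ?\<kappa> h s) = (LINT s|\<mu>. ?\<kappa> h s * ?\<kappa> (e T) s)"
    proof (rule integral_cong_AE)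
      have "AE s in \<mu>. z T s \<noteq> 0" using nz by (simp add: AE_d_bracket)
      with \<kappa>_e[OF TT(2)] show "AE s in \<mu>. ?\<kappa> h s = ?\<kappa> h s * ?\<kappa> (e T) s"
        by eventually_elim simp
    qed (use \<kappa>m in \<open>auto intro!: borel_measurable_times\<close>)
    then show ?thesis by (simp add: iso_inner[OF \<kappa>])
  qed
  have eTT: "br T = e T \<bullet> e T"
  proof -
    have "e T \<bullet> e T = cov P coord T T" using L TT(2) by (simp add: is_Lambda_def e_def)
    also have "\<dots> = br T"
      using volterra_covariance(3)[OF P W X TT(1) TT(1)] by (simp add: bracket_def power2_eq_square)
    finally show ?thesis ..
  qed
  have alpha: "alpha_X i T z \<iota> g \<bullet> alpha_X i T z \<iota> h = g \<bullet> h - (g \<bullet> e T) * (h \<bullet> e T) / br T" for g h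
    unfolding alpha_X_def pull[OF operators_isometry(2)[OF i \<kappa>L] operators_isometry(2)[OF i \<kappa>L]]
      operators_isometry(4)[OF i \<kappa>L \<kappa>L] mean iso_inner[OF \<kappa>] ..
  have Km: "?K h \<in> borel_measurable P" for h using iso_L2[OF K] by (rule L2_D)
  have Xm: "coord t \<in> borel_measurable P" if "t \<in> {0..T}" for t
    using volterra_L2(1)[OF X that] by (rule L2_D)
  have embX: "gaussian_embedding P T e coord"
    by (rule wiener_integral_embedding[OF T P W X L Xm K_e])
  have embT: "gaussian_embedding P T (\<lambda>t. beta_X i T z \<iota> (e t)) (T_process i P T z coord \<iota>)"
    by (rule wiener_integral_embedding[OF T P W X L]) (simp_all add: T_process_def e_def[symmetric] Km)
  have embB: "gaussian_embedding P T (\<lambda>t. alpha_X i T z \<iota> (e t)) (B_process i P T z coord \<iota>)"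
    by (rule wiener_integral_embedding[OF T P W X L]) (simp_all add: B_process_def e_def[symmetric] Km)
  have "path_law P T (T_process i P T z coord \<iota>) = path_law P T coord"
    by (rule path_law_cong_Gram[OF P embT embX beta])
  moreover have "centered_gaussian_process P T (T_process i P T z coord \<iota>)"
    by (rule gaussian_embedding_centered(1)[OF P embT])
  moreover have "AE \<omega> in P. T_process i P T z coord \<iota> 0 \<omega> = 0"
  proof -
    have "e 0 = 0"
      using is_Lambda_sum[OF L, of "{}"] by (simp add: e_def indicator_def[abs_def])
    then have "beta_X i T z \<iota> (e 0) = 0" using beta[of "e 0" "e 0"] by simp
    then show ?thesis unfolding T_process_def e_def[symmetric] by (rule iso_eq_0_AE[OF K])
  qed
  moreover have "cov P (T_process i P T z coord \<iota>) s t = cov P coord s t"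
    if "s \<in> {0..T}" "t \<in> {0..T}" for s t
    using gaussian_embedding_centered(2)[OF P embT that] gaussian_embedding_centered(2)[OF P embX that] beta
    by simp
  moreover have "is_bridge P T coord (B_process i P T z coord \<iota>)"
  proof (rule bridge_by_covariance[OF P T embX embB eTT])
    show "0 < br T" by (rule bracket_T_pos)
    \<comment> \<open>\<open>\<alpha>\<close> annihilates constants, and \<open>\<kappa> e\<^sub>T\<close> is the constant \<open>1\<close>.\<close>
    have "alpha_X i T z \<iota> (e T) \<bullet> alpha_X i T z \<iota> (e T) = 0"
      unfolding alpha using bracket_T_pos by (simp add: eTT[symmetric])
    then have "alpha_X i T z \<iota> (e T) = 0" by simp
    then show "AE \<omega> in P. B_process i P T z coord \<iota> T \<omega> = 0"
      unfolding B_process_def e_def[symmetric] by (rule iso_eq_0_AE[OF K])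
  qed (rule alpha)
  ultimately show ?thesis by blast
qed

end
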